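(* Let $\mathcal{R}$ be a commutative ring and let $F=\{F_n:\mathbb{Z}\to\mathcal{R}\}_{n\ge 0}$ be any admissible family of functions. Then the weighted graded root $(R_{[k]},\chi_{[k]},P_{F,[k]})$ is an invariant of the negative definite plumbed $3$-manifold $Y(\Gamma)$ equipped with the $\mathrm{spin}^c$ structure $[k]$. Explicitly: let $\Gamma_1,\Gamma_2$ be negative definite plumbing trees related by a finite sequence of type (a) and type (b) Neumann moves and their inverses (equivalently, representing the same $3$-manifold), and let $[k_1]$, $[k_2]$ be $\mathrm{spin}^c$ structures for $\Gamma_1,\Gamma_2$ that correspond to each other under the composition of the bijections $\alpha^{\pm1}$ associated with these moves. Then, for any choice of representatives $k_1\in[k_1]$ and $k_2\in[k_2]$ used in the construction, the weighted graded roots $(R_{[k_1]},\chi_{[k_1]},P_{F,[k_1]})$ and $(R_{[k_2]},\chi_{[k_2]},P_{F,[k_2]})$ are isomorphic.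
   Context: **Plumbings.** A plumbing tree $\Gamma$ is a finite tree with vertices $v_1,\dots,v_s$ and integer weights $m_i=m(v_i)$. Let $\delta_i=\delta_{v_i}$ be the degree of $v_i$, $m=(m_1,\dots,m_s)$, $\delta=(\delta_1,\dots,\delta_s)$. The matrix $M$ is the symmetric $s\times s$ matrix with $M_{ii}=m_i$, $M_{ij}=1$ if $i\ne j$ and $v_i,v_j$ are adjacent, and $0$ otherwise. $\Gamma$ is negative definite if $M$ is. $Y(\Gamma)$ is the $3$-manifold obtained by surgery on the framed link with one unknot of framing $m(v)$ for each vertex $v$, adjacent vertices giving Hopf-linked unknots. Write $\langle x,y\rangle=x^tMy$, $\cdot$ for the dot product, $u=(1,\dots,1)$ (so $Mu=m+\delta$), and $x^2:=x^tM^{-1}x$ when applied to $x=k-Mu$. $\mathrm{Spin}^c$ structures on $Y(\Gamma)$ are identified with classes $[k]\in (m+2\mathbb{Z}^s)/2M\mathbb{Z}^s$, $k\in m+2\mathbb{Z}^s$. **Neumann moves.** Type (a): $\Gamma$ has an edge joining $v_1,v_2$; $\Gamma'$ is obtained by replacing this edge by a path $v_1',v_0',v_2'$, where the new vertex $v_0'$ has weight $-1$ and $v_1',v_2'$ have weights $m_1-1,m_2-1$ (all else unchanged). Type (b): $\Gamma'$ is obtained by attaching a new leaf $v_0'$ of weight $-1$ to $v_1$, and changing the weight of $v_1$ to $m_1-1$. The vertices of $\Gamma'$ are ordered $v_0',v_1',\dots,v_s'$. By a theorem of Neumann, two negative definite plumbing trees represent the same $3$-manifold if and only if they are related by a finite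 sequence of such moves and their inverses. The bijection $\alpha$ from $(m+2\mathbb{Z}^s)/2M\mathbb{Z}^s$ to $(m'+2\mathbb{Z}^{s+1})/2M'\mathbb{Z}^{s+1}$ is $[k]\mapsto[k']$, with $k'=(0,k)+(1,-1,-1,0,\dots,0)$ for type (a) and $k'=(0,k)+(-1,1,0,\dots,0)$ for type (b). **Admissible families.** $F=\{F_n:\mathbb{Z}\to\mathcal{R}\}_{n\ge0}$ is admissible if (A1) $F_2(0)=1$ and $F_2(r)=0$ for $r\ne0$; (A2) $F_n(r+1)-F_n(r-1)=F_{n-1}(r)$ for all $n\ge1$, $r\in\mathbb{Z}$. Given $F$, define $F_{\Gamma,k}:\mathbb{Z}^s\to\mathcal{R}$ by $F_{\Gamma,k}(x)=\prod_{v}F_{\delta_v}\big((2Mx+k-Mu)_v\big)$, the product over all vertices $v$ of $\Gamma$, $(-)_v$ denoting the $v$-component. **Graded root.** For $k\in m+2\mathbb{Z}^s$ put $\chi_k(x)=-(k\cdot x+\langle x,x\rangle)/2\in\mathbb{Z}$ for $x\in\mathbb{Z}^s$. Give $\mathbb{R}^s$ the standard cubical complex structure with $0$-cells $\mathbb{Z}^s$, and let $\chi_k(\square)$ be the maximum of $\chi_k$ over the $0$-cells of the closed cell $\square$. The sublevel set $S_j$ is the subcomplex of cells with $\chi_k(\square)\le j$ (it is compact). The graded root $(R_k,\chi_k)$ is the infinite tree whose vertices are the connected components $C$ of the $S_j$, $j\in\mathbb{Z}$, with a component of $S_j$ given grading $j$ (components of different $S_j$ being different vertices), and with an edge joining a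 component $C$ of $S_j$ and a component $C'$ of $S_{j+1}$ whenever $C\subseteq C'$. **Weights.** Let $\Delta_k=-\frac{(k-Mu)^2+3s+\sum_v m_v}{4}$, $\Theta_k=\frac{k\cdot u-\langle u,u\rangle}{2}$, $\varepsilon_k(x)=\Delta_k+2\chi_k(x)+\langle x,u\rangle$, $\theta_k(x)=\Theta_k+\langle x,u\rangle$. The vertex $C$ is given the weight $P_{F,k}(C)=\sum_{x\in C\cap\mathbb{Z}^s}F_{\Gamma,k}(x)\,q^{\varepsilon_k(x)}t^{\theta_k(x)}\in q^{\Delta_k}\cdot\mathcal{R}[q^{\pm1},t^{\pm1}]$. $(R_{[k]},\chi_{[k]},P_{F,[k]})$ denotes $(R_k,\chi_k)$ for a representative $k\in[k]$, with the grading shifted so that its minimal value is $0$, equipped with the weights $P_{F,k}$. An isomorphism of weighted graded roots is a graph isomorphism preserving gradings and weights. *)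

theory Defs
  imports "HOL-Analysis.Analysis" "HOL-Library.Poly_Mapping"
begin

section \<open>Plumbing trees\<close>

text \<open>
  The vertices of a plumbing form a finite subset of a type \<open>'v\<close>; an edge is the two-element
  set of its endpoints.  Values of the weight function outside the vertex set are irrelevant.
\<close>

record 'v plumbing =
  verts :: "'v set"
  edges :: "'v set set"
  wt :: "'v \<Rightarrow> int"

definition plumbing_tree :: "'v plumbing \<Rightarrow> bool" where
  "plumbing_tree \<Gamma> \<longleftrightarrow>
     finite (verts \<Gamma>) \<and> verts \<Gamma> \<noteq> {} \<and>
     (\<forall>e\<in>edges \<Gamma>. \<exists>v\<in>verts \<Gamma>. \<exists>w\<in>verts \<Gamma>. v \<noteq> w \<and> e = {v, w}) \<and>
     (\<forall>v\<in>verts \<Gamma>. \<forall>w\<in>verts \<Gamma>. (v, w) \<in> {(a, b). {a, b} \<in> edges \<Gamma>}\<^sup>*) \<and>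
     \<not> (\<exists>c. distinct c \<and> 3 \<le> length c \<and>
            (\<forall>i<length c. {c ! i, c ! (Suc i mod length c)} \<in> edges \<Gamma>))"

definition vdeg :: "'v plumbing \<Rightarrow> 'v \<Rightarrow> nat" where
  "vdeg \<Gamma> v = card {w \<in> verts \<Gamma>. {v, w} \<in> edges \<Gamma>}"

definition plumbing_iso :: "('v \<Rightarrow> 'v) \<Rightarrow> 'v plumbing \<Rightarrow> 'v plumbing \<Rightarrow> bool" where
  "plumbing_iso f \<Gamma> \<Gamma>' \<longleftrightarrow>
     bij_betw f (verts \<Gamma>) (verts \<Gamma>') \<and>
     (\<forall>v\<in>verts \<Gamma>. \<forall>w\<in>verts \<Gamma>. {f v, f w} \<in> edges \<Gamma>' \<longleftrightarrow> {v, w} \<in> edges \<Gamma>) \<and>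
     (\<forall>v\<in>verts \<Gamma>. wt \<Gamma>' (f v) = wt \<Gamma> v)"


section \<open>Vectors and matrices indexed by the vertices\<close>

text \<open>
  With \<open>s\<close> the number of vertices, \<open>A\<^sup>s\<close> is the set of functions from \<open>'v\<close> to \<open>A\<close> that
  vanish outside the vertex set, and \<open>s \<times> s\<close> matrices are binary functions that vanish
  unless both indices are vertices.
\<close>

definition vecs :: "'v plumbing \<Rightarrow> ('v \<Rightarrow> 'a::zero) set" where
  "vecs \<Gamma> = {x. \<forall>v. v \<notin> verts \<Gamma> \<longrightarrow> x v = 0}"

definition dotp :: "'v plumbing \<Rightarrow> ('v \<Rightarrow> 'a::comm_ring_1) \<Rightarrow> ('v \<Rightarrow> 'a) \<Rightarrow> 'a" where
  "dotp \<Gamma> x y = (\<Sum>v\<in>verts \<Gamma>. x v * y v)"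

definition mat_vec :: "'v plumbing \<Rightarrow> ('v \<Rightarrow> 'v \<Rightarrow> 'a::comm_ring_1) \<Rightarrow> ('v \<Rightarrow> 'a) \<Rightarrow> 'v \<Rightarrow> 'a" where
  "mat_vec \<Gamma> A x = (\<lambda>v. \<Sum>w\<in>verts \<Gamma>. A v w * x w)"

definition mat_mat ::
  "'v plumbing \<Rightarrow> ('v \<Rightarrow> 'v \<Rightarrow> 'a::comm_ring_1) \<Rightarrow> ('v \<Rightarrow> 'v \<Rightarrow> 'a) \<Rightarrow> 'v \<Rightarrow> 'v \<Rightarrow> 'a" where
  "mat_mat \<Gamma> A B = (\<lambda>v w. \<Sum>u\<in>verts \<Gamma>. A v u * B u w)"

definition id_mat :: "'v plumbing \<Rightarrow> 'v \<Rightarrow> 'v \<Rightarrow> 'a::comm_ring_1" where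
  "id_mat \<Gamma> = (\<lambda>v w. if v \<in> verts \<Gamma> \<and> v = w then 1 else 0)"

definition plumb_mat :: "'v plumbing \<Rightarrow> 'v \<Rightarrow> 'v \<Rightarrow> 'a::comm_ring_1" where
  "plumb_mat \<Gamma> v w =
     (if v \<notin> verts \<Gamma> \<or> w \<notin> verts \<Gamma> then 0
      else if v = w then of_int (wt \<Gamma> v)
      else if {v, w} \<in> edges \<Gamma> then 1
      else 0)"

definition form :: "'v plumbing \<Rightarrow> ('v \<Rightarrow> 'a::comm_ring_1) \<Rightarrow> ('v \<Rightarrow> 'a) \<Rightarrow> 'a" where
  "form \<Gamma> x y = dotp \<Gamma> x (mat_vec \<Gamma> (plumb_mat \<Gamma>) y)"

definition negative_definite :: "'v plumbing \<Rightarrow> bool" where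
  "negative_definite \<Gamma> \<longleftrightarrow> (\<forall>x :: 'v \<Rightarrow> real. x \<in> vecs \<Gamma> \<and> x \<noteq> (\<lambda>_. 0) \<longrightarrow> form \<Gamma> x x < 0)"

text \<open>The inverse matrix is meaningful only if the plumbing matrix is invertible over \<open>\<rat>\<close>.\<close>

definition plumb_mat_inv :: "'v plumbing \<Rightarrow> 'v \<Rightarrow> 'v \<Rightarrow> rat" where
  "plumb_mat_inv \<Gamma> =
     (THE N. (\<forall>v w. v \<notin> verts \<Gamma> \<or> w \<notin> verts \<Gamma> \<longrightarrow> N v w = 0) \<and>
             mat_mat \<Gamma> (plumb_mat \<Gamma>) N = id_mat \<Gamma> \<and>
             mat_mat \<Gamma> N (plumb_mat \<Gamma>) = id_mat \<Gamma>)"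

definition ones :: "'v plumbing \<Rightarrow> 'v \<Rightarrow> int" where
  "ones \<Gamma> = (\<lambda>v. if v \<in> verts \<Gamma> then 1 else 0)"


section \<open>Spin-c structures\<close>

definition char_vecs :: "'v plumbing \<Rightarrow> ('v \<Rightarrow> int) set" where
  "char_vecs \<Gamma> = {k \<in> vecs \<Gamma>. \<forall>v\<in>verts \<Gamma>. even (k v - wt \<Gamma> v)}"

definition spinc_class :: "'v plumbing \<Rightarrow> ('v \<Rightarrow> int) \<Rightarrow> ('v \<Rightarrow> int) set" where
  "spinc_class \<Gamma> k = {\<lambda>v. k v + 2 * mat_vec \<Gamma> (plumb_mat \<Gamma>) x v | x. x \<in> vecs \<Gamma>}"

definition spinc :: "'v plumbing \<Rightarrow> ('v \<Rightarrow> int) set set" where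
  "spinc \<Gamma> = spinc_class \<Gamma> ` char_vecs \<Gamma>"


section \<open>Neumann moves\<close>

definition edge_move :: "'v plumbing \<Rightarrow> 'v \<Rightarrow> 'v \<Rightarrow> 'v \<Rightarrow> 'v plumbing" where
  "edge_move \<Gamma> v1 v2 v0 =
     \<lparr>verts = insert v0 (verts \<Gamma>),
      edges = (edges \<Gamma> - {{v1, v2}}) \<union> {{v1, v0}, {v0, v2}},
      wt = (wt \<Gamma>)(v0 := - 1, v1 := wt \<Gamma> v1 - 1, v2 := wt \<Gamma> v2 - 1)\<rparr>"

definition edge_move_vec :: "'v \<Rightarrow> 'v \<Rightarrow> 'v \<Rightarrow> ('v \<Rightarrow> int) \<Rightarrow> 'v \<Rightarrow> int" where
  "edge_move_vec v1 v2 v0 k = k(v0 := 1, v1 := k v1 - 1, v2 := k v2 - 1)"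

definition leaf_move :: "'v plumbing \<Rightarrow> 'v \<Rightarrow> 'v \<Rightarrow> 'v plumbing" where
  "leaf_move \<Gamma> v1 v0 =
     \<lparr>verts = insert v0 (verts \<Gamma>),
      edges = insert {v1, v0} (edges \<Gamma>),
      wt = (wt \<Gamma>)(v0 := - 1, v1 := wt \<Gamma> v1 - 1)\<rparr>"

definition leaf_move_vec :: "'v \<Rightarrow> 'v \<Rightarrow> ('v \<Rightarrow> int) \<Rightarrow> 'v \<Rightarrow> int" where
  "leaf_move_vec v1 v0 k = k(v0 := - 1, v1 := k v1 + 1)"

text \<open>
  One step relates a plumbing tree with a chosen spin-c structure to the result of a move with
  the corresponding spin-c structure.  Since a move only fixes the new tree up to the names of
  its vertices, renaming the vertices also counts as a step.
\<close>

inductive neumann_step ::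
  "'v plumbing \<times> ('v \<Rightarrow> int) set \<Rightarrow> 'v plumbing \<times> ('v \<Rightarrow> int) set \<Rightarrow> bool" where
  type_a: "neumann_step (\<Gamma>, spinc_class \<Gamma> k)
             (edge_move \<Gamma> v1 v2 v0, spinc_class (edge_move \<Gamma> v1 v2 v0) (edge_move_vec v1 v2 v0 k))"
    if "plumbing_tree \<Gamma>" "{v1, v2} \<in> edges \<Gamma>" "v0 \<notin> verts \<Gamma>" "k \<in> char_vecs \<Gamma>"
| type_b: "neumann_step (\<Gamma>, spinc_class \<Gamma> k)
             (leaf_move \<Gamma> v1 v0, spinc_class (leaf_move \<Gamma> v1 v0) (leaf_move_vec v1 v0 k))"
    if "plumbing_tree \<Gamma>" "v1 \<in> verts \<Gamma>" "v0 \<notin> verts \<Gamma>" "k \<in> char_vecs \<Gamma>"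
| rename: "neumann_step (\<Gamma>, spinc_class \<Gamma> k) (\<Gamma>', spinc_class \<Gamma>' k')"
    if "plumbing_tree \<Gamma>" "plumbing_tree \<Gamma>'" "plumbing_iso f \<Gamma> \<Gamma>'"
      "k \<in> char_vecs \<Gamma>" "k' \<in> char_vecs \<Gamma>'" "\<forall>v\<in>verts \<Gamma>. k' (f v) = k v"

definition neumann_equiv ::
  "'v plumbing \<times> ('v \<Rightarrow> int) set \<Rightarrow> 'v plumbing \<times> ('v \<Rightarrow> int) set \<Rightarrow> bool" where
  "neumann_equiv = equivclp neumann_step"


section \<open>Admissible families\<close>

text \<open>
  The sort of the coefficient type is that of commutative rings with unit; unlike
  \<^class>\<open>comm_ring_1\<close> it admits the zero ring.
\<close>

definition admissible :: "(nat \<Rightarrow> int \<Rightarrow> 'r::{comm_ring, comm_monoid_mult}) \<Rightarrow> bool" where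
  "admissible F \<longleftrightarrow>
     F 2 0 = 1 \<and> (\<forall>r. r \<noteq> 0 \<longrightarrow> F 2 r = 0) \<and>
     (\<forall>n\<ge>1. \<forall>r. F n (r + 1) - F n (r - 1) = F (n - 1) r)"

definition F_vec ::
  "(nat \<Rightarrow> int \<Rightarrow> 'r::{comm_ring, comm_monoid_mult}) \<Rightarrow> 'v plumbing \<Rightarrow> ('v \<Rightarrow> int) \<Rightarrow> ('v \<Rightarrow> int) \<Rightarrow> 'r" where
  "F_vec F \<Gamma> k x =
     (\<Prod>v\<in>verts \<Gamma>. F (vdeg \<Gamma> v)
        (2 * mat_vec \<Gamma> (plumb_mat \<Gamma>) x v + k v - mat_vec \<Gamma> (plumb_mat \<Gamma>) (ones \<Gamma>) v))"


section \<open>Graded roots\<close>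

text \<open>For characteristic \<open>k\<close> the division is exact.\<close>

definition chi :: "'v plumbing \<Rightarrow> ('v \<Rightarrow> int) \<Rightarrow> ('v \<Rightarrow> int) \<Rightarrow> int" where
  "chi \<Gamma> k x = - ((dotp \<Gamma> k x + form \<Gamma> x x) div 2)"

text \<open>
  The closed cell with least vertex \<open>x\<close> that extends in the directions \<open>I\<close>.  Cells live in the
  space of all functions from \<open>'v\<close> to \<open>\<real>\<close>; its product topology induces the Euclidean topology
  on the functions supported on the finite vertex set.
\<close>

definition cube :: "('v \<Rightarrow> int) \<Rightarrow> 'v set \<Rightarrow> ('v \<Rightarrow> real) set" where
  "cube x I = {y. \<forall>v. y v \<in> (if v \<in> I then {real_of_int (x v)..real_of_int (x v) + 1}
                            else {real_of_int (x v)})}"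

definition cells :: "'v plumbing \<Rightarrow> ('v \<Rightarrow> real) set set" where
  "cells \<Gamma> = {cube x I | x I. x \<in> vecs \<Gamma> \<and> I \<subseteq> verts \<Gamma>}"

definition lattice_pts :: "'v plumbing \<Rightarrow> ('v \<Rightarrow> real) set \<Rightarrow> ('v \<Rightarrow> int) set" where
  "lattice_pts \<Gamma> S = {x \<in> vecs \<Gamma>. (\<lambda>v. real_of_int (x v)) \<in> S}"

definition chi_cell :: "'v plumbing \<Rightarrow> ('v \<Rightarrow> int) \<Rightarrow> ('v \<Rightarrow> real) set \<Rightarrow> int" where
  "chi_cell \<Gamma> k Q = Max (chi \<Gamma> k ` lattice_pts \<Gamma> Q)"

definition sublevel :: "'v plumbing \<Rightarrow> ('v \<Rightarrow> int) \<Rightarrow> int \<Rightarrow> ('v \<Rightarrow> real) set" where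
  "sublevel \<Gamma> k j = \<Union> {Q \<in> cells \<Gamma>. chi_cell \<Gamma> k Q \<le> j}"

text \<open>A node is a pair of its unshifted grading and a component of the sublevel set.\<close>

definition root_nodes :: "'v plumbing \<Rightarrow> ('v \<Rightarrow> int) \<Rightarrow> (int \<times> ('v \<Rightarrow> real) set) set" where
  "root_nodes \<Gamma> k = {(j, C). C \<in> components (sublevel \<Gamma> k j)}"

definition root_edges :: "'v plumbing \<Rightarrow> ('v \<Rightarrow> int) \<Rightarrow> (int \<times> ('v \<Rightarrow> real) set) set set" where
  "root_edges \<Gamma> k =
     {{(j, C), (j + 1, C')} | j C C'.
        (j, C) \<in> root_nodes \<Gamma> k \<and> (j + 1, C') \<in> root_nodes \<Gamma> k \<and> C \<subseteq> C'}"

definition Delta :: "'v plumbing \<Rightarrow> ('v \<Rightarrow> int) \<Rightarrow> rat" where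
  "Delta \<Gamma> k =
     (let y = (\<lambda>v. of_int (k v - mat_vec \<Gamma> (plumb_mat \<Gamma>) (ones \<Gamma>) v)) in
      - ((dotp \<Gamma> y (mat_vec \<Gamma> (plumb_mat_inv \<Gamma>) y)
          + 3 * of_nat (card (verts \<Gamma>)) + of_int (\<Sum>v\<in>verts \<Gamma>. wt \<Gamma> v)) / 4))"

definition epsilon :: "'v plumbing \<Rightarrow> ('v \<Rightarrow> int) \<Rightarrow> ('v \<Rightarrow> int) \<Rightarrow> rat" where
  "epsilon \<Gamma> k x = Delta \<Gamma> k + of_int (2 * chi \<Gamma> k x + form \<Gamma> x (ones \<Gamma>))"

text \<open>For characteristic \<open>k\<close> the division is exact.\<close>

definition Theta :: "'v plumbing \<Rightarrow> ('v \<Rightarrow> int) \<Rightarrow> int" where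
  "Theta \<Gamma> k = (dotp \<Gamma> k (ones \<Gamma>) - form \<Gamma> (ones \<Gamma>) (ones \<Gamma>)) div 2"

definition theta :: "'v plumbing \<Rightarrow> ('v \<Rightarrow> int) \<Rightarrow> ('v \<Rightarrow> int) \<Rightarrow> int" where
  "theta \<Gamma> k x = Theta \<Gamma> k + form \<Gamma> x (ones \<Gamma>)"

text \<open>
  Weights are finitely supported functions on \<open>\<rat> \<times> \<int>\<close>, the value at \<open>(a, b)\<close> being the
  coefficient of \<open>q\<^sup>a t\<^sup>b\<close>.  The sum is finite if the plumbing is negative definite.
\<close>

definition root_weight ::
  "(nat \<Rightarrow> int \<Rightarrow> 'r::{comm_ring, comm_monoid_mult}) \<Rightarrow> 'v plumbing \<Rightarrow> ('v \<Rightarrow> int) \<Rightarrow> ('v \<Rightarrow> real) set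
     \<Rightarrow> (rat \<times> int) \<Rightarrow>\<^sub>0 'r" where
  "root_weight F \<Gamma> k C =
     (\<Sum>x\<in>lattice_pts \<Gamma> C. Poly_Mapping.single (epsilon \<Gamma> k x, theta \<Gamma> k x) (F_vec F \<Gamma> k x))"

record ('n, 'w) weighted_graded_graph =
  nodes :: "'n set"
  links :: "'n set set"
  grading :: "'n \<Rightarrow> int"
  weight :: "'n \<Rightarrow> 'w"

text \<open>The gradings are shifted so that their minimum is \<open>0\<close>.\<close>

definition weighted_graded_root ::
  "(nat \<Rightarrow> int \<Rightarrow> 'r::{comm_ring, comm_monoid_mult}) \<Rightarrow> 'v plumbing \<Rightarrow> ('v \<Rightarrow> int)
     \<Rightarrow> (int \<times> ('v \<Rightarrow> real) set, (rat \<times> int) \<Rightarrow>\<^sub>0 'r) weighted_graded_graph" where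
  "weighted_graded_root F \<Gamma> k =
     \<lparr>nodes = root_nodes \<Gamma> k,
      links = root_edges \<Gamma> k,
      grading = (\<lambda>(j, C). j - Inf (fst ` root_nodes \<Gamma> k)),
      weight = (\<lambda>(j, C). root_weight F \<Gamma> k C)\<rparr>"

definition wgraph_isomorphic ::
  "('n, 'w) weighted_graded_graph \<Rightarrow> ('m, 'w) weighted_graded_graph \<Rightarrow> bool" where
  "wgraph_isomorphic R R' \<longleftrightarrow>
     (\<exists>f. bij_betw f (nodes R) (nodes R') \<and>
          (\<forall>a\<in>nodes R. \<forall>b\<in>nodes R. {f a, f b} \<in> links R' \<longleftrightarrow> {a, b} \<in> links R) \<and>
          (\<forall>a\<in>nodes R. grading R' (f a) = grading R a) \<and>
          (\<forall>a\<in>nodes R. weight R' (f a) = weight R a))"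

end

theory Submission
  imports Defs
begin

text \<open>
  The proof replaces every graded root by a combinatorial model. Regard the lattice
  \<open>vecs \<Gamma>\<close> as a graph whose edges are the unit steps along coordinate
  directions. A point \<open>y\<close> of a closed lattice cube has its coordinatewise floor among the
  corners of that cube, and any two corners of a cube are joined by unit steps through corners.
  Hence the components of a sublevel set of \<open>\<chi>\<^sub>k\<close> correspond to the connected
  components (here: clusters) of the induced subgraph on the lattice points of the sublevel set,
  compatibly with inclusions and weights. So the weighted graded root is the merge tree of the
  function \<open>\<chi>\<^sub>k\<close> on this graph (\<open>weighted_graded_root_iso_lattice_root\<close>).

  Merge trees are compared by a fibration criterion (\<open>merge_tree_iso\<close>): a map of graphs that
  does not increase the function, whose fibres are connected inside each sublevel set, along which
  vertices and edges lift without raising the level, and that pushes the weights forward, induces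
  an isomorphism of merge trees. A constant shift of the level is permitted.

  Both Neumann moves are blow-ups at a set \<open>A\<close> of vertices: the new vertex \<open>v\<^sub>0\<close>
  has weight \<open>-1\<close> and is joined to the vertices in \<open>A\<close>, and the matrix restricted to
  the old vertices loses \<open>1\<close> in each entry with both indices in \<open>A\<close>. For type (a)
  the set \<open>A\<close> consists of the two ends of the edge, for type (b) it is a single vertex. With
  \<open>d(x) = x(v\<^sub>0) - (\<Sum>v\<in>A. x v)\<close> the intersection form becomes
  \<open>\<langle>x, y\<rangle> - d(x) d(y)\<close>, and \<open>\<chi>\<close> becomes \<open>\<chi> + d (d - s) / 2\<close>, where \<open>s\<close> is
  \<open>1\<close> for type (a) and \<open>-1\<close> for type (b). Forgetting the coordinate at \<open>v\<^sub>0\<close>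
  satisfies the fibration criterion: on a fibre the function is a convex function of the integer
  \<open>d\<close> with minimum at \<open>d = 0\<close> and \<open>d = s\<close>. The weights push forward
  because of admissibility. For type (a) the factor \<open>F\<^sub>2\<close> at \<open>v\<^sub>0\<close> kills all points but
  \<open>d = 0\<close>; for type (b) the factor \<open>F\<^sub>1\<close> at \<open>v\<^sub>0\<close> is \<open>1\<close> at
  \<open>d = 0\<close>, \<open>-1\<close> at \<open>d = -1\<close> and \<open>0\<close> elsewhere, and the two remaining terms
  combine by the recursion for \<open>F\<close> at the vertex to which the leaf is attached.

  A change of representative \<open>k + 2Ma\<close> is the translation of the lattice by \<open>a\<close>, and a
  renaming of the vertices is a linear isomorphism. Both are bijective instances of the criterion.
  Negative definiteness makes sublevel sets finite, so that the sums and minima involved are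
  meaningful, and it makes the matrix invertible over \<open>\<rat>\<close>, so that \<open>\<Delta>\<^sub>k\<close> can be computed
  from any solution \<open>z\<close> of \<open>M z = k - M u\<close> (\<open>Delta_eq\<close>). It is preserved by all steps, so it
  holds for every plumbing between the two given ones.
\<close>

section \<open>Merge trees of integer-valued functions on graphs\<close>

text \<open>
  The sublevel set at level \<open>j\<close> of a function \<open>h\<close> on the vertex set \<open>L\<close> of a graph.
\<close>

definition sub_pts :: "'a set \<Rightarrow> ('a \<Rightarrow> int) \<Rightarrow> int \<Rightarrow> 'a set" where
  "sub_pts L h j = {x \<in> L. h x \<le> j}"

text \<open>
  Two vertices are related if a path in the graph with edge relation \<open>E\<close> joins them inside the
  sublevel set at level \<open>j\<close>. Every element of the type is related to itself, even outside \<open>L\<close>.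
\<close>

definition path_rel :: "'a set \<Rightarrow> 'a rel \<Rightarrow> ('a \<Rightarrow> int) \<Rightarrow> int \<Rightarrow> 'a rel" where
  "path_rel L E h j = (E \<inter> sub_pts L h j \<times> sub_pts L h j)\<^sup>*"

text \<open>
  The connected components of the subgraph induced on the sublevel set (for symmetric \<open>E\<close>).
\<close>

definition clusters :: "'a set \<Rightarrow> 'a rel \<Rightarrow> ('a \<Rightarrow> int) \<Rightarrow> int \<Rightarrow> 'a set set" where
  "clusters L E h j = (\<lambda>x. path_rel L E h j `` {x}) ` sub_pts L h j"

text \<open>
  The merge tree records how the components of the sublevel sets grow together. Its shape copies
  that of a weighted graded root: nodes are pairs of a level and a cluster, the grading is shifted
  to have minimum \<open>0\<close>, and the weight of a cluster is the sum of the weights \<open>w\<close> of its points.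
\<close>

definition merge_tree ::
  "'a set \<Rightarrow> 'a rel \<Rightarrow> ('a \<Rightarrow> int) \<Rightarrow> ('a \<Rightarrow> 'w::comm_monoid_add)
     \<Rightarrow> (int \<times> 'a set, 'w) weighted_graded_graph" where
  "merge_tree L E h w =
     \<lparr>nodes = {(j, K). K \<in> clusters L E h j},
      links = {{(j, K), (j + 1, K')} | j K K'.
                 K \<in> clusters L E h j \<and> K' \<in> clusters L E h (j + 1) \<and> K \<subseteq> K'},
      grading = (\<lambda>(j, K). j - Inf {i. clusters L E h i \<noteq> {}}),
      weight = (\<lambda>(j, K). \<Sum>x\<in>K. w x)\<rparr>"

lemma path_rel_refl [simp]: "(x, x) \<in> path_rel L E h j"
  by (simp add: path_rel_def)

lemma path_rel_trans:
  "(x, y) \<in> path_rel L E h j \<Longrightarrow> (y, z) \<in> path_rel L E h j \<Longrightarrow> (x, z) \<in> path_rel L E h j"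
  by (simp add: path_rel_def)

lemma path_rel_step:
  "(x, y) \<in> E \<Longrightarrow> x \<in> sub_pts L h j \<Longrightarrow> y \<in> sub_pts L h j \<Longrightarrow> (x, y) \<in> path_rel L E h j"
  by (auto simp: path_rel_def)

lemma path_rel_sym:
  assumes "sym E" "(x, y) \<in> path_rel L E h j"
  shows "(y, x) \<in> path_rel L E h j"
proof -
  have "sym (E \<inter> sub_pts L h j \<times> sub_pts L h j)"
    using assms(1) by (auto simp: sym_def)
  then show ?thesis
    using assms(2) unfolding path_rel_def by (meson symD sym_rtrancl)
qed

lemma path_rel_in_sub:
  assumes "(x, y) \<in> path_rel L E h j" "x \<in> sub_pts L h j"
  shows "y \<in> sub_pts L h j"
  using assms unfolding path_rel_def by (induction rule: rtrancl_induct) auto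

lemma path_rel_mono:
  assumes "j \<le> i" shows "path_rel L E h j \<subseteq> path_rel L E h i"
  unfolding path_rel_def by (rule rtrancl_mono) (use assms in \<open>auto simp: sub_pts_def\<close>)

lemma clusters_subset: "K \<in> clusters L E h j \<Longrightarrow> K \<subseteq> sub_pts L h j"
  by (auto simp: clusters_def dest: path_rel_in_sub)

lemma cluster_nonempty: "K \<in> clusters L E h j \<Longrightarrow> K \<noteq> {}"
  unfolding clusters_def using path_rel_refl by fast

lemma cluster_mem_iff:
  assumes "sym E" "K \<in> clusters L E h j" "x \<in> K"
  shows "y \<in> K \<longleftrightarrow> (x, y) \<in> path_rel L E h j"
  using assms by (auto simp: clusters_def intro: path_rel_trans dest: path_rel_sym)

lemma Inf_int_translate:
  fixes X Y :: "int set"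
  assumes X: "X \<noteq> {}" "bdd_below X" and XY: "\<And>j. j \<in> X \<longleftrightarrow> j + c \<in> Y"
  shows "Inf Y = Inf X + c"
proof (rule cInf_eq_non_empty)
  show "Y \<noteq> {}" using X(1) XY by auto
  show "Inf X + c \<le> y" if "y \<in> Y" for y
    using XY[of "y - c"] that cInf_lower[OF _ X(2), of "y - c"] by simp
  show "z \<le> Inf X + c" if "\<And>y. y \<in> Y \<Longrightarrow> z \<le> y" for z
    using cInf_greatest[OF X(1), of "z - c"] XY that by fastforce
qed

lemma merge_tree_links_iff:
  assumes "(j, K) \<in> nodes (merge_tree L E h w)" "(i, K') \<in> nodes (merge_tree L E h w)"
  shows "{(j, K), (i, K')} \<in> links (merge_tree L E h w) \<longleftrightarrow>
    (i = j + 1 \<and> K \<subseteq> K') \<or> (j = i + 1 \<and> K' \<subseteq> K)"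
  using assms by (auto simp: merge_tree_def doubleton_eq_iff)

lemma wgraph_isomorphic_sym:
  assumes "wgraph_isomorphic R R'"
  shows "wgraph_isomorphic R' R"
proof -
  from assms obtain f where f: "bij_betw f (nodes R) (nodes R')"
    and l: "\<forall>a\<in>nodes R. \<forall>b\<in>nodes R. {f a, f b} \<in> links R' \<longleftrightarrow> {a, b} \<in> links R"
    and g: "\<forall>a\<in>nodes R. grading R' (f a) = grading R a"
    and w: "\<forall>a\<in>nodes R. weight R' (f a) = weight R a"
    unfolding wgraph_isomorphic_def by blast
  define h where "h = inv_into (nodes R) f"
  have h: "bij_betw h (nodes R') (nodes R)"
    unfolding h_def by (rule bij_betw_inv_into[OF f])
  have fh: "h a \<in> nodes R" "f (h a) = a" if "a \<in> nodes R'" for a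
    using that f unfolding h_def by (auto simp: bij_betw_def f_inv_into_f inv_into_into)
  show ?thesis unfolding wgraph_isomorphic_def
    by (rule exI[of _ h]) (use h fh l g w in metis)
qed

lemma wgraph_isomorphic_trans:
  assumes "wgraph_isomorphic R R'" "wgraph_isomorphic R' R''"
  shows "wgraph_isomorphic R R''"
proof -
  from assms(1) obtain f where f: "bij_betw f (nodes R) (nodes R')"
    "\<forall>a\<in>nodes R. \<forall>b\<in>nodes R. {f a, f b} \<in> links R' \<longleftrightarrow> {a, b} \<in> links R"
    "\<forall>a\<in>nodes R. grading R' (f a) = grading R a"
    "\<forall>a\<in>nodes R. weight R' (f a) = weight R a"
    unfolding wgraph_isomorphic_def by blast
  from assms(2) obtain g where g: "bij_betw g (nodes R') (nodes R'')"
    "\<forall>a\<in>nodes R'. \<forall>b\<in>nodes R'. {g a, g b} \<in> links R'' \<longleftrightarrow> {a, b} \<in> links R'"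
    "\<forall>a\<in>nodes R'. grading R'' (g a) = grading R' a"
    "\<forall>a\<in>nodes R'. weight R'' (g a) = weight R' a"
    unfolding wgraph_isomorphic_def by blast
  have "f a \<in> nodes R'" if "a \<in> nodes R" for a
    using that f(1) by (auto simp: bij_betw_def)
  then show ?thesis unfolding wgraph_isomorphic_def
    by (intro exI[of _ "g \<circ> f"])
      (use f g bij_betw_trans[OF f(1) g(1)] in auto)
qed

text \<open>
  The fibration criterion. The map \<open>p\<close> from the primed to the unprimed graph induces a bijection
  between the clusters at level \<open>j\<close> and those at level \<open>j + c\<close>: paths map down by \<open>p\<close> and \<open>edge\<close>,
  and they lift by \<open>lift\<close>, where consecutive lifted edges are connected through the \<open>fibre\<close> over
  their common endpoint. The hypothesis \<open>wt\<close> is needed only for the part of a fibre that lies in a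
  sublevel set, which for infinite fibres is all that can be summed.
\<close>

lemma merge_tree_iso:
  fixes p :: "'b \<Rightarrow> 'a" and c :: int
  assumes sym: "sym E" and sym': "sym E'"
    and fin': "\<And>j. finite (sub_pts L' h' j)"
    and ne: "L' \<noteq> {}"
    and p: "\<And>x'. x' \<in> L' \<Longrightarrow> p x' \<in> L \<and> h (p x') \<le> h' x' + c"
    and surj: "\<And>x. x \<in> L \<Longrightarrow> \<exists>x'\<in>L'. p x' = x \<and> h' x' + c = h x"
    and edge: "\<And>x' y'. x' \<in> L' \<Longrightarrow> y' \<in> L' \<Longrightarrow> (x', y') \<in> E' \<Longrightarrow> p x' = p y' \<or> (p x', p y') \<in> E"
    and lift: "\<And>x y. x \<in> L \<Longrightarrow> y \<in> L \<Longrightarrow> (x, y) \<in> E \<Longrightarrow>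
      \<exists>x'\<in>L'. \<exists>y'\<in>L'. p x' = x \<and> p y' = y \<and> h' x' + c = h x \<and> h' y' + c = h y \<and> (x', y') \<in> E'"
    and fibre: "\<And>x' y'. x' \<in> L' \<Longrightarrow> y' \<in> L' \<Longrightarrow> p x' = p y' \<Longrightarrow>
      (x', y') \<in> path_rel L' E' h' (max (h' x') (h' y'))"
    and wt: "\<And>x j. x \<in> L \<Longrightarrow> h x \<le> j + c \<Longrightarrow> (\<Sum>x'\<in>{x'\<in>sub_pts L' h' j. p x' = x}. w' x') = w x"
  shows "wgraph_isomorphic (merge_tree L' E' h' w') (merge_tree L E h w)"
proof -
  let ?S = "sub_pts L h" and ?S' = "sub_pts L' h'"
  let ?P = "path_rel L E h" and ?P' = "path_rel L' E' h'"
  let ?C = "clusters L E h" and ?C' = "clusters L' E' h'"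
  have pS: "p x' \<in> ?S (j + c)" if "x' \<in> ?S' j" for x' j
    using that p[of x'] by (auto simp: sub_pts_def)
  have over: "\<exists>x'\<in>?S' j. p x' = x" if "x \<in> ?S (j + c)" for x j
    using that surj[of x] by (auto simp: sub_pts_def)
  have fib: "(x', y') \<in> ?P' j" if "x' \<in> ?S' j" "y' \<in> ?S' j" "p x' = p y'" for x' y' j
    using fibre[of x' y'] path_rel_mono[of "max (h' x') (h' y')" j L' E' h'] that
    by (auto simp: sub_pts_def)
  have down: "(p x', p y') \<in> ?P (j + c)" if "(x', y') \<in> ?P' j" for x' y' j
    using that unfolding path_rel_def[of L']
  proof (induction rule: rtrancl_induct)
    case base
    then show ?case by simp
  next
    case (step y' z')
    then have yz: "y' \<in> ?S' j" "z' \<in> ?S' j" "(y', z') \<in> E'" by auto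
    then have "p y' = p z' \<or> (p y', p z') \<in> E"
      using edge[of y' z'] by (auto simp: sub_pts_def)
    then have "(p y', p z') \<in> ?P (j + c)"
      using path_rel_step[of "p y'" "p z'"] pS yz by fastforce
    with step.IH show ?case by (rule path_rel_trans)
  qed
  have up0: "\<forall>y'\<in>?S' j. p y' = y \<longrightarrow> (x', y') \<in> ?P' j"
    if "(x, y) \<in> ?P (j + c)" "x' \<in> ?S' j" "p x' = x" for x x' y j
    using that(1) unfolding path_rel_def[of L]
  proof (induction rule: rtrancl_induct)
    case base
    then show ?case using fib that by metis
  next
    case (step y z)
    then have yz: "y \<in> ?S (j + c)" "z \<in> ?S (j + c)" "(y, z) \<in> E" by auto
    then obtain y' z' where l: "y' \<in> L'" "z' \<in> L'" "p y' = y" "p z' = z"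
      "h' y' + c = h y" "h' z' + c = h z" "(y', z') \<in> E'"
      using lift[of y z] by (auto simp: sub_pts_def)
    then have S: "y' \<in> ?S' j" "z' \<in> ?S' j" using yz by (auto simp: sub_pts_def)
    have "(x', z') \<in> ?P' j"
      using step.IH S l path_rel_step[of y' z' E' L' h' j] by (blast intro: path_rel_trans)
    then show ?case using S l fib by (metis path_rel_trans)
  qed
  \<comment> \<open>The map \<open>p\<close> preserves and reflects connectedness inside sublevel sets.\<close>
  have key: "(x', y') \<in> ?P' j \<longleftrightarrow> (p x', p y') \<in> ?P (j + c)"
    if "x' \<in> ?S' j" "y' \<in> ?S' j" for x' y' j
    using that up0 down by blast
  have img: "p ` (?P' j `` {x'}) = ?P (j + c) `` {p x'}" if x': "x' \<in> ?S' j" for x' j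
  proof
    show "p ` (?P' j `` {x'}) \<subseteq> ?P (j + c) `` {p x'}" using down by auto
    show "?P (j + c) `` {p x'} \<subseteq> p ` (?P' j `` {x'})"
    proof
      fix y assume y: "y \<in> ?P (j + c) `` {p x'}"
      then have "y \<in> ?S (j + c)" using path_rel_in_sub pS[OF x'] by fast
      then obtain y' where "y' \<in> ?S' j" "p y' = y" using over by blast
      then show "y \<in> p ` (?P' j `` {x'})" using key[OF x'] y by auto
    qed
  qed
  have pC: "p ` K' \<in> ?C (j + c)" if "K' \<in> ?C' j" for K' j
    using that img pS by (auto simp: clusters_def)
  have mem: "p x' \<in> p ` K' \<longleftrightarrow> x' \<in> K'" if K': "K' \<in> ?C' j" and x': "x' \<in> ?S' j" for K' j x'
  proof
    assume "p x' \<in> p ` K'"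
    then obtain z' where z': "z' \<in> K'" "p x' = p z'" by auto
    then have "z' \<in> ?S' j" using clusters_subset K' by blast
    then have "(z', x') \<in> ?P' j" using fib x' z' by simp
    then show "x' \<in> K'" using cluster_mem_iff[OF sym' K' z'(1)] by simp
  qed auto
  have sub: "p ` K1 \<subseteq> p ` K2 \<longleftrightarrow> K1 \<subseteq> K2" if "K1 \<in> ?C' j" "K2 \<in> ?C' i" "j \<le> i" for K1 K2 i j
  proof -
    have "K1 \<subseteq> ?S' i"
      using clusters_subset[OF that(1)] that(3) by (auto simp: sub_pts_def)
    then show ?thesis using mem[OF that(2)] by blast
  qed
  define f where "f = (\<lambda>(j, K'). (j + c :: int, p ` K'))"
  have nodes: "nodes (merge_tree L' E' h' w') = {(j, K). K \<in> ?C' j}"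
    "nodes (merge_tree L E h w) = {(j, K). K \<in> ?C j}"
    by (auto simp: merge_tree_def)
  have onto: "\<exists>K'\<in>?C' (j - c). p ` K' = K" if K: "K \<in> ?C j" for K j
  proof -
    obtain x where x: "x \<in> ?S j" "K = ?P j `` {x}" using K unfolding clusters_def by blast
    then obtain x' where x': "x' \<in> ?S' (j - c)" "p x' = x" using over[of x "j - c"] by auto
    then have "p ` (?P' (j - c) `` {x'}) = K" using img[of x' "j - c"] x by simp
    then show ?thesis using x' by (auto simp: clusters_def)
  qed
  have bij: "bij_betw f (nodes (merge_tree L' E' h' w')) (nodes (merge_tree L E h w))"
    unfolding bij_betw_def nodes
  proof
    show "inj_on f {(j, K). K \<in> ?C' j}"
    proof (rule inj_onI, clarsimp simp: f_def)
      fix j K1 K2 assume "K1 \<in> ?C' j" "K2 \<in> ?C' j" "p ` K1 = p ` K2"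
      then show "K1 = K2" using sub[of K1 j K2 j] sub[of K2 j K1 j] by simp
    qed
    show "f ` {(j, K). K \<in> ?C' j} = {(j, K). K \<in> ?C j}"
    proof
      show "f ` {(j, K). K \<in> ?C' j} \<subseteq> {(j, K). K \<in> ?C j}" using pC by (auto simp: f_def)
      show "{(j, K). K \<in> ?C j} \<subseteq> f ` {(j, K). K \<in> ?C' j}"
      proof clarify
        fix j K assume "K \<in> ?C j"
        then obtain K' where "K' \<in> ?C' (j - c)" "p ` K' = K" using onto by blast
        then show "(j, K) \<in> f ` {(j, K). K \<in> ?C' j}"
          by (intro image_eqI[of _ _ "(j - c, K')"]) (auto simp: f_def)
      qed
    qed
  qed
  \<comment> \<open>Finite sublevel sets bound the levels of nodes from below, so the infimum is a minimum.\<close>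
  have Inf: "Inf {i. ?C i \<noteq> {}} = Inf {i. ?C' i \<noteq> {}} + c"
  proof (rule Inf_int_translate)
    obtain x' where "x' \<in> L'" using ne by auto
    then have "x' \<in> ?S' (h' x')" by (simp add: sub_pts_def)
    then show "{i. ?C' i \<noteq> {}} \<noteq> {}" by (auto simp: clusters_def)
    show "bdd_below {i. ?C' i \<noteq> {}}"
    proof (rule bdd_belowI)
      fix i assume "i \<in> {i. ?C' i \<noteq> {}}"
      then obtain x where x: "x \<in> ?S' i" unfolding clusters_def by blast
      show "Min (insert 0 (h' ` ?S' 0)) \<le> i"
      proof (cases "0 \<le> i")
        case True
        then show ?thesis using fin'[of 0] by (simp add: Min_le_iff)
      next
        case False
        then have "x \<in> ?S' 0" "h' x \<le> i" using x by (auto simp: sub_pts_def)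
        then show ?thesis using fin'[of 0] by (subst Min_le_iff) auto
      qed
    qed
    show "j \<in> {i. ?C' i \<noteq> {}} \<longleftrightarrow> j + c \<in> {i. ?C i \<noteq> {}}" for j
    proof -
      have "?C' j \<noteq> {} \<Longrightarrow> ?C (j + c) \<noteq> {}" using pC by blast
      moreover have "?C (j + c) \<noteq> {} \<Longrightarrow> ?C' j \<noteq> {}" using onto[of _ "j + c"] by auto
      ultimately show ?thesis by auto
    qed
  qed
  have weight: "(\<Sum>x\<in>p ` K'. w x) = (\<Sum>x'\<in>K'. w' x')" if K': "K' \<in> ?C' j" for K' j
  proof -
    have f': "finite K'" using finite_subset[OF clusters_subset[OF K'] fin'] .
    have "(\<Sum>x'\<in>K'. w' x') = (\<Sum>x\<in>p ` K'. \<Sum>x'\<in>{x'\<in>K'. p x' = x}. w' x')"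
      by (rule sum.image_gen[OF f'])
    also have "\<dots> = (\<Sum>x\<in>p ` K'. w x)"
    proof (rule sum.cong[OF refl])
      fix x assume x: "x \<in> p ` K'"
      then have xS: "x \<in> ?S (j + c)" using clusters_subset[OF K'] pS by blast
      have "{x'\<in>K'. p x' = x} = {x'\<in>?S' j. p x' = x}"
        using mem[OF K'] x clusters_subset[OF K'] by blast
      then show "(\<Sum>x'\<in>{x'\<in>K'. p x' = x}. w' x') = w x"
        using wt[of x j] xS by (simp add: sub_pts_def)
    qed
    finally show ?thesis by simp
  qed
  show ?thesis unfolding wgraph_isomorphic_def
  proof (intro exI[of _ f] conjI ballI bij)
    fix a b
    assume a: "a \<in> nodes (merge_tree L' E' h' w')" and b: "b \<in> nodes (merge_tree L' E' h' w')"
    obtain j K i K2 where ab: "a = (j, K)" "b = (i, K2)" by (cases a; cases b)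
    have C: "K \<in> ?C' j" "K2 \<in> ?C' i" using a b ab nodes by auto
    have fn: "f a \<in> nodes (merge_tree L E h w)" "f b \<in> nodes (merge_tree L E h w)"
      using bij a b by (auto simp: bij_betw_def)
    have "{f a, f b} \<in> links (merge_tree L E h w) \<longleftrightarrow>
      (i = j + 1 \<and> p ` K \<subseteq> p ` K2) \<or> (j = i + 1 \<and> p ` K2 \<subseteq> p ` K)"
      using merge_tree_links_iff[of "j + c" "p ` K" L E h w "i + c" "p ` K2"] fn
      by (simp add: ab f_def)
    also have "\<dots> \<longleftrightarrow> (i = j + 1 \<and> K \<subseteq> K2) \<or> (j = i + 1 \<and> K2 \<subseteq> K)"
      using sub[OF C] sub[OF C(2,1)] by auto
    also have "\<dots> \<longleftrightarrow> {a, b} \<in> links (merge_tree L' E' h' w')"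
      using merge_tree_links_iff[of j K L' E' h' w' i K2] a b by (simp add: ab)
    finally show "{f a, f b} \<in> links (merge_tree L E h w) \<longleftrightarrow>
      {a, b} \<in> links (merge_tree L' E' h' w')" .
  next
    fix a assume a: "a \<in> nodes (merge_tree L' E' h' w')"
    show "grading (merge_tree L E h w) (f a) = grading (merge_tree L' E' h' w') a"
      using Inf by (cases a) (simp add: merge_tree_def f_def)
    show "weight (merge_tree L E h w) (f a) = weight (merge_tree L' E' h' w') a"
      using weight a by (cases a) (auto simp: merge_tree_def f_def)
  qed
qed

text \<open>
  The special case in which the fibres are single points.
\<close>

lemma merge_tree_iso_bij:
  fixes p :: "'b \<Rightarrow> 'a" and c :: int
  assumes sym: "sym E" and sym': "sym E'"
    and fin': "\<And>j. finite (sub_pts L' h' j)"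
    and ne: "L' \<noteq> {}"
    and bij: "bij_betw p L' L"
    and h: "\<And>x'. x' \<in> L' \<Longrightarrow> h (p x') = h' x' + c"
    and edge: "\<And>x' y'. x' \<in> L' \<Longrightarrow> y' \<in> L' \<Longrightarrow> (p x', p y') \<in> E \<longleftrightarrow> (x', y') \<in> E'"
    and wt: "\<And>x'. x' \<in> L' \<Longrightarrow> w (p x') = w' x'"
  shows "wgraph_isomorphic (merge_tree L' E' h' w') (merge_tree L E h w)"
proof (rule merge_tree_iso[OF sym sym' fin' ne])
  have L: "L = p ` L'" and inj: "inj_on p L'" using bij by (auto simp: bij_betw_def)
  show "p x' \<in> L \<and> h (p x') \<le> h' x' + c" if "x' \<in> L'" for x' using that h L by auto
  show "\<exists>x'\<in>L'. p x' = x \<and> h' x' + c = h x" if "x \<in> L" for x using that h L by auto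
  show "p x' = p y' \<or> (p x', p y') \<in> E" if "x' \<in> L'" "y' \<in> L'" "(x', y') \<in> E'" for x' y'
    using that edge by auto
  show "\<exists>x'\<in>L'. \<exists>y'\<in>L'. p x' = x \<and> p y' = y \<and> h' x' + c = h x \<and> h' y' + c = h y \<and> (x', y') \<in> E'"
    if xy: "x \<in> L" "y \<in> L" "(x, y) \<in> E" for x y
  proof -
    obtain x' y' where "x' \<in> L'" "x = p x'" "y' \<in> L'" "y = p y'" using xy L by auto
    then show ?thesis using edge[of x' y'] h xy(3) by metis
  qed
  show "(x', y') \<in> path_rel L' E' h' (max (h' x') (h' y'))"
    if "x' \<in> L'" "y' \<in> L'" "p x' = p y'" for x' y'
  proof -
    have "x' = y'" using inj_onD[OF inj that(3)] that by simp
    then show ?thesis by simp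
  qed
  show "(\<Sum>x'\<in>{x'\<in>sub_pts L' h' j. p x' = x}. w' x') = w x" if x: "x \<in> L" "h x \<le> j + c" for x j
  proof -
    obtain x' where x': "x' \<in> L'" "x = p x'" using x L by auto
    then have "{x'\<in>sub_pts L' h' j. p x' = x} = {x'}"
      using x h inj by (auto simp: sub_pts_def dest: inj_onD)
    then show ?thesis using x' wt by simp
  qed
qed

section \<open>Components of cubical sublevel sets\<close>

text \<open>
  The edges of the standard cubical structure, in both directions.
\<close>

definition unit_steps :: "'v plumbing \<Rightarrow> ('v \<Rightarrow> int) rel" where
  "unit_steps \<Gamma> = {(x, y). \<exists>v\<in>verts \<Gamma>. y = x(v := x v + 1) \<or> x = y(v := y v + 1)}"

text \<open>
  The combinatorial model of the weighted graded root.
\<close>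

definition lattice_root ::
  "(nat \<Rightarrow> int \<Rightarrow> 'r::{comm_ring, comm_monoid_mult}) \<Rightarrow> 'v plumbing \<Rightarrow> ('v \<Rightarrow> int)
     \<Rightarrow> (int \<times> ('v \<Rightarrow> int) set, (rat \<times> int) \<Rightarrow>\<^sub>0 'r) weighted_graded_graph" where
  "lattice_root F \<Gamma> k = merge_tree (vecs \<Gamma>) (unit_steps \<Gamma>) (chi \<Gamma> k)
     (\<lambda>x. Poly_Mapping.single (epsilon \<Gamma> k x, theta \<Gamma> k x) (F_vec F \<Gamma> k x))"

text \<open>
  For a set \<open>K\<close> of lattice points, the part of the sublevel set whose coordinatewise floor lies
  in \<open>K\<close>. For a cluster \<open>K\<close> this is the component of the sublevel set that contains \<open>K\<close>.
\<close>

definition cube_hull :: "'v plumbing \<Rightarrow> ('v \<Rightarrow> int) \<Rightarrow> int \<Rightarrow> ('v \<Rightarrow> int) set \<Rightarrow> ('v \<Rightarrow> real) set" where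
  "cube_hull \<Gamma> k j K = {y \<in> sublevel \<Gamma> k j. (\<lambda>v. \<lfloor>y v\<rfloor>) \<in> K}"

lemma sym_unit_steps: "sym (unit_steps \<Gamma>)"
  by (auto simp: sym_def unit_steps_def)

lemma vecs_update: "x \<in> vecs \<Gamma> \<Longrightarrow> v \<in> verts \<Gamma> \<Longrightarrow> x(v := a) \<in> vecs \<Gamma>"
  by (auto simp: vecs_def)

lemma lattice_pts_cube:
  assumes "x \<in> vecs \<Gamma>" "I \<subseteq> verts \<Gamma>"
  shows "lattice_pts \<Gamma> (cube x I) = {y. \<forall>v. y v = x v \<or> v \<in> I \<and> y v = x v + 1}" (is "?L = ?R")
proof
  show "?L \<subseteq> ?R"
  proof
    fix y assume "y \<in> ?L"
    then have mem: "real_of_int (y v) \<in> (if v \<in> I then {real_of_int (x v)..real_of_int (x v) + 1}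
                            else {real_of_int (x v)})" for v
      by (auto simp: lattice_pts_def cube_def)
    have "y v = x v \<or> v \<in> I \<and> y v = x v + 1" for v
    proof (cases "v \<in> I")
      case True
      then have "real_of_int (x v) \<le> real_of_int (y v)" "real_of_int (y v) \<le> real_of_int (x v) + 1"
        using mem[of v] by auto
      then show ?thesis using True by linarith
    qed (use mem[of v] in auto)
    then show "y \<in> ?R" by blast
  qed
  show "?R \<subseteq> ?L"
  proof
    fix y assume y: "y \<in> ?R"
    have "y v = 0" if "v \<notin> verts \<Gamma>" for v
    proof -
      have "v \<notin> I" "x v = 0" using assms that by (auto simp: vecs_def)
      then show ?thesis using y by (auto dest!: spec[of _ v])
    qed
    moreover have "real_of_int (y v) \<in> (if v \<in> I then {real_of_int (x v)..real_of_int (x v) + 1}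
                            else {real_of_int (x v)})" for v
      using y by (auto dest!: spec[of _ v])
    ultimately show "y \<in> ?L" by (auto simp: lattice_pts_def cube_def vecs_def)
  qed
qed

lemma finite_lattice_pts_cube:
  assumes "finite (verts \<Gamma>)" "x \<in> vecs \<Gamma>" "I \<subseteq> verts \<Gamma>"
  shows "finite (lattice_pts \<Gamma> (cube x I))"
proof (rule finite_subset)
  show "lattice_pts \<Gamma> (cube x I) \<subseteq> (\<lambda>J v. if v \<in> J then x v + 1 else x v) ` Pow I"
  proof
    fix y assume "y \<in> lattice_pts \<Gamma> (cube x I)"
    then have y: "\<And>v. y v = x v \<or> v \<in> I \<and> y v = x v + 1"
      unfolding lattice_pts_cube[OF assms(2,3)] by blast
    then have "y = (\<lambda>v. if v \<in> {v\<in>I. y v = x v + 1} then x v + 1 else x v)" by fastforce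
    then show "y \<in> (\<lambda>J v. if v \<in> J then x v + 1 else x v) ` Pow I" by blast
  qed
  show "finite ((\<lambda>J v. if v \<in> J then x v + 1 else x v) ` Pow I)"
    using assms finite_subset by blast
qed

lemma corner_in_cube:
  assumes "x \<in> vecs \<Gamma>" "I \<subseteq> verts \<Gamma>"
  shows "x \<in> lattice_pts \<Gamma> (cube x I)"
  unfolding lattice_pts_cube[OF assms] by simp

text \<open>
  The floor of a point is a corner of every cube that contains the point. Thus two intersecting
  cubes share a corner, which is what links topological to combinatorial connectedness.
\<close>

lemma floor_in_cube:
  assumes "x \<in> vecs \<Gamma>" "I \<subseteq> verts \<Gamma>" "y \<in> cube x I"
  shows "(\<lambda>v. \<lfloor>y v\<rfloor>) \<in> lattice_pts \<Gamma> (cube x I)"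
proof -
  have "\<lfloor>y v\<rfloor> = x v \<or> v \<in> I \<and> \<lfloor>y v\<rfloor> = x v + 1" for v
  proof -
    have y: "y v \<in> (if v \<in> I then {real_of_int (x v)..real_of_int (x v) + 1}
                            else {real_of_int (x v)})"
      using assms(3) by (auto simp: cube_def)
    show ?thesis
    proof (cases "v \<in> I")
      case True
      then have "real_of_int (x v) \<le> y v" "y v \<le> real_of_int (x v) + 1" using y by auto
      then show ?thesis using True by linarith
    qed (use y in auto)
  qed
  then show ?thesis unfolding lattice_pts_cube[OF assms(1,2)] by blast
qed

lemma chi_cell_le_iff:
  assumes "finite (verts \<Gamma>)" "x \<in> vecs \<Gamma>" "I \<subseteq> verts \<Gamma>"
  shows "chi_cell \<Gamma> k (cube x I) \<le> j \<longleftrightarrow>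
    lattice_pts \<Gamma> (cube x I) \<subseteq> sub_pts (vecs \<Gamma>) (chi \<Gamma> k) j"
proof -
  have "lattice_pts \<Gamma> (cube x I) \<noteq> {}" using corner_in_cube[OF assms(2,3)] by auto
  then have "chi_cell \<Gamma> k (cube x I) \<le> j \<longleftrightarrow> (\<forall>y\<in>lattice_pts \<Gamma> (cube x I). chi \<Gamma> k y \<le> j)"
    unfolding chi_cell_def using finite_lattice_pts_cube[OF assms] by (subst Max_le_iff) auto
  then show ?thesis by (auto simp: sub_pts_def lattice_pts_def)
qed

lemma sublevel_iff:
  assumes "finite (verts \<Gamma>)"
  shows "y \<in> sublevel \<Gamma> k j \<longleftrightarrow> (\<exists>x\<in>vecs \<Gamma>. \<exists>I\<subseteq>verts \<Gamma>. y \<in> cube x I \<and>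
    lattice_pts \<Gamma> (cube x I) \<subseteq> sub_pts (vecs \<Gamma>) (chi \<Gamma> k) j)"
  unfolding sublevel_def cells_def using chi_cell_le_iff[OF assms] by blast

lemma cube_corners_connected:
  assumes fin: "finite (verts \<Gamma>)" and x: "x \<in> vecs \<Gamma>" "I \<subseteq> verts \<Gamma>"
    and sub: "lattice_pts \<Gamma> (cube x I) \<subseteq> sub_pts (vecs \<Gamma>) h j"
    and y: "y \<in> lattice_pts \<Gamma> (cube x I)"
  shows "(x, y) \<in> path_rel (vecs \<Gamma>) (unit_steps \<Gamma>) h j"
proof -
  have "(x, \<lambda>v. if v \<in> J then x v + 1 else x v) \<in> path_rel (vecs \<Gamma>) (unit_steps \<Gamma>) h j"
    if "finite J" "J \<subseteq> I" for J
    using that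
  proof (induction J rule: finite_induct)
    case (insert a J)
    let ?f = "\<lambda>J v. if v \<in> J then x v + 1 else x v"
    have f: "?f J' \<in> sub_pts (vecs \<Gamma>) h j" if "J' \<subseteq> I" for J'
      by (rule subsetD[OF sub[unfolded lattice_pts_cube[OF x]]]) (use that in auto)
    have "?f (insert a J) = (?f J)(a := ?f J a + 1)" using insert.hyps by auto
    then have "(?f J, ?f (insert a J)) \<in> unit_steps \<Gamma>"
      using insert.prems x(2) unfolding unit_steps_def by blast
    then have "(?f J, ?f (insert a J)) \<in> path_rel (vecs \<Gamma>) (unit_steps \<Gamma>) h j"
      using insert.prems by (intro path_rel_step f) auto
    moreover have "(x, ?f J) \<in> path_rel (vecs \<Gamma>) (unit_steps \<Gamma>) h j"
      using insert by auto
    ultimately show ?case by (rule path_rel_trans[rotated])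
  qed simp
  from this[of "{v\<in>I. y v = x v + 1}"]
  have "(x, \<lambda>v. if v \<in> {v\<in>I. y v = x v + 1} then x v + 1 else x v)
      \<in> path_rel (vecs \<Gamma>) (unit_steps \<Gamma>) h j"
    using finite_subset[OF x(2) fin] by fastforce
  moreover have "(\<lambda>v. if v \<in> {v\<in>I. y v = x v + 1} then x v + 1 else x v) = y"
  proof
    fix v
    have "y v = x v \<or> v \<in> I \<and> y v = x v + 1"
      using y unfolding lattice_pts_cube[OF x] by blast
    then show "(if v \<in> {v\<in>I. y v = x v + 1} then x v + 1 else x v) = y v" by auto
  qed
  ultimately show ?thesis by (simp only:)
qed

lemma closed_cube: "closed (cube x I)"
proof -
  have "closed {y::'a \<Rightarrow> real. y v \<in> S}" if "closed S" for v :: 'a and S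
    using closed_vimage[OF that continuous_on_product_coordinates[of v]]
    by (simp add: vimage_def)
  moreover have "cube x I = (\<Inter>v. {y. y v \<in> (if v \<in> I then {real_of_int (x v)..real_of_int (x v) + 1}
                            else {real_of_int (x v)})})"
    unfolding cube_def by blast
  ultimately show ?thesis by (simp add: closed_INT)
qed

lemma connected_cube: "connected (cube x I)"
proof -
  have "connected_component (cube x I) y z" if y: "y \<in> cube x I" and z: "z \<in> cube x I" for y z
  proof -
    let ?g = "\<lambda>t::real. \<lambda>v. (1 - t) * y v + t * z v"
    have "continuous_on {0..1} ?g"
      by (rule continuous_on_coordinatewise_then_product) (intro continuous_intros)
    then have "connected (?g ` {0..1})" by (rule connected_continuous_image) simp
    moreover have "?g ` {0..1} \<subseteq> cube x I"
    proof (clarsimp simp only: cube_def image_subset_iff mem_Collect_eq)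
      fix t :: real and v assume "t \<in> {0..1}"
      then have t: "0 \<le> t" "t \<le> 1" by auto
      have "y v \<in> (if v \<in> I then {real_of_int (x v)..real_of_int (x v) + 1} else {real_of_int (x v)})"
        "z v \<in> (if v \<in> I then {real_of_int (x v)..real_of_int (x v) + 1} else {real_of_int (x v)})"
        using y z by (auto simp: cube_def)
      moreover have "convex (if v \<in> I then {real_of_int (x v)..real_of_int (x v) + 1} else {real_of_int (x v)})"
        by simp
      ultimately show "(1 - t) * y v + t * z v \<in>
          (if v \<in> I then {real_of_int (x v)..real_of_int (x v) + 1} else {real_of_int (x v)})"
        using t unfolding convex_alt by (auto simp del: split_paired_All)
    qed
    moreover have "y \<in> ?g ` {0..1}" by (rule image_eqI[of _ _ 0]) auto
    moreover have "z \<in> ?g ` {0..1}" by (rule image_eqI[of _ _ 1]) auto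
    ultimately show ?thesis unfolding connected_component_def by blast
  qed
  then show ?thesis using connected_iff_connected_component by blast
qed

lemma lattice_pts_sublevel:
  assumes "finite (verts \<Gamma>)"
  shows "lattice_pts \<Gamma> (sublevel \<Gamma> k j) = sub_pts (vecs \<Gamma>) (chi \<Gamma> k) j"
proof
  show "lattice_pts \<Gamma> (sublevel \<Gamma> k j) \<subseteq> sub_pts (vecs \<Gamma>) (chi \<Gamma> k) j"
    by (auto simp: sublevel_iff[OF assms] lattice_pts_def)
  show "sub_pts (vecs \<Gamma>) (chi \<Gamma> k) j \<subseteq> lattice_pts \<Gamma> (sublevel \<Gamma> k j)"
  proof
    fix x assume x: "x \<in> sub_pts (vecs \<Gamma>) (chi \<Gamma> k) j"
    then have xv: "x \<in> vecs \<Gamma>" by (simp add: sub_pts_def)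
    have "lattice_pts \<Gamma> (cube x {}) = {x}"
      unfolding lattice_pts_cube[OF xv empty_subsetI] by auto
    moreover have "(\<lambda>v. real_of_int (x v)) \<in> cube x {}" by (simp add: cube_def)
    ultimately have "(\<lambda>v. real_of_int (x v)) \<in> sublevel \<Gamma> k j"
      unfolding sublevel_iff[OF assms] using x xv by (metis empty_subsetI insert_subset)
    then show "x \<in> lattice_pts \<Gamma> (sublevel \<Gamma> k j)" using xv by (simp add: lattice_pts_def)
  qed
qed

lemma floor_sublevel:
  assumes "finite (verts \<Gamma>)" "y \<in> sublevel \<Gamma> k j"
  shows "(\<lambda>v. \<lfloor>y v\<rfloor>) \<in> sub_pts (vecs \<Gamma>) (chi \<Gamma> k) j"
  using assms(2) floor_in_cube unfolding sublevel_iff[OF assms(1)] by blast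

lemma lattice_pts_cube_hull:
  assumes "finite (verts \<Gamma>)" "K \<subseteq> sub_pts (vecs \<Gamma>) (chi \<Gamma> k) j"
  shows "lattice_pts \<Gamma> (cube_hull \<Gamma> k j K) = K"
proof -
  have "lattice_pts \<Gamma> (cube_hull \<Gamma> k j K) = lattice_pts \<Gamma> (sublevel \<Gamma> k j) \<inter> K"
    by (auto simp: lattice_pts_def cube_hull_def)
  then show ?thesis using assms by (auto simp: lattice_pts_sublevel)
qed

lemma cube_hull_subset_iff:
  assumes "finite (verts \<Gamma>)" "j \<le> i" "K \<subseteq> sub_pts (vecs \<Gamma>) (chi \<Gamma> k) j"
    "K' \<subseteq> sub_pts (vecs \<Gamma>) (chi \<Gamma> k) i"
  shows "cube_hull \<Gamma> k j K \<subseteq> cube_hull \<Gamma> k i K' \<longleftrightarrow> K \<subseteq> K'"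
proof
  assume "cube_hull \<Gamma> k j K \<subseteq> cube_hull \<Gamma> k i K'"
  then have "lattice_pts \<Gamma> (cube_hull \<Gamma> k j K) \<subseteq> lattice_pts \<Gamma> (cube_hull \<Gamma> k i K')"
    by (auto simp: lattice_pts_def)
  then show "K \<subseteq> K'" using assms by (simp add: lattice_pts_cube_hull)
next
  have "sublevel \<Gamma> k j \<subseteq> sublevel \<Gamma> k i"
    using assms(2) by (force simp: sublevel_def)
  then show "K \<subseteq> K' \<Longrightarrow> cube_hull \<Gamma> k j K \<subseteq> cube_hull \<Gamma> k i K'"
    by (auto simp: cube_hull_def)
qed

text \<open>
  If \<open>K\<close> is a union of clusters, then a cube in the sublevel set meets the hull of \<open>K\<close> only if its
  least corner is in \<open>K\<close>, and then it is contained in the hull.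
\<close>

lemma cube_hull_eq_Union:
  assumes fin: "finite (verts \<Gamma>)" and K: "K \<subseteq> sub_pts (vecs \<Gamma>) (chi \<Gamma> k) j"
    and closed: "\<And>x y. x \<in> K \<Longrightarrow> (x, y) \<in> path_rel (vecs \<Gamma>) (unit_steps \<Gamma>) (chi \<Gamma> k) j \<Longrightarrow> y \<in> K"
  shows "cube_hull \<Gamma> k j K = \<Union> ((\<lambda>(x, I). cube x I) ` {(x, I). x \<in> K \<and> I \<subseteq> verts \<Gamma> \<and>
     lattice_pts \<Gamma> (cube x I) \<subseteq> sub_pts (vecs \<Gamma>) (chi \<Gamma> k) j})" (is "_ = \<Union> (_ ` ?A)")
proof
  show "cube_hull \<Gamma> k j K \<subseteq> \<Union> ((\<lambda>(x, I). cube x I) ` ?A)"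
  proof
    fix y assume y: "y \<in> cube_hull \<Gamma> k j K"
    then obtain x I where x: "x \<in> vecs \<Gamma>" "I \<subseteq> verts \<Gamma>" "y \<in> cube x I"
      "lattice_pts \<Gamma> (cube x I) \<subseteq> sub_pts (vecs \<Gamma>) (chi \<Gamma> k) j"
      by (auto simp: cube_hull_def sublevel_iff[OF fin])
    have "(x, \<lambda>v. \<lfloor>y v\<rfloor>) \<in> path_rel (vecs \<Gamma>) (unit_steps \<Gamma>) (chi \<Gamma> k) j"
      by (rule cube_corners_connected[OF fin x(1,2,4) floor_in_cube[OF x(1-3)]])
    then have "x \<in> K" using y closed path_rel_sym[OF sym_unit_steps]
      unfolding cube_hull_def by blast
    then show "y \<in> \<Union> ((\<lambda>(x, I). cube x I) ` ?A)" using x by blast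
  qed
  show "\<Union> ((\<lambda>(x, I). cube x I) ` ?A) \<subseteq> cube_hull \<Gamma> k j K"
  proof clarify
    fix y x I assume x: "x \<in> K" "I \<subseteq> verts \<Gamma>" "y \<in> cube x I"
      "lattice_pts \<Gamma> (cube x I) \<subseteq> sub_pts (vecs \<Gamma>) (chi \<Gamma> k) j"
    have xv: "x \<in> vecs \<Gamma>" using x(1) K by (auto simp: sub_pts_def)
    have "(x, \<lambda>v. \<lfloor>y v\<rfloor>) \<in> path_rel (vecs \<Gamma>) (unit_steps \<Gamma>) (chi \<Gamma> k) j"
      by (rule cube_corners_connected[OF fin xv x(2,4) floor_in_cube[OF xv x(2,3)]])
    then show "y \<in> cube_hull \<Gamma> k j K"
      using x xv closed unfolding cube_hull_def sublevel_iff[OF fin] by blast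
  qed
qed

lemma closed_cube_hull:
  assumes fin: "finite (verts \<Gamma>)" and finS: "finite (sub_pts (vecs \<Gamma>) (chi \<Gamma> k) j)"
    and K: "K \<subseteq> sub_pts (vecs \<Gamma>) (chi \<Gamma> k) j"
    and closed: "\<And>x y. x \<in> K \<Longrightarrow> (x, y) \<in> path_rel (vecs \<Gamma>) (unit_steps \<Gamma>) (chi \<Gamma> k) j \<Longrightarrow> y \<in> K"
  shows "closed (cube_hull \<Gamma> k j K)"
proof -
  have Un: "cube_hull \<Gamma> k j K = \<Union> ((\<lambda>(x, I). cube x I) ` {(x, I). x \<in> K \<and> I \<subseteq> verts \<Gamma> \<and>
     lattice_pts \<Gamma> (cube x I) \<subseteq> sub_pts (vecs \<Gamma>) (chi \<Gamma> k) j})"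
    by (rule cube_hull_eq_Union[OF fin K]) (rule closed)
  have "finite ((\<lambda>(x, I). cube x I) ` {(x, I). x \<in> K \<and> I \<subseteq> verts \<Gamma> \<and>
     lattice_pts \<Gamma> (cube x I) \<subseteq> sub_pts (vecs \<Gamma>) (chi \<Gamma> k) j})"
  proof (intro finite_imageI, rule finite_subset)
    show "finite (K \<times> Pow (verts \<Gamma>))" using fin finS K finite_subset by blast
  qed auto
  then show ?thesis
    unfolding Un by (rule closed_Union) (auto simp: closed_cube)
qed

lemma connected_cube_hull:
  assumes fin: "finite (verts \<Gamma>)"
    and K: "K \<in> clusters (vecs \<Gamma>) (unit_steps \<Gamma>) (chi \<Gamma> k) j"
  shows "connected (cube_hull \<Gamma> k j K)"
proof -
  let ?S = "sub_pts (vecs \<Gamma>) (chi \<Gamma> k) j" and ?P = "path_rel (vecs \<Gamma>) (unit_steps \<Gamma>) (chi \<Gamma> k) j"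
  let ?H = "cube_hull \<Gamma> k j K"
  have KS: "K \<subseteq> ?S" by (rule clusters_subset[OF K])
  have closed: "y \<in> K" if "x \<in> K" "(x, y) \<in> ?P" for x y
    using cluster_mem_iff[OF sym_unit_steps K that(1)] that(2) by simp
  have Un: "?H = \<Union> ((\<lambda>(x, I). cube x I) ` {(x, I). x \<in> K \<and> I \<subseteq> verts \<Gamma> \<and>
     lattice_pts \<Gamma> (cube x I) \<subseteq> ?S})"
    by (rule cube_hull_eq_Union[OF fin KS]) (rule closed)
  let ?r = "\<lambda>(x::'a \<Rightarrow> int) v. real_of_int (x v)"
  have cub: "connected_component ?H y z"
    if "x \<in> K" "I \<subseteq> verts \<Gamma>" "lattice_pts \<Gamma> (cube x I) \<subseteq> ?S" "y \<in> cube x I" "z \<in> cube x I" for x I y z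
  proof -
    have "cube x I \<subseteq> ?H" unfolding Un using that by blast
    then show ?thesis using that connected_cube unfolding connected_component_def by blast
  qed
  have edge: "connected_component ?H (?r x) (?r (x(v := x v + 1)))"
    if "x \<in> K" "x(v := x v + 1) \<in> K" "v \<in> verts \<Gamma>" for x v
  proof (rule cub[of x "{v}"])
    have "x \<in> vecs \<Gamma>" using KS that by (auto simp: sub_pts_def)
    then have L: "lattice_pts \<Gamma> (cube x {v}) = {y. \<forall>u. y u = x u \<or> u \<in> {v} \<and> y u = x u + 1}"
      using that by (intro lattice_pts_cube) auto
    have "y = x \<or> y = x(v := x v + 1)" if "\<forall>u. y u = x u \<or> u \<in> {v} \<and> y u = x u + 1" for y
      using that by (cases "y v = x v") (auto simp: fun_eq_iff)
    then have "lattice_pts \<Gamma> (cube x {v}) \<subseteq> K" unfolding L using that by blast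
    then show "lattice_pts \<Gamma> (cube x {v}) \<subseteq> ?S" using KS by simp
  qed (use that in \<open>auto simp: cube_def\<close>)
  have path: "connected_component ?H (?r x) (?r y)" if "(x, y) \<in> ?P" "x \<in> K" for x y
    using that(1) unfolding path_rel_def
  proof (induction rule: rtrancl_induct)
    case base
    have "x \<in> vecs \<Gamma>" using KS that(2) by (auto simp: sub_pts_def)
    then have "lattice_pts \<Gamma> (cube x {}) \<subseteq> K"
      using lattice_pts_cube[of x \<Gamma> "{}"] that(2) by (auto simp flip: fun_eq_iff)
    then show ?case using KS that(2)
      by (intro cub[of x "{}" "?r x" "?r x"]) (auto simp: cube_def)
  next
    case (step y z)
    have "(x, y) \<in> ?P" using step.hyps(1) by (simp add: path_rel_def)
    moreover have "(y, z) \<in> ?P" using r_into_rtrancl[OF step.hyps(2)] by (simp add: path_rel_def)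
    ultimately    have yz: "y \<in> K" "z \<in> K" using closed[OF that(2)] closed by blast+
    have "(y, z) \<in> unit_steps \<Gamma>" using step.hyps by simp
    then have "connected_component ?H (?r y) (?r z)"
      using yz edge unfolding unit_steps_def by (blast intro: connected_component_sym)
    with step.IH show ?case by (rule connected_component_trans)
  qed
  have floor: "connected_component ?H y (?r (\<lambda>v. \<lfloor>y v\<rfloor>))" if y: "y \<in> ?H" for y
  proof -
    obtain x I where x: "x \<in> K" "I \<subseteq> verts \<Gamma>" "lattice_pts \<Gamma> (cube x I) \<subseteq> ?S" "y \<in> cube x I"
      using y unfolding Un by auto
    moreover have "x \<in> vecs \<Gamma>" using x KS by (auto simp: sub_pts_def)
    then have "?r (\<lambda>v. \<lfloor>y v\<rfloor>) \<in> cube x I" using floor_in_cube[of x \<Gamma> I y] x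
      by (simp add: lattice_pts_def)
    ultimately show ?thesis by (intro cub)
  qed
  have "connected_component ?H y z" if yz: "y \<in> ?H" "z \<in> ?H" for y z
  proof -
    have "(\<lambda>v. \<lfloor>y v\<rfloor>) \<in> K" "(\<lambda>v. \<lfloor>z v\<rfloor>) \<in> K" using yz by (auto simp: cube_hull_def)
    then have "connected_component ?H (?r (\<lambda>v. \<lfloor>y v\<rfloor>)) (?r (\<lambda>v. \<lfloor>z v\<rfloor>))"
      using path cluster_mem_iff[OF sym_unit_steps K] by blast
    then show ?thesis using floor[OF yz(1)] floor[OF yz(2)]
      by (meson connected_component_sym connected_component_trans)
  qed
  then show ?thesis using connected_iff_connected_component by blast
qed

text \<open>
  The hulls of a cluster and of the union of all other clusters are disjoint finite unions of closed
  cubes that cover the sublevel set. So the hull of a cluster, being connected, is a component.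
\<close>

lemma components_sublevel:
  assumes fin: "finite (verts \<Gamma>)" and finS: "finite (sub_pts (vecs \<Gamma>) (chi \<Gamma> k) j)"
  shows "components (sublevel \<Gamma> k j) =
    cube_hull \<Gamma> k j ` clusters (vecs \<Gamma>) (unit_steps \<Gamma>) (chi \<Gamma> k) j"
proof -
  let ?S = "sub_pts (vecs \<Gamma>) (chi \<Gamma> k) j" and ?P = "path_rel (vecs \<Gamma>) (unit_steps \<Gamma>) (chi \<Gamma> k) j"
  let ?C = "clusters (vecs \<Gamma>) (unit_steps \<Gamma>) (chi \<Gamma> k) j" and ?X = "sublevel \<Gamma> k j"
  have comp: "cube_hull \<Gamma> k j K \<in> components ?X" if K: "K \<in> ?C" for K
    unfolding in_components_maximal
  proof (intro conjI allI impI)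
    have KS: "K \<subseteq> ?S" by (rule clusters_subset[OF K])
    have cl1: "y \<in> K" if "x \<in> K" "(x, y) \<in> ?P" for x y
      using cluster_mem_iff[OF sym_unit_steps K that(1)] that(2) by simp
    have cl2: "y \<in> ?S - K" if "x \<in> ?S - K" "(x, y) \<in> ?P" for x y
      using that path_rel_in_sub cl1 path_rel_sym[OF sym_unit_steps] by fast
    show ne: "cube_hull \<Gamma> k j K \<noteq> {}"
      using lattice_pts_cube_hull[OF fin KS] cluster_nonempty[OF K] by (auto simp: lattice_pts_def)
    show "cube_hull \<Gamma> k j K \<subseteq> ?X" by (auto simp: cube_hull_def)
    show "connected (cube_hull \<Gamma> k j K)" by (rule connected_cube_hull[OF fin K])
    fix D assume D: "D \<noteq> {} \<and> cube_hull \<Gamma> k j K \<subseteq> D \<and> D \<subseteq> ?X \<and> connected D"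
    have c1: "closed (cube_hull \<Gamma> k j K)"
      by (rule closed_cube_hull[OF fin finS KS cl1])
    have c2: "closed (cube_hull \<Gamma> k j (?S - K))"
      by (rule closed_cube_hull[OF fin finS Diff_subset cl2])
    have un: "D \<subseteq> cube_hull \<Gamma> k j K \<union> cube_hull \<Gamma> k j (?S - K)"
      using D floor_sublevel[OF fin] by (fastforce simp: cube_hull_def)
    have disj: "cube_hull \<Gamma> k j K \<inter> cube_hull \<Gamma> k j (?S - K) \<inter> D = {}"
      by (auto simp: cube_hull_def)
    have "cube_hull \<Gamma> k j K \<inter> D = {} \<or> cube_hull \<Gamma> k j (?S - K) \<inter> D = {}"
      using D c1 c2 un disj unfolding connected_closed by blast
    then show "D = cube_hull \<Gamma> k j K" using D ne un by blast
  qed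
  show ?thesis
  proof
    show "cube_hull \<Gamma> k j ` ?C \<subseteq> components ?X" using comp by blast
    show "components ?X \<subseteq> cube_hull \<Gamma> k j ` ?C"
    proof
      fix C assume C: "C \<in> components ?X"
      then obtain y where y: "y \<in> C" "y \<in> ?X"
        using in_components_nonempty in_components_subset by fast
      define K where "K = ?P `` {\<lambda>v. \<lfloor>y v\<rfloor>}"
      have K: "K \<in> ?C" unfolding clusters_def K_def using floor_sublevel[OF fin y(2)] by blast
      have "y \<in> cube_hull \<Gamma> k j K" using y(2) by (simp add: cube_hull_def K_def)
      then have "C = cube_hull \<Gamma> k j K"
        using components_nonoverlap[OF C comp[OF K]] y(1) by blast
      then show "C \<in> cube_hull \<Gamma> k j ` ?C" using K by blast
    qed
  qed
qed

lemma weighted_graded_root_iso_lattice_root: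
  assumes fin: "finite (verts \<Gamma>)" and finS: "\<And>j. finite (sub_pts (vecs \<Gamma>) (chi \<Gamma> k) j)"
  shows "wgraph_isomorphic (lattice_root F \<Gamma> k) (weighted_graded_root F \<Gamma> k)"
proof -
  let ?C = "clusters (vecs \<Gamma>) (unit_steps \<Gamma>) (chi \<Gamma> k)"
  let ?H = "cube_hull \<Gamma> k"
  define f where "f = (\<lambda>(j, K). (j, ?H j K))"
  have nodes: "nodes (lattice_root F \<Gamma> k) = {(j, K). K \<in> ?C j}"
    by (simp add: lattice_root_def merge_tree_def)
  have rn: "root_nodes \<Gamma> k = {(j, C). C \<in> ?H j ` ?C j}"
    unfolding root_nodes_def components_sublevel[OF fin finS] by simp
  have lp: "lattice_pts \<Gamma> (?H j K) = K" if "K \<in> ?C j" for j K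
    using lattice_pts_cube_hull[OF fin clusters_subset[OF that]] .
  have sub: "?H j K \<subseteq> ?H i K' \<longleftrightarrow> K \<subseteq> K'" if "K \<in> ?C j" "K' \<in> ?C i" "j \<le> i" for i j K K'
    by (rule cube_hull_subset_iff[OF fin that(3) clusters_subset[OF that(1)] clusters_subset[OF that(2)]])
  have bij: "bij_betw f (nodes (lattice_root F \<Gamma> k)) (nodes (weighted_graded_root F \<Gamma> k))"
    unfolding bij_betw_def nodes
  proof
    show "inj_on f {(j, K). K \<in> ?C j}"
    proof (rule inj_onI)
      fix a b assume ab: "a \<in> {(j, K). K \<in> ?C j}" "b \<in> {(j, K). K \<in> ?C j}" "f a = f b"
      obtain j K i K' where e: "a = (j, K)" "b = (i, K')" by (cases a; cases b)
      have "i = j" "?H j K = ?H i K'" using ab(3) e by (auto simp: f_def)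
      moreover have "K \<in> ?C j" "K' \<in> ?C i" using ab e by auto
      ultimately show "a = b" using lp[of K j] lp[of K' i] e by simp
    qed
    show "f ` {(j, K). K \<in> ?C j} = nodes (weighted_graded_root F \<Gamma> k)"
      by (auto simp: weighted_graded_root_def rn f_def image_iff)
  qed
  have fst_rn: "fst ` root_nodes \<Gamma> k = {i. ?C i \<noteq> {}}"
    unfolding rn by force
  show ?thesis unfolding wgraph_isomorphic_def
  proof (intro exI[of _ f] conjI ballI bij)
    fix a b assume ab: "a \<in> nodes (lattice_root F \<Gamma> k)" "b \<in> nodes (lattice_root F \<Gamma> k)"
    obtain j K i K' where e: "a = (j, K)" "b = (i, K')" by (cases a; cases b)
    have C: "K \<in> ?C j" "K' \<in> ?C i" using ab nodes e by auto
    have "{f a, f b} \<in> links (weighted_graded_root F \<Gamma> k) \<longleftrightarrow>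
      (i = j + 1 \<and> ?H j K \<subseteq> ?H i K') \<or> (j = i + 1 \<and> ?H i K' \<subseteq> ?H j K)"
      using C by (auto simp: weighted_graded_root_def root_edges_def rn e f_def doubleton_eq_iff)
    also have "\<dots> \<longleftrightarrow> (i = j + 1 \<and> K \<subseteq> K') \<or> (j = i + 1 \<and> K' \<subseteq> K)"
      using sub[OF C] sub[OF C(2,1)] by auto
    also have "\<dots> \<longleftrightarrow> {a, b} \<in> links (lattice_root F \<Gamma> k)"
      unfolding lattice_root_def e
      by (rule merge_tree_links_iff[symmetric]) (use ab e in \<open>simp_all add: lattice_root_def\<close>)
    finally show "{f a, f b} \<in> links (weighted_graded_root F \<Gamma> k) \<longleftrightarrow>
      {a, b} \<in> links (lattice_root F \<Gamma> k)" .
  next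
    fix a assume a: "a \<in> nodes (lattice_root F \<Gamma> k)"
    show "grading (weighted_graded_root F \<Gamma> k) (f a) = grading (lattice_root F \<Gamma> k) a"
      by (cases a) (simp add: weighted_graded_root_def fst_rn f_def lattice_root_def merge_tree_def)
    show "weight (weighted_graded_root F \<Gamma> k) (f a) = weight (lattice_root F \<Gamma> k) a"
      using a lp by (cases a) (auto simp: weighted_graded_root_def f_def lattice_root_def
          merge_tree_def root_weight_def)
  qed
qed

section \<open>Linear algebra of negative definite plumbings\<close>

lemma plumb_mat_of_int: "(plumb_mat \<Gamma> v w :: 'r::comm_ring_1) = of_int (plumb_mat \<Gamma> v w)"
  by (simp add: plumb_mat_def)

lemma plumb_mat_sym: "plumb_mat \<Gamma> v w = plumb_mat \<Gamma> w v"
  by (simp add: plumb_mat_def insert_commute)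

lemma mat_vec_of_int:
  "(mat_vec \<Gamma> (plumb_mat \<Gamma>) (\<lambda>v. of_int (x v)) w :: 'r::comm_ring_1) =
    of_int (mat_vec \<Gamma> (plumb_mat \<Gamma>) x w)"
  by (simp add: mat_vec_def plumb_mat_of_int[where 'r='r])

lemma dotp_of_int: "dotp \<Gamma> (\<lambda>v. of_int (x v)) (\<lambda>v. of_int (y v)) = of_int (dotp \<Gamma> x y)"
  by (simp add: dotp_def)

lemma form_of_int: "form \<Gamma> (\<lambda>v. of_int (x v)) (\<lambda>v. of_int (y v)) = of_int (form \<Gamma> x y)"
  using dotp_of_int[of \<Gamma> x "mat_vec \<Gamma> (plumb_mat \<Gamma>) y"] by (simp add: form_def mat_vec_of_int[abs_def])

lemma form_expand: "form \<Gamma> x y = (\<Sum>v\<in>verts \<Gamma>. \<Sum>w\<in>verts \<Gamma>. x v * plumb_mat \<Gamma> v w * y w)"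
  by (simp add: form_def dotp_def mat_vec_def sum_distrib_left mult.assoc)

lemma form_sym: "form \<Gamma> x y = form \<Gamma> y x"
  unfolding form_expand
  by (subst sum.swap) (simp add: plumb_mat_sym[of \<Gamma>] mult.commute mult.left_commute)

lemma dotp_mat_vec: "dotp \<Gamma> (mat_vec \<Gamma> (plumb_mat \<Gamma>) x) y = form \<Gamma> x y"
  using form_sym[of \<Gamma> y x] by (simp add: form_def dotp_def mult.commute)

lemma dotp_add_left: "dotp \<Gamma> (\<lambda>v. x v + y v) z = dotp \<Gamma> x z + dotp \<Gamma> y z"
  by (simp add: dotp_def distrib_right sum.distrib)

lemma dotp_add_right: "dotp \<Gamma> x (\<lambda>v. y v + z v) = dotp \<Gamma> x y + dotp \<Gamma> x z"
  by (simp add: dotp_def distrib_left sum.distrib)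

lemma dotp_scale_left: "dotp \<Gamma> (\<lambda>v. c * x v) y = c * dotp \<Gamma> x y"
  by (simp add: dotp_def sum_distrib_left mult.assoc)

lemma dotp_scale_right: "dotp \<Gamma> x (\<lambda>v. c * y v) = c * dotp \<Gamma> x y"
  by (simp add: dotp_def sum_distrib_left mult.left_commute)

lemma dotp_sym: "dotp \<Gamma> x y = dotp \<Gamma> y x"
  by (simp add: dotp_def mult.commute)

lemma mat_vec_add: "mat_vec \<Gamma> A (\<lambda>v. x v + y v) w = mat_vec \<Gamma> A x w + mat_vec \<Gamma> A y w"
  by (simp add: mat_vec_def distrib_left sum.distrib)

lemma mat_vec_scale: "mat_vec \<Gamma> A (\<lambda>v. c * x v) w = c * mat_vec \<Gamma> A x w"
  by (simp add: mat_vec_def sum_distrib_left mult.left_commute)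

lemma form_add_left: "form \<Gamma> (\<lambda>v. x v + y v) z = form \<Gamma> x z + form \<Gamma> y z"
  by (simp add: form_def dotp_add_left)

lemma form_add_right: "form \<Gamma> x (\<lambda>v. y v + z v) = form \<Gamma> x y + form \<Gamma> x z"
  by (simp add: form_sym[of \<Gamma> x] form_add_left)

lemma form_scale_left: "form \<Gamma> (\<lambda>v. c * x v) y = c * form \<Gamma> x y"
  by (simp add: form_def dotp_scale_left)

lemma form_scale_right: "form \<Gamma> x (\<lambda>v. c * y v) = c * form \<Gamma> x y"
  by (simp add: form_sym[of \<Gamma> x] form_scale_left)

text \<open>
  By compactness of the unit sphere, as a subset of a product of intervals.
\<close>

lemma negative_definite_coercive:
  assumes fin: "finite (verts \<Gamma>)" and nd: "negative_definite \<Gamma>"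
  shows "\<exists>c>0. \<forall>x::'v \<Rightarrow> real. x \<in> vecs \<Gamma> \<longrightarrow> form \<Gamma> x x \<le> - c * (\<Sum>v\<in>verts \<Gamma>. (x v)\<^sup>2)"
proof -
  let ?V = "verts \<Gamma>"
  let ?q = "\<lambda>x::'v \<Rightarrow> real. \<Sum>v\<in>?V. (x v)\<^sup>2"
  define S where "S = {x \<in> vecs \<Gamma>. ?q x = 1}"
  have cont: "continuous_on UNIV ?q" "continuous_on UNIV (\<lambda>x::'v \<Rightarrow> real. form \<Gamma> x x)"
    unfolding form_expand by (intro continuous_intros continuous_on_product_coordinates)+
  have pos: "?q x > 0" if "x \<in> vecs \<Gamma>" "x \<noteq> (\<lambda>_. 0)" for x
  proof -
    obtain v where "x v \<noteq> 0" using \<open>x \<noteq> (\<lambda>_. 0)\<close> by auto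
    then show ?thesis using \<open>x \<in> vecs \<Gamma>\<close> fin by (intro sum_pos2[of _ v]) (auto simp: vecs_def)
  qed
  have scaled: "?q (\<lambda>v. r * x v) = r\<^sup>2 * ?q x" for r x
    by (simp add: power_mult_distrib sum_distrib_left)
  have "compact S"
  proof -
    define B where "B = PiE UNIV (\<lambda>v. if v \<in> ?V then {-1..1::real} else {0})"
    have "compactin (product_topology (\<lambda>v. euclidean) UNIV) B"
      unfolding B_def by (auto simp: compactin_PiE)
    then have B: "compact B" by (simp add: euclidean_product_topology)
    have "closed {x. ?q x = 1}"
      by (rule closed_Collect_eq[OF cont(1) continuous_on_const])
    moreover have "S = {x. ?q x = 1} \<inter> B"
    proof (intro equalityI subsetI)
      fix x assume x: "x \<in> S"
      have "x v \<in> {-1..1}" if "v \<in> ?V" for v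
      proof -
        have "(x v)\<^sup>2 \<le> ?q x" using that fin by (intro member_le_sum) auto
        then have "(x v)\<^sup>2 \<le> 1" using x by (simp add: S_def)
        then have "\<bar>x v\<bar> \<le> 1" by (simp add: abs_square_le_1)
        then show ?thesis by auto
      qed
      then show "x \<in> {x. ?q x = 1} \<inter> B" using x by (auto simp: S_def B_def vecs_def)
    next
      fix x assume "x \<in> {x. ?q x = 1} \<inter> B"
      moreover from this have "x v \<in> (if v \<in> ?V then {-1..1} else {0})" for v
        by (auto simp: B_def PiE_iff)
      ultimately show "x \<in> S" by (auto simp: S_def vecs_def) (meson singletonD)
    qed
    ultimately show ?thesis using B by (simp add: closed_Int_compact)
  qed
  have normalise: "\<exists>y\<in>S. x = (\<lambda>v. sqrt (?q x) * y v)" if x: "x \<in> vecs \<Gamma>" "x \<noteq> (\<lambda>_. 0)" for x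
  proof
    show "(\<lambda>v. (1 / sqrt (?q x)) * x v) \<in> S"
      using pos[OF x] x(1) by (simp only: S_def mem_Collect_eq scaled) (auto simp: vecs_def power_divide)
    show "x = (\<lambda>v. sqrt (?q x) * ((1 / sqrt (?q x)) * x v))" using pos[OF x] by simp
  qed
  have zero: "form \<Gamma> (\<lambda>_. 0::real) (\<lambda>_. 0) = 0" by (simp add: form_expand)
  show ?thesis
  proof (cases "S = {}")
    case True
    then have "x = (\<lambda>_. 0)" if "x \<in> vecs \<Gamma>" for x :: "'v \<Rightarrow> real"
      using normalise[of x] that by auto
    then have "\<forall>x::'v \<Rightarrow> real. x \<in> vecs \<Gamma> \<longrightarrow> form \<Gamma> x x \<le> - 1 * (\<Sum>v\<in>verts \<Gamma>. (x v)\<^sup>2)"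
      using zero by force
    then show ?thesis by (metis zero_less_one)
  next
    case False
    obtain y where y: "y \<in> S" and max: "\<And>z. z \<in> S \<Longrightarrow> form \<Gamma> z z \<le> form \<Gamma> y y"
      using continuous_attains_sup[OF \<open>compact S\<close> False continuous_on_subset[OF cont(2)]] by auto
    have "y \<in> vecs \<Gamma>" "y \<noteq> (\<lambda>_. 0)" using y by (auto simp: S_def)
    then have "form \<Gamma> y y < 0" using nd by (auto simp: negative_definite_def)
    moreover have "form \<Gamma> x x \<le> - (- form \<Gamma> y y) * ?q x" if x: "x \<in> vecs \<Gamma>" for x
    proof (cases "x = (\<lambda>_. 0)")
      case False
      then obtain z where z: "z \<in> S" "x = (\<lambda>v. sqrt (?q x) * z v)" using normalise[OF x] by auto
      have "form \<Gamma> x x = ?q x * form \<Gamma> z z"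
        using pos[OF x False] by (subst (1 2) z(2)) (simp add: form_scale_left form_scale_right)
      also have "\<dots> \<le> ?q x * form \<Gamma> y y"
        using pos[OF x False] max[OF z(1)] by (intro mult_left_mono) auto
      finally show ?thesis by (simp add: mult.commute)
    qed (simp add: zero)
    ultimately show ?thesis by (metis neg_0_less_iff_less)
  qed
qed

text \<open>
  On a sublevel set, \<open>c |x|\<^sup>2\<close> is bounded by \<open>k \<cdot> x + 2j\<close>, and the linear term is absorbed into half
  of the quadratic one.
\<close>

lemma finite_sublevel_pts:
  assumes fin: "finite (verts \<Gamma>)" and nd: "negative_definite \<Gamma>"
  shows "finite (sub_pts (vecs \<Gamma>) (chi \<Gamma> k) j)"
proof -
  let ?V = "verts \<Gamma>"
  obtain c :: real where c: "c > 0"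
    and le: "\<And>x. x \<in> vecs \<Gamma> \<Longrightarrow> form \<Gamma> x x \<le> - c * (\<Sum>v\<in>?V. (x v)\<^sup>2)"
    using negative_definite_coercive[OF assms] by blast
  define b where "b = (2 / c) * (2 * j + (\<Sum>v\<in>?V. (real_of_int (k v))\<^sup>2 / (2 * c)))"
  have bound: "(real_of_int (x v))\<^sup>2 \<le> b" if x: "x \<in> sub_pts (vecs \<Gamma>) (chi \<Gamma> k) j" and v: "v \<in> ?V" for x v
  proof -
    let ?x = "\<lambda>v. real_of_int (x v)" and ?k = "\<lambda>v. real_of_int (k v)"
    have "- 2 * j \<le> dotp \<Gamma> k x + form \<Gamma> x x"
      using x by (simp add: sub_pts_def chi_def) linarith
    then have "real_of_int (- 2 * j) \<le> real_of_int (dotp \<Gamma> k x + form \<Gamma> x x)"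
      by (simp only: of_int_le_iff)
    then have "- 2 * real_of_int j \<le> dotp \<Gamma> ?k ?x + form \<Gamma> ?x ?x"
      by (simp add: dotp_of_int form_of_int)
    also have "\<dots> \<le> (\<Sum>v\<in>?V. ?k v * ?x v) + - c * (\<Sum>v\<in>?V. (?x v)\<^sup>2)"
      using le[of ?x] x by (simp add: dotp_def sub_pts_def vecs_def)
    also have "(\<Sum>v\<in>?V. ?k v * ?x v) \<le> (\<Sum>v\<in>?V. (c / 2) * (?x v)\<^sup>2 + (?k v)\<^sup>2 / (2 * c))"
    proof (rule sum_mono)
      fix v
      have "0 \<le> (c * ?x v - ?k v)\<^sup>2 / (2 * c)" using c by simp
      also have "\<dots> = (c / 2) * (?x v)\<^sup>2 + (?k v)\<^sup>2 / (2 * c) - ?k v * ?x v"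
        using c by (simp add: power2_eq_square field_simps)
      finally show "?k v * ?x v \<le> (c / 2) * (?x v)\<^sup>2 + (?k v)\<^sup>2 / (2 * c)" by simp
    qed
    also have "\<dots> = (c / 2) * (\<Sum>v\<in>?V. (?x v)\<^sup>2) + (\<Sum>v\<in>?V. (?k v)\<^sup>2 / (2 * c))"
      by (simp only: sum.distrib sum_distrib_left)
    finally have "(c / 2) * (\<Sum>v\<in>?V. (?x v)\<^sup>2) \<le> 2 * j + (\<Sum>v\<in>?V. (?k v)\<^sup>2 / (2 * c))"
      by (simp add: field_simps)
    then have "(\<Sum>v\<in>?V. (?x v)\<^sup>2) \<le> b" using c by (simp add: b_def field_simps)
    moreover have "(?x v)\<^sup>2 \<le> (\<Sum>v\<in>?V. (?x v)\<^sup>2)" using v fin by (intro member_le_sum) auto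
    ultimately show ?thesis by simp
  qed
  have "sub_pts (vecs \<Gamma>) (chi \<Gamma> k) j \<subseteq>
    {x. \<forall>v. (v \<in> ?V \<longrightarrow> x v \<in> {- \<lceil>b\<rceil>..\<lceil>b\<rceil>}) \<and> (v \<notin> ?V \<longrightarrow> x v = 0)}"
  proof clarify
    fix x v assume x: "x \<in> sub_pts (vecs \<Gamma>) (chi \<Gamma> k) j"
    have "x v \<in> {- \<lceil>b\<rceil>..\<lceil>b\<rceil>}" if v: "v \<in> ?V"
    proof -
      have "\<bar>x v\<bar> \<le> (x v)\<^sup>2"
      proof (cases "x v = 0")
        case False
        then have "\<bar>x v\<bar> * 1 \<le> \<bar>x v\<bar> * \<bar>x v\<bar>" by (intro mult_left_mono) auto
        then show ?thesis by (simp add: power2_eq_square)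
      qed simp
      then have "real_of_int \<bar>x v\<bar> \<le> (real_of_int (x v))\<^sup>2" by (simp only: of_int_le_iff flip: of_int_power)
      then have "real_of_int \<bar>x v\<bar> \<le> b" using bound[OF x v] by linarith
      then have "\<bar>x v\<bar> \<le> \<lceil>b\<rceil>" by linarith
      then show ?thesis by auto
    qed
    then show "(v \<in> ?V \<longrightarrow> x v \<in> {- \<lceil>b\<rceil>..\<lceil>b\<rceil>}) \<and> (v \<notin> ?V \<longrightarrow> x v = 0)"
      using x by (auto simp: sub_pts_def vecs_def)
  qed
  moreover have "finite {x. \<forall>v. (v \<in> ?V \<longrightarrow> x v \<in> {- \<lceil>b\<rceil>..\<lceil>b\<rceil>}) \<and> (v \<notin> ?V \<longrightarrow> x v = 0)}"
    by (rule finite_set_of_finite_funs) (use fin in auto)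
  ultimately show ?thesis by (rule finite_subset)
qed

text \<open>
  Solvability of definite linear systems, by induction on the index set. Eliminating the index \<open>a\<close>
  leaves the Schur complement \<open>B\<close>, which is again symmetric and negative definite.
\<close>

lemma neg_definite_solve:
  fixes A :: "'v \<Rightarrow> 'v \<Rightarrow> 'a::linordered_field"
  assumes "finite S" "\<And>v w. A v w = A w v"
    "\<And>x :: 'v \<Rightarrow> 'a. \<exists>v\<in>S. x v \<noteq> 0 \<Longrightarrow> (\<Sum>v\<in>S. \<Sum>w\<in>S. x v * A v w * x w) < 0"
  shows "\<exists>x. \<forall>v\<in>S. (\<Sum>w\<in>S. A v w * x w) = y v"
  using assms
proof (induction S arbitrary: A y rule: finite_induct)
  case (insert a T)
  define d where "d = A a a"
  have exp: "(\<Sum>v\<in>insert a T. \<Sum>w\<in>insert a T. x v * A v w * x w) =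
    d * (x a)\<^sup>2 + 2 * x a * (\<Sum>w\<in>T. A a w * x w) + (\<Sum>v\<in>T. \<Sum>w\<in>T. x v * A v w * x w)" for x
  proof -
    have "(\<Sum>v\<in>T. x v * A v a * x a) = x a * (\<Sum>w\<in>T. A a w * x w)"
      by (simp add: sum_distrib_left insert.prems(1)[of _ a] mult_ac)
    moreover have "(\<Sum>w\<in>T. x a * A a w * x w) = x a * (\<Sum>w\<in>T. A a w * x w)"
      by (simp add: sum_distrib_left mult_ac)
    ultimately show ?thesis
      using insert.hyps by (simp add: sum.distrib d_def power2_eq_square algebra_simps)
  qed
  have "d < 0"
    using insert.prems(2)[of "\<lambda>v. if v = a then 1 else 0"] insert.hyps
    unfolding exp by (simp add: d_def sum.neutral if_distrib cong: if_cong)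
  define B where "B = (\<lambda>v w. A v w - A v a * A a w / d)"
  have "\<exists>x. \<forall>v\<in>T. (\<Sum>w\<in>T. B v w * x w) = y v - A v a * y a / d"
  proof (rule insert.IH)
    show "B v w = B w v" for v w
      using insert.prems(1) by (simp add: B_def mult.commute)
    fix x :: "'v \<Rightarrow> 'a" assume x: "\<exists>v\<in>T. x v \<noteq> 0"
    define s where "s = (\<Sum>w\<in>T. A a w * x w)"
    \<comment> \<open>This value at \<open>a\<close> maximises the form over all extensions of \<open>x\<close>.\<close>
    define x' where "x' = x(a := - s / d)"
    have eq: "x' v = x v" if "v \<in> T" for v using that insert.hyps by (auto simp: x'_def)
    have "(\<Sum>v\<in>T. \<Sum>w\<in>T. x v * B v w * x w) =
      (\<Sum>v\<in>T. \<Sum>w\<in>T. x v * A v w * x w) - (\<Sum>v\<in>T. \<Sum>w\<in>T. (A a v * x v) * (A a w * x w)) / d"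
      by (simp add: B_def sum_subtractf sum_divide_distrib insert.prems(1)[of _ a] algebra_simps)
    also have "(\<Sum>v\<in>T. \<Sum>w\<in>T. (A a v * x v) * (A a w * x w)) = s * s"
      by (simp add: s_def sum_product)
    also have "(\<Sum>v\<in>T. \<Sum>w\<in>T. x v * A v w * x w) - s * s / d =
      (\<Sum>v\<in>insert a T. \<Sum>w\<in>insert a T. x' v * A v w * x' w)"
      unfolding exp using \<open>d < 0\<close>
      by (simp add: eq s_def[symmetric]) (simp add: x'_def power2_eq_square field_simps)
    also have "\<dots> < 0" using x eq by (intro insert.prems(2)) auto
    finally show "(\<Sum>v\<in>T. \<Sum>w\<in>T. x v * B v w * x w) < 0" .
  qed
  then obtain x where x: "\<And>v. v \<in> T \<Longrightarrow> (\<Sum>w\<in>T. B v w * x w) = y v - A v a * y a / d" by blast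
  define s where "s = (\<Sum>w\<in>T. A a w * x w)"
  define x' where "x' = x(a := (y a - s) / d)"
  have sum: "(\<Sum>w\<in>insert a T. A v w * x' w) = A v a * (y a - s) / d + (\<Sum>w\<in>T. A v w * x w)" for v
  proof -
    have "(\<Sum>w\<in>T. A v w * x' w) = (\<Sum>w\<in>T. A v w * x w)"
      using insert.hyps by (intro sum.cong) (auto simp: x'_def)
    then show ?thesis using insert.hyps by (simp add: x'_def)
  qed
  have "(\<Sum>w\<in>insert a T. A v w * x' w) = y v" if "v \<in> insert a T" for v
  proof (cases "v = a")
    case True
    then show ?thesis unfolding sum using \<open>d < 0\<close> by (simp add: s_def[symmetric] d_def[symmetric])
  next
    case False
    then have "v \<in> T" using that by simp
    have "(\<Sum>w\<in>T. B v w * x w) = (\<Sum>w\<in>T. A v w * x w) - A v a * s / d"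
      by (simp add: B_def s_def sum_subtractf sum_divide_distrib sum_distrib_left algebra_simps)
    then show ?thesis unfolding sum using x[OF \<open>v \<in> T\<close>] by (simp add: diff_divide_distrib right_diff_distrib)
  qed
  then show ?case by blast
qed simp

lemma plumb_mat_solve:
  fixes y :: "'v \<Rightarrow> rat"
  assumes fin: "finite (verts \<Gamma>)" and nd: "negative_definite \<Gamma>"
  shows "\<exists>x\<in>vecs \<Gamma>. \<forall>v\<in>verts \<Gamma>. mat_vec \<Gamma> (plumb_mat \<Gamma>) x v = y v"
proof -
  let ?V = "verts \<Gamma>"
  have neg: "form \<Gamma> x x < 0" if x: "\<exists>v\<in>?V. x v \<noteq> 0" for x :: "'v \<Rightarrow> rat"
  proof -
    let ?x = "\<lambda>v. if v \<in> ?V then real_of_rat (x v) else 0"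
    have "?x \<noteq> (\<lambda>_. 0)" using x by (metis of_rat_eq_0_iff)
    then have "form \<Gamma> ?x ?x < 0" using nd by (simp add: negative_definite_def vecs_def)
    also have "form \<Gamma> ?x ?x = real_of_rat (form \<Gamma> x x)"
      unfolding form_expand of_rat_sum
    proof (intro sum.cong refl)
      fix v w assume vw: "v \<in> ?V" "w \<in> ?V"
      have "real_of_rat (plumb_mat \<Gamma> v w) = plumb_mat \<Gamma> v w"
        unfolding plumb_mat_def by simp
      then show "?x v * plumb_mat \<Gamma> v w * ?x w = real_of_rat (x v * plumb_mat \<Gamma> v w * x w)"
        using vw by (simp add: of_rat_mult)
    qed
    finally show ?thesis by simp
  qed
  have "\<exists>x. \<forall>v\<in>?V. (\<Sum>w\<in>?V. plumb_mat \<Gamma> v w * x w) = y v"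
    by (rule neg_definite_solve[OF fin plumb_mat_sym]) (rule neg[unfolded form_expand])
  then obtain x where x: "\<And>v. v \<in> ?V \<Longrightarrow> (\<Sum>w\<in>?V. plumb_mat \<Gamma> v w * x w) = y v"
    by blast
  let ?x = "\<lambda>v. if v \<in> ?V then x v else 0"
  have "?x \<in> vecs \<Gamma>" by (simp add: vecs_def)
  moreover have "mat_vec \<Gamma> (plumb_mat \<Gamma>) ?x v = y v" if "v \<in> ?V" for v
    using x[OF that] by (simp add: mat_vec_def)
  ultimately show ?thesis by blast
qed

lemma mat_mat_assoc: "mat_mat \<Gamma> (mat_mat \<Gamma> A B) C = mat_mat \<Gamma> A (mat_mat \<Gamma> B C)"
proof (intro ext)
  fix v w
  have "mat_mat \<Gamma> (mat_mat \<Gamma> A B) C v w =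
    (\<Sum>t\<in>verts \<Gamma>. \<Sum>u\<in>verts \<Gamma>. A v u * (B u t * C t w))"
    by (simp add: mat_mat_def sum_distrib_right mult.assoc)
  also have "\<dots> = (\<Sum>u\<in>verts \<Gamma>. \<Sum>t\<in>verts \<Gamma>. A v u * (B u t * C t w))"
    by (rule sum.swap)
  also have "\<dots> = mat_mat \<Gamma> A (mat_mat \<Gamma> B C) v w"
    by (simp add: mat_mat_def sum_distrib_left)
  finally show "mat_mat \<Gamma> (mat_mat \<Gamma> A B) C v w = mat_mat \<Gamma> A (mat_mat \<Gamma> B C) v w" .
qed

lemma id_mat_sum:
  assumes "finite (verts \<Gamma>)" "v \<in> verts \<Gamma>"
  shows "(\<Sum>w\<in>verts \<Gamma>. id_mat \<Gamma> v w * x w) = x v"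
proof -
  have "(\<Sum>w\<in>verts \<Gamma>. id_mat \<Gamma> v w * x w) = (\<Sum>w\<in>verts \<Gamma>. if w = v then x w else 0)"
    by (rule sum.cong) (auto simp: id_mat_def)
  then show ?thesis using assms by simp
qed

lemma mat_mat_id:
  assumes "finite (verts \<Gamma>)" "\<And>v w. v \<notin> verts \<Gamma> \<or> w \<notin> verts \<Gamma> \<Longrightarrow> N v w = 0"
  shows "mat_mat \<Gamma> (id_mat \<Gamma>) N = N" "mat_mat \<Gamma> N (id_mat \<Gamma>) = N"
proof -
  show "mat_mat \<Gamma> (id_mat \<Gamma>) N = N"
  proof (intro ext)
    fix v w show "mat_mat \<Gamma> (id_mat \<Gamma>) N v w = N v w"
    proof (cases "v \<in> verts \<Gamma>")
      case True
      then show ?thesis unfolding mat_mat_def by (rule id_mat_sum[OF assms(1)])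
    next
      case False
      then show ?thesis using assms(2) by (simp add: mat_mat_def id_mat_def)
    qed
  qed
  show "mat_mat \<Gamma> N (id_mat \<Gamma>) = N"
  proof (intro ext)
    fix v w
    have "mat_mat \<Gamma> N (id_mat \<Gamma>) v w = (\<Sum>u\<in>verts \<Gamma>. if u = w then N v u else 0)"
      unfolding mat_mat_def by (rule sum.cong) (auto simp: id_mat_def)
    then show "mat_mat \<Gamma> N (id_mat \<Gamma>) v w = N v w" using assms by auto
  qed
qed

text \<open>
  An inverse exists and is unique, so the definite description of the inverse matrix denotes it.
\<close>

lemma plumb_mat_inv:
  assumes fin: "finite (verts \<Gamma>)" and nd: "negative_definite \<Gamma>"
  shows "mat_mat \<Gamma> (plumb_mat_inv \<Gamma>) (plumb_mat \<Gamma>) = id_mat \<Gamma>"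
proof -
  let ?V = "verts \<Gamma>" and ?M = "plumb_mat \<Gamma> :: 'a \<Rightarrow> 'a \<Rightarrow> rat"
  let ?inv = "\<lambda>N. (\<forall>v w. v \<notin> ?V \<or> w \<notin> ?V \<longrightarrow> N v w = 0) \<and>
    mat_mat \<Gamma> ?M N = id_mat \<Gamma> \<and> mat_mat \<Gamma> N ?M = id_mat \<Gamma>"
  have "\<forall>w. \<exists>x\<in>vecs \<Gamma>. \<forall>v\<in>?V. mat_vec \<Gamma> ?M x v = id_mat \<Gamma> v w"
    by (intro allI plumb_mat_solve[OF assms])
  then obtain X where X: "\<And>w. X w \<in> vecs \<Gamma>" "\<And>v w. v \<in> ?V \<Longrightarrow> mat_vec \<Gamma> ?M (X w) v = id_mat \<Gamma> v w"
    by metis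
  define N where "N = (\<lambda>v w. if w \<in> ?V then X w v else 0)"
  have N0: "N v w = 0" if "v \<notin> ?V \<or> w \<notin> ?V" for v w
    using that X(1) by (auto simp: N_def vecs_def)
  have M0: "?M v w = 0" if "v \<notin> ?V \<or> w \<notin> ?V" for v w
    using that by (auto simp: plumb_mat_def)
  have MN: "mat_mat \<Gamma> ?M N = id_mat \<Gamma>"
  proof (intro ext)
    fix v w
    show "mat_mat \<Gamma> ?M N v w = id_mat \<Gamma> v w"
    proof (cases "v \<in> ?V \<and> w \<in> ?V")
      case True
      then show ?thesis using X(2)[of v w] by (simp add: mat_mat_def mat_vec_def N_def)
    next
      case False
      then show ?thesis by (auto simp: mat_mat_def id_mat_def plumb_mat_def N_def)
    qed
  qed
  \<comment> \<open>Since the matrix is symmetric, the transpose of a right inverse is a left inverse.\<close>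
  have NtM: "mat_mat \<Gamma> (\<lambda>v w. N w v) ?M = id_mat \<Gamma>"
  proof (intro ext)
    fix v w
    have "mat_mat \<Gamma> (\<lambda>v w. N w v) ?M v w = mat_mat \<Gamma> ?M N w v"
      by (simp add: mat_mat_def plumb_mat_sym[of \<Gamma> w] mult.commute)
    then show "mat_mat \<Gamma> (\<lambda>v w. N w v) ?M v w = id_mat \<Gamma> v w"
      unfolding MN by (auto simp: id_mat_def)
  qed
  have "(\<lambda>v w. N w v) = mat_mat \<Gamma> (\<lambda>v w. N w v) (mat_mat \<Gamma> ?M N)"
    unfolding MN by (rule mat_mat_id(2)[OF fin, symmetric]) (use N0 in blast)
  also have "\<dots> = N"
    unfolding mat_mat_assoc[symmetric] NtM by (rule mat_mat_id(1)[OF fin]) (use N0 in blast)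
  finally have "mat_mat \<Gamma> N ?M = id_mat \<Gamma>" using NtM by simp
  then have ex: "?inv N" using N0 MN by blast
  moreover have "N' = N" if "?inv N'" for N'
  proof -
    have "N' = mat_mat \<Gamma> N' (mat_mat \<Gamma> ?M N)"
      unfolding MN by (rule mat_mat_id(2)[OF fin, symmetric]) (use that in blast)
    also have "\<dots> = mat_mat \<Gamma> (id_mat \<Gamma>) N" unfolding mat_mat_assoc[symmetric] using that by simp
    also have "\<dots> = N" by (rule mat_mat_id(1)[OF fin]) (use N0 in blast)
    finally show ?thesis .
  qed
  ultimately have "plumb_mat_inv \<Gamma> = N"
    unfolding plumb_mat_inv_def by (intro the_equality)
  then show ?thesis using ex by simp
qed

text \<open>
  The constant \<open>\<Delta>\<^sub>k\<close> without reference to the inverse matrix: the quadratic term is \<open>y \<cdot> z\<close> for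
  \<open>y = k - M u\<close> and any \<open>z\<close> with \<open>M z = y\<close>.
\<close>

lemma Delta_eq:
  fixes z :: "'v \<Rightarrow> rat"
  assumes fin: "finite (verts \<Gamma>)" and nd: "negative_definite \<Gamma>"
    and z: "\<And>v. v \<in> verts \<Gamma> \<Longrightarrow> mat_vec \<Gamma> (plumb_mat \<Gamma>) z v =
      of_int (k v - mat_vec \<Gamma> (plumb_mat \<Gamma>) (ones \<Gamma>) v)"
  shows "Delta \<Gamma> k = - ((dotp \<Gamma> (\<lambda>v. of_int (k v - mat_vec \<Gamma> (plumb_mat \<Gamma>) (ones \<Gamma>) v)) z
    + 3 * of_nat (card (verts \<Gamma>)) + of_int (\<Sum>v\<in>verts \<Gamma>. wt \<Gamma> v)) / 4)"
proof -
  let ?V = "verts \<Gamma>" and ?M = "plumb_mat \<Gamma> :: 'v \<Rightarrow> 'v \<Rightarrow> rat" and ?N = "plumb_mat_inv \<Gamma>"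
  let ?y = "\<lambda>v. rat_of_int (k v - mat_vec \<Gamma> (plumb_mat \<Gamma>) (ones \<Gamma>) v)"
  have "mat_vec \<Gamma> ?N ?y v = z v" if v: "v \<in> ?V" for v
  proof -
    have "mat_vec \<Gamma> ?N ?y v = (\<Sum>w\<in>?V. ?N v w * mat_vec \<Gamma> ?M z w)"
      unfolding mat_vec_def[of \<Gamma> ?N] by (rule sum.cong) (simp_all add: z)
    also have "\<dots> = (\<Sum>u\<in>?V. mat_mat \<Gamma> ?N ?M v u * z u)"
      by (simp add: mat_vec_def mat_mat_def sum_distrib_left sum_distrib_right mult.assoc) (rule sum.swap)
    also have "\<dots> = z v" unfolding plumb_mat_inv[OF fin nd] by (rule id_mat_sum[OF fin v])
    finally show ?thesis .
  qed
  then have "dotp \<Gamma> ?y (mat_vec \<Gamma> ?N ?y) = dotp \<Gamma> ?y z" by (simp add: dotp_def)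
  then show ?thesis unfolding Delta_def Let_def by simp
qed

section \<open>Blow-ups of plumbings\<close>

text \<open>
  The plumbing \<open>\<Gamma>'\<close> arises from \<open>\<Gamma>\<close> by blowing up at the set \<open>A\<close>, which has to be a clique: the
  new vertex \<open>v0\<close> of weight \<open>-1\<close> is joined to all of \<open>A\<close>, the weights in \<open>A\<close> drop by \<open>1\<close>, and
  the edges inside \<open>A\<close> are removed. A pair with two elements is a type (a) move, a singleton is a
  type (b) move. Loops are excluded because they would count towards the degree.
\<close>

definition blow_up :: "'v plumbing \<Rightarrow> 'v set \<Rightarrow> 'v \<Rightarrow> 'v plumbing \<Rightarrow> bool" where
  "blow_up \<Gamma> A v0 \<Gamma>' \<longleftrightarrow>
     finite (verts \<Gamma>) \<and> A \<subseteq> verts \<Gamma> \<and> v0 \<notin> verts \<Gamma> \<and> verts \<Gamma>' = insert v0 (verts \<Gamma>) \<and>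
     wt \<Gamma>' v0 = - 1 \<and> (\<forall>v\<in>verts \<Gamma>. wt \<Gamma>' v = wt \<Gamma> v - (if v \<in> A then 1 else 0)) \<and>
     (\<forall>v\<in>verts \<Gamma>'. {v, v} \<notin> edges \<Gamma> \<and> {v, v} \<notin> edges \<Gamma>') \<and>
     (\<forall>v\<in>verts \<Gamma>. {v, v0} \<in> edges \<Gamma>' \<longleftrightarrow> v \<in> A) \<and>
     (\<forall>v\<in>verts \<Gamma>. \<forall>w\<in>verts \<Gamma>. v \<noteq> w \<longrightarrow>
        (if v \<in> A \<and> w \<in> A then {v, w} \<in> edges \<Gamma> \<and> {v, w} \<notin> edges \<Gamma>'
         else {v, w} \<in> edges \<Gamma>' \<longleftrightarrow> {v, w} \<in> edges \<Gamma>))"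

text \<open>
  The linear functional \<open>d\<close> by whose square the form changes. Together with the projection that
  forgets the coordinate at \<open>v0\<close>, it splits the new form as the orthogonal sum of the old one and
  the form \<open>-1\<close> of rank one.
\<close>

definition defect :: "'v set \<Rightarrow> 'v \<Rightarrow> ('v \<Rightarrow> 'a::comm_ring_1) \<Rightarrow> 'a" where
  "defect A v0 x = x v0 - (\<Sum>v\<in>A. x v)"

lemma dotp_cong:
  assumes "\<And>v. v \<in> verts \<Gamma> \<Longrightarrow> x v = x' v" "\<And>v. v \<in> verts \<Gamma> \<Longrightarrow> y v = y' v"
  shows "dotp \<Gamma> x y = dotp \<Gamma> x' y'"
  using assms by (simp add: dotp_def)

lemma mat_vec_cong:
  assumes "\<And>v. v \<in> verts \<Gamma> \<Longrightarrow> x v = x' v"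
  shows "mat_vec \<Gamma> A x = mat_vec \<Gamma> A x'"
  using assms by (simp add: mat_vec_def)

lemma form_cong:
  assumes "\<And>v. v \<in> verts \<Gamma> \<Longrightarrow> x v = x' v" "\<And>v. v \<in> verts \<Gamma> \<Longrightarrow> y v = y' v"
  shows "form \<Gamma> x y = form \<Gamma> x' y'"
  unfolding form_def using assms mat_vec_cong[of \<Gamma> y y'] by (intro dotp_cong) auto

lemma chi_cong:
  assumes "\<And>v. v \<in> verts \<Gamma> \<Longrightarrow> x v = x' v"
  shows "chi \<Gamma> k x = chi \<Gamma> k x'"
  using dotp_cong[of \<Gamma> k k x x'] form_cong[of \<Gamma> x x' x x'] assms by (simp add: chi_def)

context
  fixes \<Gamma> \<Gamma>' :: "'v plumbing" and A :: "'v set" and v0 :: 'v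
  assumes bu: "blow_up \<Gamma> A v0 \<Gamma>'"
begin

lemma blow_up_facts:
  "finite (verts \<Gamma>)" "A \<subseteq> verts \<Gamma>" "v0 \<notin> verts \<Gamma>" "verts \<Gamma>' = insert v0 (verts \<Gamma>)"
  "finite A" "v0 \<notin> A" "finite (verts \<Gamma>')"
  using bu finite_subset by (auto simp: blow_up_def)

lemma plumb_mat_blow_up:
  "v \<in> verts \<Gamma> \<Longrightarrow> w \<in> verts \<Gamma> \<Longrightarrow>
    plumb_mat \<Gamma>' v w = plumb_mat \<Gamma> v w - (if v \<in> A \<and> w \<in> A then 1 else 0)"
  "v \<in> verts \<Gamma> \<Longrightarrow> plumb_mat \<Gamma>' v v0 = (if v \<in> A then 1 else 0)"
  "v \<in> verts \<Gamma> \<Longrightarrow> plumb_mat \<Gamma>' v0 v = (if v \<in> A then 1 else 0)"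
  "plumb_mat \<Gamma>' v0 v0 = - 1"
proof -
  show "plumb_mat \<Gamma>' v w = plumb_mat \<Gamma> v w - (if v \<in> A \<and> w \<in> A then 1 else 0)"
    if v: "v \<in> verts \<Gamma>" and w: "w \<in> verts \<Gamma>"
  proof (cases "v = w")
    case True
    have "wt \<Gamma>' v = wt \<Gamma> v - (if v \<in> A then 1 else 0)" using bu v by (simp add: blow_up_def)
    then show ?thesis using True v blow_up_facts by (simp add: plumb_mat_def)
  next
    case False
    then have "if v \<in> A \<and> w \<in> A then {v, w} \<in> edges \<Gamma> \<and> {v, w} \<notin> edges \<Gamma>'
        else {v, w} \<in> edges \<Gamma>' \<longleftrightarrow> {v, w} \<in> edges \<Gamma>"
      using bu v w unfolding blow_up_def by metis
    then show ?thesis using False v w blow_up_facts by (auto simp: plumb_mat_def)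
  qed
  show *: "plumb_mat \<Gamma>' v v0 = (if v \<in> A then 1 else 0)" if "v \<in> verts \<Gamma>"
    using bu that unfolding blow_up_def plumb_mat_def by auto
  show "plumb_mat \<Gamma>' v0 v = (if v \<in> A then 1 else 0)" if "v \<in> verts \<Gamma>"
    using *[OF that] plumb_mat_sym by metis
  show "plumb_mat \<Gamma>' v0 v0 = - 1"
    using bu unfolding blow_up_def plumb_mat_def by simp
qed

lemma sum_blow_up_centre: "(\<Sum>v\<in>verts \<Gamma>. if v \<in> A then f v else 0) = (\<Sum>v\<in>A. f v)"
  using blow_up_facts by (simp add: sum.If_cases Int_absorb1)

lemma mat_vec_blow_up:
  "v \<in> verts \<Gamma> \<Longrightarrow> mat_vec \<Gamma>' (plumb_mat \<Gamma>') x v =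
    mat_vec \<Gamma> (plumb_mat \<Gamma>) x v + (if v \<in> A then defect A v0 x else 0)"
  "mat_vec \<Gamma>' (plumb_mat \<Gamma>') x v0 = - defect A v0 x"
proof -
  assume v: "v \<in> verts \<Gamma>"
  have "(\<Sum>w\<in>verts \<Gamma>. plumb_mat \<Gamma>' v w * x w) =
    (\<Sum>w\<in>verts \<Gamma>. plumb_mat \<Gamma> v w * x w - (if w \<in> A then (if v \<in> A then x w else 0) else 0))"
    by (rule sum.cong) (auto simp: plumb_mat_blow_up v algebra_simps)
  also have "\<dots> = mat_vec \<Gamma> (plumb_mat \<Gamma>) x v - (\<Sum>w\<in>A. if v \<in> A then x w else 0)"
    by (simp only: sum_subtractf sum_blow_up_centre mat_vec_def)
  finally show "mat_vec \<Gamma>' (plumb_mat \<Gamma>') x v =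
    mat_vec \<Gamma> (plumb_mat \<Gamma>) x v + (if v \<in> A then defect A v0 x else 0)"
    using blow_up_facts v by (simp add: mat_vec_def plumb_mat_blow_up defect_def)
next
  have "(\<Sum>w\<in>verts \<Gamma>. plumb_mat \<Gamma>' v0 w * x w) = (\<Sum>w\<in>verts \<Gamma>. if w \<in> A then x w else 0)"
    by (rule sum.cong) (auto simp: plumb_mat_blow_up)
  then show "mat_vec \<Gamma>' (plumb_mat \<Gamma>') x v0 = - defect A v0 x"
    using blow_up_facts by (simp add: mat_vec_def plumb_mat_blow_up defect_def sum_blow_up_centre)
qed

lemma dotp_blow_up:
  assumes "k' v0 = s" "\<And>v. v \<in> verts \<Gamma> \<Longrightarrow> k' v = k v - (if v \<in> A then s else 0)"
  shows "dotp \<Gamma>' k' x = dotp \<Gamma> k x + s * defect A v0 x"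
proof -
  have "(\<Sum>v\<in>verts \<Gamma>. k' v * x v) = (\<Sum>v\<in>verts \<Gamma>. k v * x v - (if v \<in> A then s * x v else 0))"
    by (rule sum.cong) (auto simp: assms algebra_simps)
  also have "\<dots> = dotp \<Gamma> k x - s * (\<Sum>v\<in>A. x v)"
    by (simp only: sum_subtractf sum_blow_up_centre dotp_def sum_distrib_left)
  finally show ?thesis
    using blow_up_facts by (simp add: dotp_def assms(1) defect_def algebra_simps)
qed

lemma form_blow_up: "form \<Gamma>' x y = form \<Gamma> x y - defect A v0 x * defect A v0 y"
proof -
  have "dotp \<Gamma>' (mat_vec \<Gamma>' (plumb_mat \<Gamma>') x) y =
    dotp \<Gamma> (mat_vec \<Gamma> (plumb_mat \<Gamma>) x) y + - defect A v0 x * defect A v0 y"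
    by (rule dotp_blow_up) (auto simp: mat_vec_blow_up)
  then show ?thesis by (simp add: dotp_mat_vec)
qed

lemma defect_ones: "defect A v0 (ones \<Gamma>') = 1 - int (card A)"
proof -
  have "(\<Sum>v\<in>A. ones \<Gamma>' v) = (\<Sum>v\<in>A. 1)"
    using blow_up_facts by (intro sum.cong) (auto simp: ones_def)
  then show ?thesis using blow_up_facts by (simp add: defect_def ones_def)
qed

lemma negative_definite_blow_up: "negative_definite \<Gamma>' \<longleftrightarrow> negative_definite \<Gamma>"
proof
  assume nd: "negative_definite \<Gamma>'"
  show "negative_definite \<Gamma>" unfolding negative_definite_def
  proof (intro allI impI)
    fix x :: "'v \<Rightarrow> real" assume x: "x \<in> vecs \<Gamma> \<and> x \<noteq> (\<lambda>_. 0)"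
    let ?x = "x(v0 := \<Sum>v\<in>A. x v)"
    have eq: "?x v = x v" if "v \<in> verts \<Gamma>" for v using that blow_up_facts by auto
    have "(\<Sum>v\<in>A. ?x v) = (\<Sum>v\<in>A. x v)" using eq blow_up_facts by (intro sum.cong) auto
    then have d: "defect A v0 ?x = 0" by (simp add: defect_def)
    have "x v0 = 0" using x blow_up_facts by (auto simp: vecs_def)
    moreover obtain v where v: "x v \<noteq> 0" using x by auto
    ultimately have "?x v \<noteq> 0" by auto
    then have "?x \<noteq> (\<lambda>_. 0)" by metis
    moreover have "?x \<in> vecs \<Gamma>'" using x blow_up_facts by (auto simp: vecs_def)
    ultimately have "form \<Gamma>' ?x ?x < 0" using nd by (auto simp: negative_definite_def)
    then show "form \<Gamma> x x < 0" using form_cong[of \<Gamma> ?x x ?x x] eq d by (simp add: form_blow_up)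
  qed
next
  assume nd: "negative_definite \<Gamma>"
  show "negative_definite \<Gamma>'" unfolding negative_definite_def
  proof (intro allI impI)
    fix x :: "'v \<Rightarrow> real" assume x: "x \<in> vecs \<Gamma>' \<and> x \<noteq> (\<lambda>_. 0)"
    let ?x = "x(v0 := 0)"
    have "form \<Gamma> x x = form \<Gamma> ?x ?x" by (rule form_cong) (use blow_up_facts in auto)
    then have f: "form \<Gamma>' x x = form \<Gamma> ?x ?x - (defect A v0 x)\<^sup>2"
      unfolding form_blow_up by (simp add: power2_eq_square)
    show "form \<Gamma>' x x < 0"
    proof (cases "?x = (\<lambda>_. 0)")
      case True
      then have x0: "x v = 0" if "v \<noteq> v0" for v using that by (metis fun_upd_other)
      have "(\<Sum>v\<in>A. x v) = 0" using x0 blow_up_facts(6) by (metis sum.neutral)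
      then have "defect A v0 x = x v0" by (simp add: defect_def)
      moreover have "x v0 \<noteq> 0"
      proof
        assume "x v0 = 0"
        then have "x v = 0" for v using x0[of v] by (cases "v = v0") auto
        then show False using x by auto
      qed
      ultimately have "form \<Gamma>' x x = - (x v0)\<^sup>2" "x v0 \<noteq> 0" using f True by (auto simp: form_expand)
      then show ?thesis by simp
    next
      case False
      moreover have "?x \<in> vecs \<Gamma>" using x blow_up_facts by (auto simp: vecs_def)
      ultimately have "form \<Gamma> ?x ?x < 0" using nd by (auto simp: negative_definite_def)
      moreover have "0 \<le> (defect A v0 x)\<^sup>2" by simp
      ultimately show ?thesis using f by linarith
    qed
  qed
qed

lemma vdeg_blow_up_new: "vdeg \<Gamma>' v0 = card A"
proof -
  have "{w \<in> verts \<Gamma>'. {v0, w} \<in> edges \<Gamma>'} = A"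
    using bu unfolding blow_up_def by (auto simp: insert_commute)
  then show ?thesis by (simp add: vdeg_def)
qed

text \<open>
  A vertex in \<open>A\<close> loses its \<open>card A - 1\<close> neighbours in \<open>A\<close> and gains \<open>v0\<close>.
\<close>

lemma vdeg_blow_up:
  assumes v: "v \<in> verts \<Gamma>"
  shows "vdeg \<Gamma>' v + (if v \<in> A then card A else 0) = vdeg \<Gamma> v + (if v \<in> A then 2 else 0)"
proof -
  let ?N = "{w \<in> verts \<Gamma>. {v, w} \<in> edges \<Gamma>}" and ?N' = "{w \<in> verts \<Gamma>'. {v, w} \<in> edges \<Gamma>'}"
  note f = blow_up_facts
  have ll: "{v, v} \<notin> edges \<Gamma>" "{v, v} \<notin> edges \<Gamma>'" using bu v unfolding blow_up_def by auto
  have v0: "{v, v0} \<in> edges \<Gamma>' \<longleftrightarrow> v \<in> A" using bu v unfolding blow_up_def by auto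
  have e: "if v \<in> A \<and> w \<in> A then {v, w} \<in> edges \<Gamma> \<and> {v, w} \<notin> edges \<Gamma>'
         else {v, w} \<in> edges \<Gamma>' \<longleftrightarrow> {v, w} \<in> edges \<Gamma>" if "w \<in> verts \<Gamma>" "w \<noteq> v" for w
    using bu v that unfolding blow_up_def by metis
  show ?thesis
  proof (cases "v \<in> A")
    case False
    have "{v, w} \<in> edges \<Gamma>' \<longleftrightarrow> {v, w} \<in> edges \<Gamma>" if "w \<in> verts \<Gamma>" for w
      using e[OF that] ll False by (cases "w = v") auto
    then have "?N' = ?N" using f(4) v0 False by auto
    then show ?thesis using False by (simp add: vdeg_def)
  next
    case True
    have "{v, w} \<in> edges \<Gamma>' \<longleftrightarrow> {v, w} \<in> edges \<Gamma> \<and> w \<notin> A" if "w \<in> verts \<Gamma>" for w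
      using e[OF that] ll True by (cases "w = v") (auto split: if_splits)
    then have N': "?N' = insert v0 (?N - (A - {v}))" using f(3,4) v0 True ll by auto
    have sub: "A - {v} \<subseteq> ?N" using e f(2) True by auto
    have finN: "finite ?N" using f(1) by simp
    have "card ?N' = Suc (card (?N - (A - {v})))"
      unfolding N' using finN f(3) by (subst card_insert_disjoint) auto
    also have "card (?N - (A - {v})) = card ?N - card (A - {v})"
      using sub finN by (intro card_Diff_subset) (use f(5) in auto)
    also have "card (A - {v}) = card A - 1" using True f(5) by simp
    finally have "card ?N' = Suc (card ?N - (card A - 1))" .
    moreover have "card A - 1 \<le> card ?N" using card_mono[OF finN sub] True f(5) by simp
    moreover have "card A \<noteq> 0" using True f(5) by auto
    ultimately show ?thesis using True by (simp add: vdeg_def)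
  qed
qed

lemma chi_blow_up:
  assumes k': "k' v0 = s" "\<And>v. v \<in> verts \<Gamma> \<Longrightarrow> k' v = k v - (if v \<in> A then s else 0)"
    and s: "s = 1 \<or> s = - 1"
  shows "chi \<Gamma>' k' x = chi \<Gamma> k x + defect A v0 x * (defect A v0 x - s) div 2"
proof -
  let ?d = "defect A v0 x"
  have "even (?d * (?d - s))" using s by auto
  then obtain m where m: "?d * (?d - s) = 2 * m" by (elim evenE)
  have "dotp \<Gamma>' k' x = dotp \<Gamma> k x + s * ?d" by (rule dotp_blow_up) (use k' in auto)
  then have "dotp \<Gamma>' k' x + form \<Gamma>' x x = (dotp \<Gamma> k x + form \<Gamma> x x) + 2 * (- m)"
    unfolding form_blow_up using m by (simp add: algebra_simps)
  then have "(dotp \<Gamma>' k' x + form \<Gamma>' x x) div 2 = (dotp \<Gamma> k x + form \<Gamma> x x) div 2 - m"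
    by simp
  then show ?thesis unfolding chi_def m by simp
qed

text \<open>
  With \<open>c = s + 1 - card A\<close>, the vector \<open>k' - M' u'\<close> is \<open>c\<close> at \<open>v0\<close> and differs from \<open>k - M u\<close>
  by \<open>-c\<close> on \<open>A\<close>. So a solution \<open>z\<close> for \<open>\<Gamma>\<close> extends to one with defect \<open>-c\<close>, and the square
  changes by \<open>-c\<^sup>2\<close>. This cancels against the change \<open>3 - (1 + card A)\<close> of the other terms in
  the two cases that belong to Neumann moves.
\<close>

lemma Delta_blow_up:
  assumes nd: "negative_definite \<Gamma>"
    and k': "k' v0 = s" "\<And>v. v \<in> verts \<Gamma> \<Longrightarrow> k' v = k v - (if v \<in> A then s else 0)"
    and A: "card A = 2 \<and> s = 1 \<or> card A = 1 \<and> s = - 1"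
  shows "Delta \<Gamma>' k' = Delta \<Gamma> k"
proof -
  let ?y = "\<lambda>v. k v - mat_vec \<Gamma> (plumb_mat \<Gamma>) (ones \<Gamma>) v"
  let ?y' = "\<lambda>v. k' v - mat_vec \<Gamma>' (plumb_mat \<Gamma>') (ones \<Gamma>') v"
  define c where "c = s + 1 - int (card A)"
  note f = blow_up_facts
  have ones: "mat_vec \<Gamma> (plumb_mat \<Gamma>) (ones \<Gamma>') = mat_vec \<Gamma> (plumb_mat \<Gamma>) (ones \<Gamma>)"
    by (rule mat_vec_cong) (auto simp: ones_def f)
  have y0: "?y' v0 = c"
    by (simp add: mat_vec_blow_up(2) defect_ones k'(1) c_def)
  have yv: "?y' v = ?y v - (if v \<in> A then c else 0)" if "v \<in> verts \<Gamma>" for v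
    by (simp add: mat_vec_blow_up(1)[OF that] defect_ones k'(2)[OF that] c_def ones)
  obtain z :: "'v \<Rightarrow> rat" where z: "z \<in> vecs \<Gamma>"
    "\<And>v. v \<in> verts \<Gamma> \<Longrightarrow> mat_vec \<Gamma> (plumb_mat \<Gamma>) z v = of_int (?y v)"
    using plumb_mat_solve[OF f(1) nd, of "\<lambda>v. of_int (?y v)"] by blast
  define z' where "z' = z(v0 := (\<Sum>v\<in>A. z v) - of_int c)"
  have zz: "z' v = z v" if "v \<in> verts \<Gamma>" for v using that f by (auto simp: z'_def)
  have "(\<Sum>v\<in>A. z' v) = (\<Sum>v\<in>A. z v)" using zz f by (intro sum.cong) auto
  then have dz: "defect A v0 z' = - of_int c" by (simp add: defect_def z'_def)
  have Mz: "mat_vec \<Gamma> (plumb_mat \<Gamma>) z' = mat_vec \<Gamma> (plumb_mat \<Gamma>) z"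
    by (rule mat_vec_cong) (rule zz)
  have Mz': "mat_vec \<Gamma>' (plumb_mat \<Gamma>') z' v = of_int (?y' v)" if "v \<in> verts \<Gamma>'" for v
  proof (cases "v = v0")
    case True
    have "mat_vec \<Gamma>' (plumb_mat \<Gamma>') z' v0 = of_int c" by (simp add: mat_vec_blow_up(2) dz)
    then show ?thesis by (simp only: True y0)
  next
    case False
    then have "v \<in> verts \<Gamma>" using that f by auto
    then have "mat_vec \<Gamma>' (plumb_mat \<Gamma>') z' v = of_int (?y v - (if v \<in> A then c else 0))"
      by (simp add: mat_vec_blow_up(1) dz Mz z(2))
    then show ?thesis using \<open>v \<in> verts \<Gamma>\<close> by (simp only: yv)
  qed
  have "dotp \<Gamma>' (\<lambda>v. of_int (?y' v)) z' = dotp \<Gamma> (\<lambda>v. of_int (?y v)) z' + of_int c * defect A v0 z'"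
  proof (rule dotp_blow_up)
    show "rat_of_int (?y' v0) = of_int c" unfolding y0 ..
    show "rat_of_int (?y' v) = of_int (?y v) - (if v \<in> A then of_int c else 0)" if "v \<in> verts \<Gamma>" for v
      unfolding yv[OF that] by simp
  qed
  also have "dotp \<Gamma> (\<lambda>v. of_int (?y v)) z' = dotp \<Gamma> (\<lambda>v. of_int (?y v)) z"
    by (rule dotp_cong) (auto simp: zz)
  finally have dp: "dotp \<Gamma>' (\<lambda>v. of_int (?y' v)) z' = dotp \<Gamma> (\<lambda>v. of_int (?y v)) z - of_int (c * c)"
    by (simp add: dz)
  have "(\<Sum>v\<in>verts \<Gamma>'. wt \<Gamma>' v) = - 1 + (\<Sum>v\<in>verts \<Gamma>. wt \<Gamma>' v)"
    using f bu by (simp add: blow_up_def)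
  also have "(\<Sum>v\<in>verts \<Gamma>. wt \<Gamma>' v) = (\<Sum>v\<in>verts \<Gamma>. wt \<Gamma> v - (if v \<in> A then 1 else 0))"
    by (rule sum.cong) (use bu in \<open>auto simp: blow_up_def\<close>)
  also have "\<dots> = (\<Sum>v\<in>verts \<Gamma>. wt \<Gamma> v) - int (card A)"
    by (simp only: sum_subtractf sum_blow_up_centre) simp
  finally have w: "(\<Sum>v\<in>verts \<Gamma>'. wt \<Gamma>' v) = (\<Sum>v\<in>verts \<Gamma>. wt \<Gamma> v) - int (card A) - 1" by simp
  have card: "card (verts \<Gamma>') = card (verts \<Gamma>) + 1" using f by simp
  have D: "Delta \<Gamma> k = - ((dotp \<Gamma> (\<lambda>v. of_int (?y v)) z
      + 3 * of_nat (card (verts \<Gamma>)) + of_int (\<Sum>v\<in>verts \<Gamma>. wt \<Gamma> v)) / 4)"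
    by (rule Delta_eq[OF f(1) nd]) (rule z(2))
  have D': "Delta \<Gamma>' k' = - ((dotp \<Gamma>' (\<lambda>v. of_int (?y' v)) z'
      + 3 * of_nat (card (verts \<Gamma>')) + of_int (\<Sum>v\<in>verts \<Gamma>'. wt \<Gamma>' v)) / 4)"
    by (rule Delta_eq[OF f(7)]) (use nd negative_definite_blow_up Mz' in auto)
  show ?thesis
    unfolding D D' dp w card using A by (auto simp: c_def)
qed

end

section \<open>Invariance of the root under blow-ups\<close>

lemma path_rel_interval:
  assumes ab: "a \<le> b" and sub: "\<And>e. a \<le> e \<Longrightarrow> e \<le> b \<Longrightarrow> g e \<in> sub_pts L h j"
    and succ: "\<And>e::int. (g e, g (e + 1)) \<in> E"
  shows "(g a, g b) \<in> path_rel L E h j"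
proof -
  show ?thesis
    using ab sub
  proof (induction b rule: int_ge_induct)
    case base
    then show ?case by simp
  next
    case (step i)
    have "(g a, g i) \<in> path_rel L E h j" by (rule step.IH) (use step.prems in auto)
    moreover have "(g i, g (i + 1)) \<in> path_rel L E h j"
      by (rule path_rel_step[OF succ]) (use step in auto)
    ultimately show ?case by (rule path_rel_trans)
  qed
qed

context
  fixes F :: "nat \<Rightarrow> int \<Rightarrow> 'r::{comm_ring, comm_monoid_mult}"
    and \<Gamma> \<Gamma>' :: "'v plumbing" and A :: "'v set" and v0 :: 'v and k k' :: "'v \<Rightarrow> int" and s :: int
  assumes adm: "admissible F" and bu: "blow_up \<Gamma> A v0 \<Gamma>'" and nd: "negative_definite \<Gamma>"
    and k'0: "k' v0 = s" and k'v: "\<And>v. v \<in> verts \<Gamma> \<Longrightarrow> k' v = k v - (if v \<in> A then s else 0)"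
    and A: "card A = 2 \<and> s = 1 \<or> card A = 1 \<and> s = - 1"
begin

text \<open>
  The point of the new lattice over \<open>x\<close> with defect \<open>e\<close>. The fibre over \<open>x\<close> consists of these.
\<close>

definition over :: "('v \<Rightarrow> int) \<Rightarrow> int \<Rightarrow> 'v \<Rightarrow> int" where
  "over x e = x(v0 := (\<Sum>v\<in>A. x v) + e)"

lemma over_eq: "v \<in> verts \<Gamma> \<Longrightarrow> over x e v = x v"
  using blow_up_facts[OF bu] by (auto simp: over_def)

lemma over_in_vecs: "x \<in> vecs \<Gamma> \<Longrightarrow> over x e \<in> vecs \<Gamma>'"
  using blow_up_facts[OF bu] by (auto simp: over_def vecs_def)

lemma defect_over: "defect A v0 (over x e) = e"
proof -
  have "(\<Sum>v\<in>A. over x e v) = (\<Sum>v\<in>A. x v)"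
    using blow_up_facts[OF bu] by (intro sum.cong) (auto simp: over_def)
  then show ?thesis by (simp add: defect_def over_def)
qed

lemma chi_over: "chi \<Gamma>' k' (over x e) = chi \<Gamma> k x + e * (e - s) div 2"
proof -
  have "chi \<Gamma>' k' (over x e) = chi \<Gamma> k (over x e) + defect A v0 (over x e) * (defect A v0 (over x e) - s) div 2"
    by (rule chi_blow_up[OF bu k'0 k'v]) (use A in auto)
  moreover have "chi \<Gamma> k (over x e) = chi \<Gamma> k x" by (rule chi_cong) (rule over_eq)
  ultimately show ?thesis by (simp add: defect_over)
qed

lemma over_project:
  assumes "x' \<in> vecs \<Gamma>'" "x'(v0 := 0) = x" shows "x' = over x (defect A v0 x')"
proof -
  have "(\<Sum>v\<in>A. x' v) = (\<Sum>v\<in>A. x v)"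
    using blow_up_facts[OF bu] assms(2) by (intro sum.cong) auto
  then show ?thesis using assms(2) by (auto simp: over_def defect_def)
qed

lemma project_over: "x \<in> vecs \<Gamma> \<Longrightarrow> (over x e)(v0 := 0) = x"
  using blow_up_facts[OF bu] by (auto simp: over_def vecs_def)

lemma F_vec_over:
  "F_vec F \<Gamma>' k' (over x e) = F (card A) (s + 1 - int (card A) - 2 * e) *
    (\<Prod>v\<in>verts \<Gamma>. F (vdeg \<Gamma>' v)
      (2 * mat_vec \<Gamma> (plumb_mat \<Gamma>) x v + k v - mat_vec \<Gamma> (plumb_mat \<Gamma>) (ones \<Gamma>) v
        + (if v \<in> A then 2 * e - (s + 1 - int (card A)) else 0)))"
proof -
  note f = blow_up_facts[OF bu]
  have ones: "mat_vec \<Gamma> (plumb_mat \<Gamma>) (ones \<Gamma>') = mat_vec \<Gamma> (plumb_mat \<Gamma>) (ones \<Gamma>)"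
    by (rule mat_vec_cong) (auto simp: ones_def f)
  have ov: "mat_vec \<Gamma> (plumb_mat \<Gamma>) (over x e) = mat_vec \<Gamma> (plumb_mat \<Gamma>) x"
    by (rule mat_vec_cong) (rule over_eq)
  have "2 * mat_vec \<Gamma>' (plumb_mat \<Gamma>') (over x e) v0 + k' v0 - mat_vec \<Gamma>' (plumb_mat \<Gamma>') (ones \<Gamma>') v0
    = s + 1 - int (card A) - 2 * e"
    by (simp add: mat_vec_blow_up(2)[OF bu] defect_over defect_ones[OF bu] k'0)
  moreover have "2 * mat_vec \<Gamma>' (plumb_mat \<Gamma>') (over x e) v + k' v - mat_vec \<Gamma>' (plumb_mat \<Gamma>') (ones \<Gamma>') v
    = 2 * mat_vec \<Gamma> (plumb_mat \<Gamma>) x v + k v - mat_vec \<Gamma> (plumb_mat \<Gamma>) (ones \<Gamma>) v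
        + (if v \<in> A then 2 * e - (s + 1 - int (card A)) else 0)" if "v \<in> verts \<Gamma>" for v
    by (simp add: mat_vec_blow_up(1)[OF bu that] defect_over defect_ones[OF bu] k'v[OF that] ones ov)
  ultimately show ?thesis
    unfolding F_vec_def using f by (simp add: vdeg_blow_up_new[OF bu])
qed

lemma dotp_ones_blow_up:
  "dotp \<Gamma>' k' (ones \<Gamma>') = dotp \<Gamma> k (ones \<Gamma>) + s * (1 - int (card A))"
proof -
  have "dotp \<Gamma>' k' (ones \<Gamma>') = dotp \<Gamma> k (ones \<Gamma>') + s * defect A v0 (ones \<Gamma>')"
    by (rule dotp_blow_up[OF bu k'0 k'v])
  also have "dotp \<Gamma> k (ones \<Gamma>') = dotp \<Gamma> k (ones \<Gamma>)"
    by (rule dotp_cong) (auto simp: ones_def blow_up_facts[OF bu])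
  finally show ?thesis by (simp add: defect_ones[OF bu])
qed

lemma form_ones_blow_up:
  "form \<Gamma>' x (ones \<Gamma>') = form \<Gamma> x (ones \<Gamma>) - defect A v0 x * (1 - int (card A))"
proof -
  have "form \<Gamma> x (ones \<Gamma>') = form \<Gamma> x (ones \<Gamma>)"
    by (rule form_cong) (auto simp: ones_def blow_up_facts[OF bu])
  then show ?thesis by (simp add: form_blow_up[OF bu] defect_ones[OF bu])
qed

lemma Theta_blow_up: "Theta \<Gamma>' k' = Theta \<Gamma> k"
proof -
  have "form \<Gamma> (ones \<Gamma>') (ones \<Gamma>) = form \<Gamma> (ones \<Gamma>) (ones \<Gamma>)"
    by (rule form_cong) (auto simp: ones_def blow_up_facts[OF bu])
  then show ?thesis
    using A by (auto simp: Theta_def dotp_ones_blow_up form_ones_blow_up defect_ones[OF bu])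
qed

text \<open>
  The exponents agree with those of \<open>x\<close> at all points of the fibre at which \<open>F_vec\<close> may be nonzero.
\<close>

lemma exponents_over:
  assumes "e = 0 \<or> card A = 1 \<and> e = - 1"
  shows "epsilon \<Gamma>' k' (over x e) = epsilon \<Gamma> k x" "theta \<Gamma>' k' (over x e) = theta \<Gamma> k x"
proof -
  have "form \<Gamma> (over x e) (ones \<Gamma>) = form \<Gamma> x (ones \<Gamma>)"
    by (rule form_cong) (auto simp: over_eq)
  then have 1: "form \<Gamma>' (over x e) (ones \<Gamma>') = form \<Gamma> x (ones \<Gamma>)"
    using assms by (auto simp: form_ones_blow_up defect_over)
  have 2: "chi \<Gamma>' k' (over x e) = chi \<Gamma> k x" using assms A by (auto simp: chi_over)
  show "epsilon \<Gamma>' k' (over x e) = epsilon \<Gamma> k x" "theta \<Gamma>' k' (over x e) = theta \<Gamma> k x"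
    using Delta_blow_up[OF bu nd k'0 k'v A] by (simp_all add: epsilon_def theta_def 1 2 Theta_blow_up)
qed

text \<open>
  The weights push forward. The set \<open>I\<close> stands for the defects of the points of the fibre that lie
  in a sublevel set; it contains both minima \<open>0\<close> and \<open>s\<close> once the level is at least that of \<open>x\<close>.
\<close>

lemma sum_over_weights:
  assumes fin: "finite I" and I: "0 \<in> I" "s \<in> I"
  shows "(\<Sum>e\<in>I. Poly_Mapping.single (epsilon \<Gamma>' k' (over x e), theta \<Gamma>' k' (over x e))
      (F_vec F \<Gamma>' k' (over x e))) =
    Poly_Mapping.single (epsilon \<Gamma> k x, theta \<Gamma> k x) (F_vec F \<Gamma> k x)" (is "(\<Sum>e\<in>I. ?w e) = ?rhs")
proof -
  note f = blow_up_facts[OF bu]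
  let ?r = "\<lambda>v. 2 * mat_vec \<Gamma> (plumb_mat \<Gamma>) x v + k v - mat_vec \<Gamma> (plumb_mat \<Gamma>) (ones \<Gamma>) v"
  have F2: "F 2 0 = 1" "\<And>r. r \<noteq> 0 \<Longrightarrow> F 2 r = 0"
    and rec: "\<And>n r. F n r = F (Suc n) (r + 1) - F (Suc n) (r - 1)"
    using adm by (auto simp: admissible_def)
  from A show ?thesis
  proof
    assume a: "card A = 2 \<and> s = 1"
    have deg: "vdeg \<Gamma>' v = vdeg \<Gamma> v" if "v \<in> verts \<Gamma>" for v
      using vdeg_blow_up[OF bu that] a by (auto split: if_splits)
    have w0: "?w e = 0" if "e \<noteq> 0" for e
      using that a F2(2)[of "- (2 * e)"] by (simp add: F_vec_over)
    have "(\<Sum>e\<in>I. ?w e) = (\<Sum>e\<in>{0}. ?w e)"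
      by (rule sum.mono_neutral_right) (use fin I w0 in auto)
    also have "\<dots> = ?w 0" by simp
    also have "F_vec F \<Gamma>' k' (over x 0) = F_vec F \<Gamma> k x"
      unfolding F_vec_over F_vec_def[of F \<Gamma> k] using a F2(1) by (auto simp: deg intro!: prod.cong)
    finally show ?thesis by (simp add: exponents_over)
  next
    assume a: "card A = 1 \<and> s = - 1"
    then obtain a1 where a1: "A = {a1}" by (meson card_1_singletonE)
    then have a1V: "a1 \<in> verts \<Gamma>" using f by auto
    have deg: "vdeg \<Gamma>' v = vdeg \<Gamma> v + (if v = a1 then 1 else 0)" if "v \<in> verts \<Gamma>" for v
      using vdeg_blow_up[OF bu that] a a1 by (auto split: if_splits)
    define R where "R = (\<Prod>v\<in>verts \<Gamma> - {a1}. F (vdeg \<Gamma> v) (?r v))"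
    have F1: "F (Suc 0) r = F 2 (r + 1) - F 2 (r - 1)" for r
      using rec[of 1 r] by (simp add: numeral_2_eq_2)
    have Fe: "F_vec F \<Gamma>' k' (over x e) =
      F (Suc 0) (- 1 - 2 * e) * (F (Suc (vdeg \<Gamma> a1)) (?r a1 + (2 * e + 1)) * R)" for e
    proof -
      have "(\<Prod>v\<in>verts \<Gamma>. F (vdeg \<Gamma>' v) (?r v + (if v \<in> A then 2 * e - (s + 1 - int (card A)) else 0)))
        = F (vdeg \<Gamma>' a1) (?r a1 + (2 * e + 1)) *
          (\<Prod>v\<in>verts \<Gamma> - {a1}. F (vdeg \<Gamma>' v) (?r v + (if v \<in> A then 2 * e - (s + 1 - int (card A)) else 0)))"
        using a a1 by (subst prod.remove[OF f(1) a1V]) simp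
      also have "(\<Prod>v\<in>verts \<Gamma> - {a1}. F (vdeg \<Gamma>' v) (?r v + (if v \<in> A then 2 * e - (s + 1 - int (card A)) else 0))) = R"
        unfolding R_def by (rule prod.cong) (auto simp: a1 deg)
      finally show ?thesis unfolding F_vec_over using a by (simp add: deg[OF a1V])
    qed
    have w0: "?w e = 0" if "e \<notin> {0, - 1}" for e
      using that F2(2)[of "- (2 * e)"] F2(2)[of "- 2 - 2 * e"] by (simp add: Fe F1)
    have "(\<Sum>e\<in>I. ?w e) = (\<Sum>e\<in>{0, - 1}. ?w e)"
      by (rule sum.mono_neutral_right) (use fin I w0 a in auto)
    also have "\<dots> = ?w 0 + ?w (- 1)" by simp
    also have "\<dots> = Poly_Mapping.single (epsilon \<Gamma> k x, theta \<Gamma> k x)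
        (F_vec F \<Gamma>' k' (over x 0) + F_vec F \<Gamma>' k' (over x (- 1)))"
      using a by (simp add: exponents_over single_add)
    also have "F_vec F \<Gamma>' k' (over x 0) + F_vec F \<Gamma>' k' (over x (- 1)) =
      (F (Suc (vdeg \<Gamma> a1)) (?r a1 + 1) - F (Suc (vdeg \<Gamma> a1)) (?r a1 - 1)) * R"
      unfolding Fe F1 using F2 by (simp add: left_diff_distrib)
    also have "\<dots> = F_vec F \<Gamma> k x"
      unfolding F_vec_def R_def rec[symmetric] by (rule prod.remove[OF f(1) a1V, symmetric])
    finally show ?thesis .
  qed
qed

lemma lattice_root_blow_up:
  "wgraph_isomorphic (lattice_root F \<Gamma>' k') (lattice_root F \<Gamma> k)"
  unfolding lattice_root_def
proof (rule merge_tree_iso[where p = "\<lambda>x'. x'(v0 := 0)" and c = 0, OF sym_unit_steps sym_unit_steps])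
  note f = blow_up_facts[OF bu]
  have nd': "negative_definite \<Gamma>'" using nd negative_definite_blow_up[OF bu] by simp
  have q0: "0 \<le> e * (e - s) div 2" for e :: int
  proof -
    have "0 \<le> e * (e - s)" using A by (cases "e \<ge> 1") (auto intro: mult_nonneg_nonneg mult_nonpos_nonpos simp: zero_le_mult_iff)
    then show ?thesis by simp
  qed
  have over: "\<exists>e. x' = over (x'(v0 := 0)) e" if "x' \<in> vecs \<Gamma>'" for x'
    using over_project[OF that refl] by blast
  have pv: "x'(v0 := 0) \<in> vecs \<Gamma>" if "x' \<in> vecs \<Gamma>'" for x' :: "'v \<Rightarrow> int"
    using that f by (auto simp: vecs_def)
  show fin': "finite (sub_pts (vecs \<Gamma>') (chi \<Gamma>' k') j)" for j by (rule finite_sublevel_pts[OF f(7) nd'])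
  have "(\<lambda>_. 0) \<in> vecs \<Gamma>'" by (simp add: vecs_def)
  then show "vecs \<Gamma>' \<noteq> ({} :: ('v \<Rightarrow> int) set)" by blast
  show "x'(v0 := 0) \<in> vecs \<Gamma> \<and> chi \<Gamma> k (x'(v0 := 0)) \<le> chi \<Gamma>' k' x' + 0" if x': "x' \<in> vecs \<Gamma>'" for x'
  proof -
    obtain e where "x' = over (x'(v0 := 0)) e" using over[OF x'] ..
    then have "chi \<Gamma>' k' x' = chi \<Gamma> k (x'(v0 := 0)) + e * (e - s) div 2" using chi_over by metis
    then show ?thesis using pv[OF x'] q0[of e] by simp
  qed
  show "\<exists>x'\<in>vecs \<Gamma>'. x'(v0 := 0) = x \<and> chi \<Gamma>' k' x' + 0 = chi \<Gamma> k x" if x: "x \<in> vecs \<Gamma>" for x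
    using over_in_vecs[OF x] project_over[OF x] chi_over[of x 0] by force
  show "x'(v0 := 0) = y'(v0 := 0) \<or> (x'(v0 := 0), y'(v0 := 0)) \<in> unit_steps \<Gamma>"
    if xy': "x' \<in> vecs \<Gamma>'" "y' \<in> vecs \<Gamma>'" "(x', y') \<in> unit_steps \<Gamma>'" for x' y'
  proof -
    have *: "(x'(v0 := 0), (x'(v := x' v + 1))(v0 := 0)) \<in> unit_steps \<Gamma> \<or>
        x'(v0 := 0) = (x'(v := x' v + 1))(v0 := 0)" if "v \<in> verts \<Gamma>'" for x' :: "'v \<Rightarrow> int" and v
    proof (cases "v = v0")
      case False
      then have "v \<in> verts \<Gamma>" using that f by auto
      moreover have "(x'(v := x' v + 1))(v0 := 0) = (x'(v0 := 0))(v := (x'(v0 := 0)) v + 1)"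
        using False by auto
      ultimately show ?thesis unfolding unit_steps_def by blast
    qed simp
    obtain v where "v \<in> verts \<Gamma>'" "y' = x'(v := x' v + 1) \<or> x' = y'(v := y' v + 1)"
      using xy'(3) unfolding unit_steps_def by blast
    then show ?thesis using *[of v x'] *[of v y'] symD[OF sym_unit_steps] by metis
  qed
  show "\<exists>x'\<in>vecs \<Gamma>'. \<exists>y'\<in>vecs \<Gamma>'. x'(v0 := 0) = x \<and> y'(v0 := 0) = y \<and>
      chi \<Gamma>' k' x' + 0 = chi \<Gamma> k x \<and> chi \<Gamma>' k' y' + 0 = chi \<Gamma> k y \<and> (x', y') \<in> unit_steps \<Gamma>'"
    if xy: "x \<in> vecs \<Gamma>" "y \<in> vecs \<Gamma>" "(x, y) \<in> unit_steps \<Gamma>" for x y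
  proof -
    have *: "\<exists>e d. (over x e, over y d) \<in> unit_steps \<Gamma>' \<and> e * (e - s) = 0 \<and> d * (d - s) = 0"
      if "v \<in> verts \<Gamma>" "y = x(v := x v + 1)" for x y v
    proof -
      have v: "v \<noteq> v0" "v \<in> verts \<Gamma>'" using that f by auto
      have "(\<Sum>u\<in>A. y u) = (\<Sum>u\<in>A. x u + (if u = v then 1 else 0))"
        by (rule sum.cong) (auto simp: that)
      then have sum: "(\<Sum>u\<in>A. y u) = (\<Sum>u\<in>A. x u) + (if v \<in> A then 1 else 0)"
        using f(5) by (simp add: sum.distrib)
      \<comment> \<open>With the coordinate at \<open>v0\<close> fixed, a step in a direction of \<open>A\<close> lowers the defect by \<open>1\<close>,
        so it has to run between the two minima \<open>0\<close> and \<open>s\<close>.\<close>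
      define e where "e = (if v \<in> A \<and> s = 1 then 1 else 0 :: int)"
      define d where "d = e - (if v \<in> A then 1 else 0)"
      have "over y d = (over x e)(v := over x e v + 1)"
      proof
        fix u show "over y d u = ((over x e)(v := over x e v + 1)) u"
        proof (cases "u = v0")
          case True
          then show ?thesis using v by (simp add: over_def sum d_def)
        next
          case False
          then show ?thesis using v by (simp add: over_def that(2))
        qed
      qed
      then have "(over x e, over y d) \<in> unit_steps \<Gamma>'" using v(2) unfolding unit_steps_def by blast
      moreover have "e * (e - s) = 0" "d * (d - s) = 0" using A by (auto simp: e_def d_def)
      ultimately show ?thesis by blast
    qed
    obtain v where v: "v \<in> verts \<Gamma>" "y = x(v := x v + 1) \<or> x = y(v := y v + 1)"
      using xy(3) unfolding unit_steps_def by blast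
    obtain e d where "(over x e, over y d) \<in> unit_steps \<Gamma>'" "e * (e - s) = 0" "d * (d - s) = 0"
      using v *[of v y x] *[of v x y] symD[OF sym_unit_steps] by metis
    then show ?thesis
      using over_in_vecs project_over chi_over xy
      by (intro bexI[of _ "over x e"] bexI[of _ "over y d"]) auto
  qed
  show "(x', y') \<in> path_rel (vecs \<Gamma>') (unit_steps \<Gamma>') (chi \<Gamma>' k') (max (chi \<Gamma>' k' x') (chi \<Gamma>' k' y'))"
    if xy: "x' \<in> vecs \<Gamma>'" "y' \<in> vecs \<Gamma>'" "x'(v0 := 0) = y'(v0 := 0)" for x' y'
  proof -
    define x where "x = x'(v0 := 0)"
    have x: "x \<in> vecs \<Gamma>" using pv[OF xy(1)] by (simp add: x_def)
    obtain a b where ab: "x' = over x a" "y' = over x b" using over xy unfolding x_def by metis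
    have "(over x (e + 1)) = (over x e)(v0 := over x e v0 + 1)" for e by (auto simp: over_def)
    then have step: "(over x e, over x (e + 1)) \<in> unit_steps \<Gamma>'" for e
      unfolding unit_steps_def using f(4) by blast
    let ?m = "\<lambda>a b. max (chi \<Gamma>' k' (over x a)) (chi \<Gamma>' k' (over x b))"
    have path: "(over x a, over x b) \<in> path_rel (vecs \<Gamma>') (unit_steps \<Gamma>') (chi \<Gamma>' k') (?m a b)"
      if "a \<le> b" for a b
    proof (rule path_rel_interval[where g = "over x", OF that _ step])
      fix e assume e: "a \<le> e" "e \<le> b"
      \<comment> \<open>A convex function on an interval is bounded by its values at the ends.\<close>
      have "e * (e - s) \<le> a * (a - s) \<or> e * (e - s) \<le> b * (b - s)"
      proof (cases "2 * e \<ge> s")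
        case True
        have "0 \<le> (b - e) * (b + e - s)" using e True by (intro mult_nonneg_nonneg) auto
        then show ?thesis by (simp add: algebra_simps)
      next
        case False
        have "0 \<le> (e - a) * (s - a - e)" using e False by (intro mult_nonneg_nonneg) auto
        then show ?thesis by (simp add: algebra_simps)
      qed
      then have "e * (e - s) div 2 \<le> a * (a - s) div 2 \<or> e * (e - s) div 2 \<le> b * (b - s) div 2"
        using zdiv_mono1[of _ _ 2] by auto
      then show "over x e \<in> sub_pts (vecs \<Gamma>') (chi \<Gamma>' k') (?m a b)"
        using over_in_vecs[OF x] by (auto simp: sub_pts_def chi_over)
    qed
    show ?thesis
    proof (cases "a \<le> b")
      case True
      then show ?thesis using path ab by simp
    next
      case False
      then have "(y', x') \<in> path_rel (vecs \<Gamma>') (unit_steps \<Gamma>') (chi \<Gamma>' k') (?m b a)"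
        using path[of b a] ab by simp
      then show ?thesis using path_rel_sym[OF sym_unit_steps] ab by (simp add: max.commute)
    qed
  qed
  show "(\<Sum>x'\<in>{x'\<in>sub_pts (vecs \<Gamma>') (chi \<Gamma>' k') j. x'(v0 := 0) = x}.
      Poly_Mapping.single (epsilon \<Gamma>' k' x', theta \<Gamma>' k' x') (F_vec F \<Gamma>' k' x')) =
    Poly_Mapping.single (epsilon \<Gamma> k x, theta \<Gamma> k x) (F_vec F \<Gamma> k x)"
    if x: "x \<in> vecs \<Gamma>" "chi \<Gamma> k x \<le> j + 0" for x j
  proof -
    let ?X = "{x'\<in>sub_pts (vecs \<Gamma>') (chi \<Gamma>' k') j. x'(v0 := 0) = x}"
    define I where "I = {e. over x e \<in> ?X}"
    have inj: "inj_on (over x) I"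
      by (rule inj_onI) (metis defect_over)
    have X: "?X = over x ` I"
      using over_project by (fastforce simp: I_def sub_pts_def)
    have "finite ?X" using fin'[of j] by simp
    then have finI: "finite I" using inj X finite_imageD by metis
    have mem: "e \<in> I" if "e * (e - s) = 0" for e
    proof -
      have "chi \<Gamma>' k' (over x e) = chi \<Gamma> k x" unfolding chi_over that by simp
      then show ?thesis
        using over_in_vecs[OF x(1)] project_over[OF x(1)] x(2) by (simp add: I_def sub_pts_def)
    qed
    show ?thesis
      unfolding X sum.reindex[OF inj] o_def
      by (rule sum_over_weights[OF finI]) (auto intro: mem)
  qed
qed

end

section \<open>Change of representative\<close>

lemma even_symmetric_sum:
  fixes f :: "'v \<Rightarrow> 'v \<Rightarrow> int"
  assumes "finite S" "\<And>v w. f v w = f w v"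
  shows "even ((\<Sum>v\<in>S. \<Sum>w\<in>S. f v w) - (\<Sum>v\<in>S. f v v))"
  using assms(1)
proof (induction S rule: finite_induct)
  case (insert a S)
  have "(\<Sum>v\<in>S. f v a) = (\<Sum>v\<in>S. f a v)" using assms(2) by simp
  then have "(\<Sum>v\<in>insert a S. \<Sum>w\<in>insert a S. f v w) - (\<Sum>v\<in>insert a S. f v v) =
    2 * (\<Sum>v\<in>S. f a v) + ((\<Sum>v\<in>S. \<Sum>w\<in>S. f v w) - (\<Sum>v\<in>S. f v v))"
    using insert.hyps by (simp add: sum.distrib)
  then show ?case using insert.IH by simp
qed simp

text \<open>
  Characteristic vectors make the division in the definition of \<open>\<chi>\<^sub>k\<close> exact.
\<close>

lemma even_chi:
  assumes fin: "finite (verts \<Gamma>)" and k: "k \<in> char_vecs \<Gamma>"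
  shows "even (dotp \<Gamma> k x + form \<Gamma> x x)"
proof -
  let ?V = "verts \<Gamma>"
  have "even (form \<Gamma> x x - (\<Sum>v\<in>?V. x v * plumb_mat \<Gamma> v v * x v))"
    unfolding form_expand
    by (rule even_symmetric_sum[OF fin]) (simp add: plumb_mat_sym[of \<Gamma>] mult_ac)
  moreover have "even (\<Sum>v\<in>?V. k v * x v + x v * plumb_mat \<Gamma> v v * x v)"
  proof (rule dvd_sum)
    fix v assume v: "v \<in> ?V"
    then have "even (k v - wt \<Gamma> v)" using k by (simp add: char_vecs_def)
    then show "even (k v * x v + x v * plumb_mat \<Gamma> v v * x v)"
      using v by (auto simp: plumb_mat_def)
  qed
  then have "even (dotp \<Gamma> k x + (\<Sum>v\<in>?V. x v * plumb_mat \<Gamma> v v * x v))"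
    by (simp add: sum.distrib dotp_def)
  ultimately show ?thesis by auto
qed

context
  fixes \<Gamma> :: "'v plumbing" and k a k2 :: "'v \<Rightarrow> int"
  assumes fin: "finite (verts \<Gamma>)" and nd: "negative_definite \<Gamma>" and k: "k \<in> char_vecs \<Gamma>"
    and a: "a \<in> vecs \<Gamma>" and k2: "k2 = (\<lambda>v. k v + 2 * mat_vec \<Gamma> (plumb_mat \<Gamma>) a v)"
begin

lemma chi_translate: "chi \<Gamma> k (\<lambda>v. x v + a v) = chi \<Gamma> k2 x + chi \<Gamma> k a"
proof -
  obtain m where m: "dotp \<Gamma> k a + form \<Gamma> a a = 2 * m"
    using even_chi[OF fin k, of a] by (elim evenE)
  have "dotp \<Gamma> k (\<lambda>v. x v + a v) + form \<Gamma> (\<lambda>v. x v + a v) (\<lambda>v. x v + a v) =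
    (dotp \<Gamma> k x + 2 * form \<Gamma> a x + form \<Gamma> x x) + (dotp \<Gamma> k a + form \<Gamma> a a)"
    by (simp add: dotp_add_right form_add_left form_add_right form_sym[of \<Gamma> x a])
  also have "dotp \<Gamma> k x + 2 * form \<Gamma> a x = dotp \<Gamma> k2 x"
    by (simp add: k2 dotp_add_left dotp_scale_left dotp_mat_vec)
  finally show ?thesis unfolding chi_def m by simp
qed

text \<open>
  Passing from \<open>k\<close> to \<open>k + 2Ma\<close> replaces a solution \<open>z\<close> of \<open>M z = y\<close> by \<open>z + 2a\<close>, and so it adds
  \<open>4 (y \<cdot> a + \<langle>a, a\<rangle>)\<close> to the square \<open>y \<cdot> z\<close>.
\<close>

lemma Delta_translate: "Delta \<Gamma> k2 = Delta \<Gamma> k + of_int (2 * chi \<Gamma> k a + form \<Gamma> a (ones \<Gamma>))"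
proof -
  let ?M = "plumb_mat \<Gamma>"
  let ?y = "\<lambda>v. k v - mat_vec \<Gamma> ?M (ones \<Gamma>) v" and ?y2 = "\<lambda>v. k2 v - mat_vec \<Gamma> ?M (ones \<Gamma>) v"
  let ?a = "\<lambda>v. rat_of_int (a v)" and ?q = "\<lambda>v. rat_of_int (?y v)"
  obtain z where z: "\<And>v. v \<in> verts \<Gamma> \<Longrightarrow> mat_vec \<Gamma> ?M z v = ?q v"
    using plumb_mat_solve[OF fin nd, of ?q] by blast
  let ?z2 = "\<lambda>v. z v + 2 * ?a v"
  have y2: "rat_of_int (?y2 v) = ?q v + 2 * mat_vec \<Gamma> ?M ?a v" for v
    by (simp add: k2 mat_vec_of_int)
  have D: "Delta \<Gamma> k = - ((dotp \<Gamma> ?q z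
      + 3 * of_nat (card (verts \<Gamma>)) + of_int (\<Sum>v\<in>verts \<Gamma>. wt \<Gamma> v)) / 4)"
    by (rule Delta_eq[OF fin nd]) (rule z)
  have D2: "Delta \<Gamma> k2 = - ((dotp \<Gamma> (\<lambda>v. of_int (?y2 v)) ?z2
      + 3 * of_nat (card (verts \<Gamma>)) + of_int (\<Sum>v\<in>verts \<Gamma>. wt \<Gamma> v)) / 4)"
  proof (rule Delta_eq[OF fin nd])
    fix v assume v: "v \<in> verts \<Gamma>"
    show "mat_vec \<Gamma> ?M ?z2 v = of_int (?y2 v)"
      unfolding y2 mat_vec_add mat_vec_scale z[OF v] ..
  qed
  have az: "form \<Gamma> ?a z = dotp \<Gamma> ?q ?a"
    unfolding form_def dotp_sym[of \<Gamma> ?q] by (rule dotp_cong) (simp_all add: z)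
  have "dotp \<Gamma> (\<lambda>v. of_int (?y2 v)) ?z2 = dotp \<Gamma> ?q z + 4 * dotp \<Gamma> ?q ?a + 4 * form \<Gamma> ?a ?a"
    unfolding y2 dotp_add_left dotp_add_right dotp_scale_left dotp_scale_right dotp_mat_vec az
    by simp
  then have "Delta \<Gamma> k2 = Delta \<Gamma> k - (dotp \<Gamma> ?q ?a + form \<Gamma> ?a ?a)"
    unfolding D D2 by (simp add: field_simps)
  also have "dotp \<Gamma> ?q ?a = of_int (dotp \<Gamma> ?y a)" by (rule dotp_of_int)
  also have "dotp \<Gamma> ?y a = dotp \<Gamma> k a - form \<Gamma> a (ones \<Gamma>)"
    using dotp_mat_vec[of \<Gamma> "ones \<Gamma>" a] form_sym[of \<Gamma> a "ones \<Gamma>"]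
    by (simp add: dotp_def left_diff_distrib sum_subtractf)
  also have "form \<Gamma> ?a ?a = of_int (form \<Gamma> a a)" by (rule form_of_int)
  finally have "Delta \<Gamma> k2 = Delta \<Gamma> k + of_int (form \<Gamma> a (ones \<Gamma>) - (dotp \<Gamma> k a + form \<Gamma> a a))"
    by simp
  moreover have "2 * chi \<Gamma> k a = - (dotp \<Gamma> k a + form \<Gamma> a a)"
    using even_chi[OF fin k, of a] unfolding chi_def by auto
  ultimately show ?thesis by simp
qed

text \<open>
  The translation by \<open>a\<close> raises the level by the constant \<open>\<chi>\<^sub>k(a)\<close>.
\<close>

lemma lattice_root_translate: "wgraph_isomorphic (lattice_root F \<Gamma> k2) (lattice_root F \<Gamma> k)"
  unfolding lattice_root_def
proof (rule merge_tree_iso_bij[where p = "\<lambda>x v. x v + a v" and c = "chi \<Gamma> k a",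
      OF sym_unit_steps sym_unit_steps])
  show "finite (sub_pts (vecs \<Gamma>) (chi \<Gamma> k2) j)" for j by (rule finite_sublevel_pts[OF fin nd])
  show "vecs \<Gamma> \<noteq> ({} :: ('v \<Rightarrow> int) set)" using a by blast
  show "bij_betw (\<lambda>x v. x v + a v) (vecs \<Gamma>) (vecs \<Gamma>)"
    by (rule bij_betw_byWitness[where f' = "\<lambda>x v. x v - a v"]) (use a in \<open>auto simp: vecs_def\<close>)
  show "chi \<Gamma> k (\<lambda>v. x v + a v) = chi \<Gamma> k2 x + chi \<Gamma> k a" for x by (rule chi_translate)
  show "((\<lambda>v. x v + a v), (\<lambda>v. y v + a v)) \<in> unit_steps \<Gamma> \<longleftrightarrow> (x, y) \<in> unit_steps \<Gamma>" for x y
  proof -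
    have "(\<lambda>u. y u + a u) = (\<lambda>u. x u + a u)(v := x v + a v + 1) \<longleftrightarrow> y = x(v := x v + 1)" for x y v
      by (auto simp: fun_eq_iff)
    then show ?thesis by (simp add: unit_steps_def)
  qed
  fix x
  have e: "epsilon \<Gamma> k (\<lambda>v. x v + a v) = epsilon \<Gamma> k2 x"
    by (simp add: epsilon_def Delta_translate chi_translate form_add_left)
  have "dotp \<Gamma> k2 (ones \<Gamma>) = dotp \<Gamma> k (ones \<Gamma>) + 2 * form \<Gamma> a (ones \<Gamma>)"
    by (simp add: k2 dotp_add_left dotp_scale_left dotp_mat_vec)
  then have "Theta \<Gamma> k2 = Theta \<Gamma> k + form \<Gamma> a (ones \<Gamma>)"
    unfolding Theta_def by simp
  then have t: "theta \<Gamma> k (\<lambda>v. x v + a v) = theta \<Gamma> k2 x"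
    by (simp add: theta_def form_add_left)
  have "F_vec F \<Gamma> k (\<lambda>v. x v + a v) = F_vec F \<Gamma> k2 x"
    by (simp add: F_vec_def mat_vec_add k2 algebra_simps)
  then show "Poly_Mapping.single (epsilon \<Gamma> k (\<lambda>v. x v + a v), theta \<Gamma> k (\<lambda>v. x v + a v))
      (F_vec F \<Gamma> k (\<lambda>v. x v + a v)) =
    Poly_Mapping.single (epsilon \<Gamma> k2 x, theta \<Gamma> k2 x) (F_vec F \<Gamma> k2 x)"
    using e t by simp
qed

end

lemma lattice_root_spinc_class:
  assumes "finite (verts \<Gamma>)" "negative_definite \<Gamma>" "k \<in> char_vecs \<Gamma>" "k2 \<in> spinc_class \<Gamma> k"
  shows "wgraph_isomorphic (lattice_root F \<Gamma> k2) (lattice_root F \<Gamma> k)"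
  using assms lattice_root_translate unfolding spinc_class_def by blast

section \<open>Renaming of vertices\<close>

text \<open>
  Composition with a renaming \<open>f\<close> of the vertices of \<open>\<Gamma>\<close>, extended by \<open>0\<close>.
\<close>

definition pull_back :: "'v plumbing \<Rightarrow> ('v \<Rightarrow> 'v) \<Rightarrow> ('v \<Rightarrow> 'a::zero) \<Rightarrow> 'v \<Rightarrow> 'a" where
  "pull_back \<Gamma> f x = (\<lambda>v. if v \<in> verts \<Gamma> then x (f v) else 0)"

context
  fixes f :: "'v \<Rightarrow> 'v" and \<Gamma> \<Gamma>' :: "'v plumbing"
  assumes iso: "plumbing_iso f \<Gamma> \<Gamma>'" and fin: "finite (verts \<Gamma>)"
begin

lemma iso_bij: "bij_betw f (verts \<Gamma>) (verts \<Gamma>')"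
  using iso by (simp add: plumbing_iso_def)

lemma iso_mem: "v \<in> verts \<Gamma> \<Longrightarrow> f v \<in> verts \<Gamma>'"
  using iso_bij by (auto simp: bij_betw_def)

lemma iso_eq_iff: "v \<in> verts \<Gamma> \<Longrightarrow> w \<in> verts \<Gamma> \<Longrightarrow> f v = f w \<longleftrightarrow> v = w"
  using iso_bij by (auto simp: bij_betw_def inj_on_def)

lemma plumb_mat_iso:
  "v \<in> verts \<Gamma> \<Longrightarrow> w \<in> verts \<Gamma> \<Longrightarrow> plumb_mat \<Gamma>' (f v) (f w) = plumb_mat \<Gamma> v w"
  using iso by (simp add: plumb_mat_def iso_mem iso_eq_iff plumbing_iso_def)

lemma dotp_iso: "dotp \<Gamma>' x y = dotp \<Gamma> (pull_back \<Gamma> f x) (pull_back \<Gamma> f y)"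
proof -
  have "dotp \<Gamma>' x y = (\<Sum>v\<in>verts \<Gamma>. x (f v) * y (f v))"
    unfolding dotp_def by (rule sum.reindex_bij_betw[OF iso_bij, symmetric])
  then show ?thesis by (simp add: dotp_def pull_back_def)
qed

lemma mat_vec_iso:
  assumes "v \<in> verts \<Gamma>"
  shows "mat_vec \<Gamma>' (plumb_mat \<Gamma>') x (f v) = mat_vec \<Gamma> (plumb_mat \<Gamma>) (pull_back \<Gamma> f x) v"
proof -
  have "mat_vec \<Gamma>' (plumb_mat \<Gamma>') x (f v) = (\<Sum>w\<in>verts \<Gamma>. plumb_mat \<Gamma>' (f v) (f w) * x (f w))"
    unfolding mat_vec_def by (rule sum.reindex_bij_betw[OF iso_bij, symmetric])
  also have "\<dots> = mat_vec \<Gamma> (plumb_mat \<Gamma>) (pull_back \<Gamma> f x) v"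
    unfolding mat_vec_def by (rule sum.cong) (auto simp: plumb_mat_iso assms pull_back_def)
  finally show ?thesis .
qed

lemma form_iso: "form \<Gamma>' x y = form \<Gamma> (pull_back \<Gamma> f x) (pull_back \<Gamma> f y)"
proof -
  have "form \<Gamma>' x y = dotp \<Gamma> (pull_back \<Gamma> f x) (pull_back \<Gamma> f (mat_vec \<Gamma>' (plumb_mat \<Gamma>') y))"
    by (simp add: form_def dotp_iso)
  also have "\<dots> = form \<Gamma> (pull_back \<Gamma> f x) (pull_back \<Gamma> f y)"
    unfolding form_def by (rule dotp_cong) (auto simp: pull_back_def[of _ _ "mat_vec _ _ _"] mat_vec_iso)
  finally show ?thesis .
qed

lemma pull_back_ones: "pull_back \<Gamma> f (ones \<Gamma>') = ones \<Gamma>"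
  by (auto simp: pull_back_def ones_def iso_mem)

lemma bij_pull_back: "bij_betw (pull_back \<Gamma> f :: ('v \<Rightarrow> 'b::zero) \<Rightarrow> _) (vecs \<Gamma>') (vecs \<Gamma>)"
proof (rule bij_betw_byWitness[where f' = "\<lambda>x v'. if v' \<in> verts \<Gamma>' then x (inv_into (verts \<Gamma>) f v') else 0"])
  have g: "inv_into (verts \<Gamma>) f v' \<in> verts \<Gamma>" "f (inv_into (verts \<Gamma>) f v') = v'" if "v' \<in> verts \<Gamma>'" for v'
    using that iso_bij by (auto simp: bij_betw_def f_inv_into_f inv_into_into)
  show "\<forall>x\<in>(vecs \<Gamma>' :: ('v \<Rightarrow> 'b) set). (\<lambda>v'. if v' \<in> verts \<Gamma>' then pull_back \<Gamma> f x (inv_into (verts \<Gamma>) f v') else 0) = x"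
    by (auto simp: pull_back_def g vecs_def)
  show "\<forall>x\<in>(vecs \<Gamma> :: ('v \<Rightarrow> 'b) set). pull_back \<Gamma> f (\<lambda>v'. if v' \<in> verts \<Gamma>' then x (inv_into (verts \<Gamma>) f v') else 0) = x"
    using iso_bij by (auto simp: pull_back_def iso_mem vecs_def bij_betw_inv_into_left)
qed (auto simp: pull_back_def vecs_def)

lemma negative_definite_iso: "negative_definite \<Gamma>' \<longleftrightarrow> negative_definite \<Gamma>"
proof
  assume nd: "negative_definite \<Gamma>'"
  show "negative_definite \<Gamma>" unfolding negative_definite_def
  proof (intro allI impI)
    fix x :: "'v \<Rightarrow> real" assume x: "x \<in> vecs \<Gamma> \<and> x \<noteq> (\<lambda>_. 0)"
    then obtain x' where x': "x' \<in> vecs \<Gamma>'" "x = pull_back \<Gamma> f x'"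
      using bij_pull_back by (auto simp: bij_betw_def)
    have "x' \<noteq> (\<lambda>_. 0)" using x x'(2) by (auto simp: pull_back_def)
    then show "form \<Gamma> x x < 0" using nd x' by (simp add: negative_definite_def form_iso)
  qed
next
  assume nd: "negative_definite \<Gamma>"
  show "negative_definite \<Gamma>'" unfolding negative_definite_def
  proof (intro allI impI)
    fix x :: "'v \<Rightarrow> real" assume x: "x \<in> vecs \<Gamma>' \<and> x \<noteq> (\<lambda>_. 0)"
    have "(\<lambda>_. 0) \<in> vecs \<Gamma>'" "pull_back \<Gamma> f (\<lambda>_. 0 :: real) = (\<lambda>_. 0)"
      by (auto simp: vecs_def pull_back_def)
    then have "pull_back \<Gamma> f x \<noteq> (\<lambda>_. 0)" using x bij_pull_back by (metis bij_betw_def inj_onD)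
    moreover have "pull_back \<Gamma> f x \<in> vecs \<Gamma>" by (auto simp: pull_back_def vecs_def)
    ultimately show "form \<Gamma>' x x < 0" using nd by (simp add: negative_definite_def form_iso)
  qed
qed

lemma vdeg_iso:
  assumes "v \<in> verts \<Gamma>" shows "vdeg \<Gamma>' (f v) = vdeg \<Gamma> v"
proof -
  have "{w \<in> verts \<Gamma>'. {f v, w} \<in> edges \<Gamma>'} = f ` {w \<in> verts \<Gamma>. {v, w} \<in> edges \<Gamma>}"
  proof -
    have "{f v, f w} \<in> edges \<Gamma>' \<longleftrightarrow> {v, w} \<in> edges \<Gamma>" if "w \<in> verts \<Gamma>" for w
      using iso assms that by (simp add: plumbing_iso_def)
    moreover have "verts \<Gamma>' = f ` verts \<Gamma>" using iso_bij by (simp add: bij_betw_def)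
    ultimately show ?thesis by auto
  qed
  moreover have "inj_on f {w \<in> verts \<Gamma>. {v, w} \<in> edges \<Gamma>}"
    using iso_bij by (auto simp: bij_betw_def inj_on_def)
  ultimately show ?thesis by (simp add: vdeg_def card_image)
qed

lemma lattice_root_iso:
  assumes nd: "negative_definite \<Gamma>" and k: "\<forall>v\<in>verts \<Gamma>. k' (f v) = k v"
  shows "wgraph_isomorphic (lattice_root F \<Gamma>' k') (lattice_root F \<Gamma> k)"
  unfolding lattice_root_def
proof (rule merge_tree_iso_bij[where p = "pull_back \<Gamma> f" and c = 0,
      OF sym_unit_steps sym_unit_steps _ _ bij_pull_back])
  let ?p = "pull_back \<Gamma> f :: ('v \<Rightarrow> int) \<Rightarrow> _"
  have nd': "negative_definite \<Gamma>'" using nd negative_definite_iso by simp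
  have fin': "finite (verts \<Gamma>')" using fin iso_bij bij_betw_finite by blast
  show "finite (sub_pts (vecs \<Gamma>') (chi \<Gamma>' k') j)" for j by (rule finite_sublevel_pts[OF fin' nd'])
  have "(\<lambda>_. 0) \<in> vecs \<Gamma>'" by (simp add: vecs_def)
  then show "vecs \<Gamma>' \<noteq> ({} :: ('v \<Rightarrow> int) set)" by blast
  have dk: "dotp \<Gamma>' k' x = dotp \<Gamma> k (?p x)" for x
    unfolding dotp_iso by (rule dotp_cong) (auto simp: pull_back_def k)
  show chi: "chi \<Gamma> k (?p x) = chi \<Gamma>' k' x + 0" for x
    by (simp add: chi_def dk form_iso)
  show "(?p x, ?p y) \<in> unit_steps \<Gamma> \<longleftrightarrow> (x, y) \<in> unit_steps \<Gamma>'"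
    if xy: "x \<in> vecs \<Gamma>'" "y \<in> vecs \<Gamma>'" for x y
  proof -
    have "?p y = (?p x)(v := ?p x v + 1) \<longleftrightarrow> y = x(f v := x (f v) + 1)"
      if v: "v \<in> verts \<Gamma>" "x \<in> vecs \<Gamma>'" "y \<in> vecs \<Gamma>'" for x y v
    proof -
      have eq: "(?p x)(v := ?p x v + 1) = ?p (x(f v := x (f v) + 1))"
        using v by (auto simp: pull_back_def iso_eq_iff)
      have "x(f v := x (f v) + 1) \<in> vecs \<Gamma>'" by (rule vecs_update[OF v(2) iso_mem[OF v(1)]])
      then show ?thesis
        unfolding eq using inj_on_eq_iff[OF bij_betw_imp_inj_on[OF bij_pull_back] v(3)] by simp
    qed
    moreover have "verts \<Gamma>' = f ` verts \<Gamma>" using iso_bij by (simp add: bij_betw_def)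
    ultimately show ?thesis using xy by (simp add: unit_steps_def)
  qed
  have Delta: "Delta \<Gamma> k = Delta \<Gamma>' k'"
  proof -
    let ?y = "\<lambda>v. k v - mat_vec \<Gamma> (plumb_mat \<Gamma>) (ones \<Gamma>) v"
    let ?y' = "\<lambda>v. k' v - mat_vec \<Gamma>' (plumb_mat \<Gamma>') (ones \<Gamma>') v"
    obtain z where z: "\<And>v. v \<in> verts \<Gamma>' \<Longrightarrow> mat_vec \<Gamma>' (plumb_mat \<Gamma>') z v = rat_of_int (?y' v)"
      using plumb_mat_solve[OF fin' nd', of "\<lambda>v. of_int (?y' v)"] by blast
    have y: "?y' (f v) = ?y v" if "v \<in> verts \<Gamma>" for v
      using that k by (simp add: mat_vec_iso pull_back_ones)
    have D': "Delta \<Gamma>' k' = - ((dotp \<Gamma>' (\<lambda>v. of_int (?y' v)) z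
        + 3 * of_nat (card (verts \<Gamma>')) + of_int (\<Sum>v\<in>verts \<Gamma>'. wt \<Gamma>' v)) / 4)"
      by (rule Delta_eq[OF fin' nd']) (rule z)
    have D: "Delta \<Gamma> k = - ((dotp \<Gamma> (\<lambda>v. of_int (?y v)) (pull_back \<Gamma> f z)
        + 3 * of_nat (card (verts \<Gamma>)) + of_int (\<Sum>v\<in>verts \<Gamma>. wt \<Gamma> v)) / 4)"
    proof (rule Delta_eq[OF fin nd])
      fix v assume v: "v \<in> verts \<Gamma>"
      show "mat_vec \<Gamma> (plumb_mat \<Gamma>) (pull_back \<Gamma> f z) v = of_int (?y v)"
        unfolding mat_vec_iso[OF v, symmetric] z[OF iso_mem[OF v]] y[OF v] ..
    qed
    have "dotp \<Gamma>' (\<lambda>v. of_int (?y' v)) z = dotp \<Gamma> (\<lambda>v. of_int (?y v)) (pull_back \<Gamma> f z)"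
      unfolding dotp_iso by (rule dotp_cong) (simp_all add: pull_back_def y del: of_int_diff)
    moreover have "card (verts \<Gamma>') = card (verts \<Gamma>)"
      using bij_betw_same_card[OF iso_bij] by simp
    moreover have "(\<Sum>v\<in>verts \<Gamma>'. wt \<Gamma>' v) = (\<Sum>v\<in>verts \<Gamma>. wt \<Gamma> v)"
      using sum.reindex_bij_betw[OF iso_bij, of "wt \<Gamma>'"] iso by (simp add: plumbing_iso_def)
    ultimately show ?thesis unfolding D D' by simp
  qed
  fix x
  have "epsilon \<Gamma> k (?p x) = epsilon \<Gamma>' k' x"
    using chi[of x] by (simp add: epsilon_def Delta form_iso pull_back_ones)
  moreover have "theta \<Gamma> k (?p x) = theta \<Gamma>' k' x"
    by (simp add: theta_def Theta_def form_iso dk pull_back_ones)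
  moreover have "F_vec F \<Gamma> k (?p x) = F_vec F \<Gamma>' k' x"
    unfolding F_vec_def prod.reindex_bij_betw[OF iso_bij, symmetric]
    by (rule prod.cong) (simp_all add: vdeg_iso mat_vec_iso k pull_back_ones)
  ultimately show "Poly_Mapping.single (epsilon \<Gamma> k (?p x), theta \<Gamma> k (?p x)) (F_vec F \<Gamma> k (?p x)) =
    Poly_Mapping.single (epsilon \<Gamma>' k' x, theta \<Gamma>' k' x) (F_vec F \<Gamma>' k' x)" by simp
qed

end

section \<open>Neumann moves\<close>

lemma plumbing_tree_edges:
  assumes "plumbing_tree \<Gamma>" "{v, w} \<in> edges \<Gamma>"
  shows "v \<in> verts \<Gamma>" "w \<in> verts \<Gamma>" "v \<noteq> w"
proof -
  obtain a b where "a \<in> verts \<Gamma>" "b \<in> verts \<Gamma>" "a \<noteq> b" "{v, w} = {a, b}"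
    using assms unfolding plumbing_tree_def by meson
  then show "v \<in> verts \<Gamma>" "w \<in> verts \<Gamma>" "v \<noteq> w" by (auto simp: doubleton_eq_iff)
qed

lemma blow_up_edge_move:
  assumes t: "plumbing_tree \<Gamma>" and e: "{v1, v2} \<in> edges \<Gamma>" and v0: "v0 \<notin> verts \<Gamma>"
  shows "blow_up \<Gamma> {v1, v2} v0 (edge_move \<Gamma> v1 v2 v0)"
proof -
  note v = plumbing_tree_edges[OF t e]
  have n: "{v, v0} \<notin> edges \<Gamma>" "{v, v} \<notin> edges \<Gamma>" for v
    using plumbing_tree_edges[OF t, of v v0] plumbing_tree_edges[OF t, of v v] v0 by auto
  have "finite (verts \<Gamma>)" using t by (simp add: plumbing_tree_def)
  then show ?thesis
    unfolding blow_up_def edge_move_def using v v0 n e by (auto simp: doubleton_eq_iff insert_commute)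
qed

lemma blow_up_leaf_move:
  assumes t: "plumbing_tree \<Gamma>" and v1: "v1 \<in> verts \<Gamma>" and v0: "v0 \<notin> verts \<Gamma>"
  shows "blow_up \<Gamma> {v1} v0 (leaf_move \<Gamma> v1 v0)"
proof -
  have n: "{v, v0} \<notin> edges \<Gamma>" "{v, v} \<notin> edges \<Gamma>" for v
    using plumbing_tree_edges[OF t, of v v0] plumbing_tree_edges[OF t, of v v] v0 by auto
  have "finite (verts \<Gamma>)" using t by (simp add: plumbing_tree_def)
  then show ?thesis
    unfolding blow_up_def leaf_move_def using v1 v0 n by (auto simp: doubleton_eq_iff insert_commute)
qed

lemma char_vecs_blow_up:
  assumes bu: "blow_up \<Gamma> A v0 \<Gamma>'" and k: "k \<in> char_vecs \<Gamma>" and k'0: "k' v0 = s"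
    and k'v: "\<And>v. v \<noteq> v0 \<Longrightarrow> k' v = k v - (if v \<in> A then s else 0)" and s: "odd s"
  shows "k' \<in> char_vecs \<Gamma>'"
proof -
  note f = blow_up_facts[OF bu]
  have "k' v = 0" if "v \<notin> verts \<Gamma>'" for v
    using that f k k'v[of v] by (auto simp: char_vecs_def vecs_def)
  moreover have "even (k' v - wt \<Gamma>' v)" if "v \<in> verts \<Gamma>'" for v
  proof (cases "v = v0")
    case True
    then show ?thesis using bu k'0 s by (simp add: blow_up_def)
  next
    case False
    then have "v \<in> verts \<Gamma>" using that f by auto
    moreover from this have "wt \<Gamma>' v = wt \<Gamma> v - (if v \<in> A then 1 else 0)" using bu by (simp add: blow_up_def)
    moreover have "even (k v - wt \<Gamma> v)" using k \<open>v \<in> verts \<Gamma>\<close> by (simp add: char_vecs_def)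
    ultimately show ?thesis using k'v[OF False] s by auto
  qed
  ultimately show ?thesis by (simp add: char_vecs_def vecs_def)
qed

text \<open>
  The symmetric relation between plumbings with spin-c structures that a Neumann step establishes.
  The isomorphism is stated for one pair of representatives. Negative definiteness is a hypothesis
  of the isomorphism, because a step need not start from a negative definite plumbing.
\<close>

definition root_related ::
  "(nat \<Rightarrow> int \<Rightarrow> 'r::{comm_ring, comm_monoid_mult}) \<Rightarrow>
    'v plumbing \<times> ('v \<Rightarrow> int) set \<Rightarrow> 'v plumbing \<times> ('v \<Rightarrow> int) set \<Rightarrow> bool" where
  "root_related F X Y \<longleftrightarrow> (\<exists>\<Gamma> k \<Gamma>' k'.
     X = (\<Gamma>, spinc_class \<Gamma> k) \<and> Y = (\<Gamma>', spinc_class \<Gamma>' k') \<and>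
     k \<in> char_vecs \<Gamma> \<and> k' \<in> char_vecs \<Gamma>' \<and> finite (verts \<Gamma>) \<and> finite (verts \<Gamma>') \<and>
     (negative_definite \<Gamma> \<longleftrightarrow> negative_definite \<Gamma>') \<and>
     (negative_definite \<Gamma> \<longrightarrow> wgraph_isomorphic (lattice_root F \<Gamma> k) (lattice_root F \<Gamma>' k')))"

lemma root_related_sym: "root_related F X Y \<Longrightarrow> root_related F Y X"
  unfolding root_related_def using wgraph_isomorphic_sym by metis

lemma root_related_blow_up:
  assumes adm: "admissible F" and bu: "blow_up \<Gamma> A v0 \<Gamma>'" and k: "k \<in> char_vecs \<Gamma>"
    and k'0: "k' v0 = s" and k'v: "\<And>v. v \<noteq> v0 \<Longrightarrow> k' v = k v - (if v \<in> A then s else 0)"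
    and A: "card A = 2 \<and> s = 1 \<or> card A = 1 \<and> s = - 1"
  shows "root_related F (\<Gamma>, spinc_class \<Gamma> k) (\<Gamma>', spinc_class \<Gamma>' k')"
proof -
  note f = blow_up_facts[OF bu]
  have k'V: "k' v = k v - (if v \<in> A then s else 0)" if "v \<in> verts \<Gamma>" for v
    using that f(3) by (intro k'v) auto
  have "k' \<in> char_vecs \<Gamma>'" by (rule char_vecs_blow_up[OF bu k k'0 k'v]) (use A in auto)
  moreover have "wgraph_isomorphic (lattice_root F \<Gamma> k) (lattice_root F \<Gamma>' k')" if "negative_definite \<Gamma>"
    by (rule wgraph_isomorphic_sym, rule lattice_root_blow_up[where s = s and k = k and k' = k', OF adm bu that k'0 _ A])
      (rule k'V)
  ultimately show ?thesis
    unfolding root_related_def using k f negative_definite_blow_up[OF bu] by blast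
qed

lemma neumann_step_root_related:
  assumes adm: "admissible F" and "neumann_step X Y"
  shows "root_related F X Y"
  using assms(2)
proof cases
  case (type_a \<Gamma> v1 v2 v0 k)
  have v: "v1 \<noteq> v2" "v1 \<noteq> v0" "v2 \<noteq> v0"
    using plumbing_tree_edges[of \<Gamma> v1 v2] type_a by auto
  show ?thesis unfolding type_a(1,2)
    by (rule root_related_blow_up[OF adm blow_up_edge_move, where s = 1])
      (use type_a v in \<open>auto simp: edge_move_vec_def\<close>)
next
  case (type_b \<Gamma> v1 v0 k)
  have v: "v1 \<noteq> v0" using type_b by auto
  show ?thesis unfolding type_b(1,2)
    by (rule root_related_blow_up[OF adm blow_up_leaf_move, where s = "- 1"])
      (use type_b v in \<open>auto simp: leaf_move_vec_def\<close>)
next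
  case (rename \<Gamma> \<Gamma>' f k k')
  have fin: "finite (verts \<Gamma>)" "finite (verts \<Gamma>')"
    using rename by (auto simp: plumbing_tree_def)
  have "wgraph_isomorphic (lattice_root F \<Gamma> k) (lattice_root F \<Gamma>' k')" if "negative_definite \<Gamma>"
    by (rule wgraph_isomorphic_sym, rule lattice_root_iso[OF rename(5) fin(1) that rename(8)])
  then show ?thesis
    unfolding root_related_def using rename fin negative_definite_iso[OF rename(5) fin(1)] by blast
qed

theorem theorem1p1:
  fixes F :: "nat \<Rightarrow> int \<Rightarrow> 'r::{comm_ring, comm_monoid_mult}"
    and \<Gamma>1 \<Gamma>2 :: "'v plumbing"
  assumes "admissible F"
    and "plumbing_tree \<Gamma>1" and "negative_definite \<Gamma>1"
    and "plumbing_tree \<Gamma>2" and "negative_definite \<Gamma>2"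
    and "c1 \<in> spinc \<Gamma>1" and "c2 \<in> spinc \<Gamma>2"
    and "neumann_equiv (\<Gamma>1, c1) (\<Gamma>2, c2)"
    and "k1 \<in> c1" and "k2 \<in> c2"
  shows "wgraph_isomorphic (weighted_graded_root F \<Gamma>1 k1) (weighted_graded_root F \<Gamma>2 k2)"
proof -
  \<comment> \<open>Negative definiteness is carried along the chain of steps together with the isomorphism.\<close>
  define P where "P = (\<lambda>X :: 'v plumbing \<times> ('v \<Rightarrow> int) set. \<exists>\<Gamma> k. X = (\<Gamma>, spinc_class \<Gamma> k) \<and>
    k \<in> char_vecs \<Gamma> \<and> finite (verts \<Gamma>) \<and> negative_definite \<Gamma> \<and>
    wgraph_isomorphic (lattice_root F \<Gamma>1 k1) (lattice_root F \<Gamma> k))"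
  have fin1: "finite (verts \<Gamma>1)" using assms(2) by (simp add: plumbing_tree_def)
  have mem: "k \<in> spinc_class \<Gamma> k" for k :: "'v \<Rightarrow> int" and \<Gamma>
    unfolding spinc_class_def
    by (rule CollectI, rule exI[of _ "\<lambda>_. 0"]) (simp add: vecs_def mat_vec_def)
  have "equivclp neumann_step (\<Gamma>1, c1) (\<Gamma>2, c2)" using assms(8) by (simp add: neumann_equiv_def)
  then have "P (\<Gamma>2, c2)"
  proof (induction rule: equivclp_induct)
    case base
    obtain k where "k \<in> char_vecs \<Gamma>1" "c1 = spinc_class \<Gamma>1 k" using assms(6) by (auto simp: spinc_def)
    then show ?case unfolding P_def
      using fin1 assms(3,9) lattice_root_spinc_class[OF fin1 assms(3)] by blast
  next
    case (step Y Z)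
    have "root_related F Y Z"
      using step.hyps neumann_step_root_related[OF assms(1)] root_related_sym by blast
    then obtain \<Gamma> k \<Gamma>' k' where YZ: "Y = (\<Gamma>, spinc_class \<Gamma> k)" "Z = (\<Gamma>', spinc_class \<Gamma>' k')"
      "k \<in> char_vecs \<Gamma>" "k' \<in> char_vecs \<Gamma>'" "finite (verts \<Gamma>)" "finite (verts \<Gamma>')"
      "negative_definite \<Gamma> \<longleftrightarrow> negative_definite \<Gamma>'"
      "negative_definite \<Gamma> \<longrightarrow> wgraph_isomorphic (lattice_root F \<Gamma> k) (lattice_root F \<Gamma>' k')"
      unfolding root_related_def by blast
    obtain l where l: "spinc_class \<Gamma> k = spinc_class \<Gamma> l" "negative_definite \<Gamma>"
      "wgraph_isomorphic (lattice_root F \<Gamma>1 k1) (lattice_root F \<Gamma> l)"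
      using step.IH unfolding P_def YZ(1) by blast
    have "wgraph_isomorphic (lattice_root F \<Gamma> l) (lattice_root F \<Gamma> k)"
      by (rule lattice_root_spinc_class[OF YZ(5) l(2) YZ(3)]) (use mem l in blast)
    then have "wgraph_isomorphic (lattice_root F \<Gamma>1 k1) (lattice_root F \<Gamma>' k')"
      using l YZ(8) wgraph_isomorphic_trans by blast
    then show ?case unfolding P_def using YZ l by blast
  qed
  then obtain k where k: "c2 = spinc_class \<Gamma>2 k" "k \<in> char_vecs \<Gamma>2" "finite (verts \<Gamma>2)"
    "wgraph_isomorphic (lattice_root F \<Gamma>1 k1) (lattice_root F \<Gamma>2 k)"
    unfolding P_def by blast
  have "wgraph_isomorphic (lattice_root F \<Gamma>2 k2) (lattice_root F \<Gamma>2 k)"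
    by (rule lattice_root_spinc_class) (use k assms in auto)
  then have "wgraph_isomorphic (lattice_root F \<Gamma>1 k1) (lattice_root F \<Gamma>2 k2)"
    using k(4) wgraph_isomorphic_sym wgraph_isomorphic_trans by blast
  then have "wgraph_isomorphic (lattice_root F \<Gamma>1 k1) (weighted_graded_root F \<Gamma>2 k2)"
    by (rule wgraph_isomorphic_trans)
      (intro weighted_graded_root_iso_lattice_root finite_sublevel_pts k(3) assms(5))
  moreover have "wgraph_isomorphic (weighted_graded_root F \<Gamma>1 k1) (lattice_root F \<Gamma>1 k1)"
    by (intro wgraph_isomorphic_sym[OF weighted_graded_root_iso_lattice_root]
        finite_sublevel_pts fin1 assms(3))
  ultimately show ?thesis by (rule wgraph_isomorphic_trans[rotated])
qed

end
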